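(* Let $N_T\ge 2$, $N_R\ge N_T$ be integers, $N=N_R-N_T+1$, and let $H=H_d+H_r$ be the random $N_R\times N_T$ complex matrix of the full-Rician fading model with rank-one deterministic part $H_d=ab^{\mathsf H}$ and column covariance matrix $R$ described in the context. Let $\Gamma_s>0$, $\gamma_1=\Gamma_s/[(H^{\mathsf H}H)^{-1}]_{1,1}$, and let $\Gamma_1,x_1,x_2$ be as in the context. For a sequence $(H_{n})_{n\ge0}$ write $$S\big[(H_{n})\big]=e^{-x_2}\sum_{n_1=0}^\infty\sum_{n_2=0}^\infty\frac{(N)_{n_1}}{(n_2+N_R)_{n_1}}\frac{x_1^{n_1}}{n_1!}\frac{x_2^{n_2}}{n_2!}\,H_{n_1}.$$ Then, with $M_{n}(s)$, $p_{n}(t)$, $P_{\mathrm o,n}$, $C_{n}$ as defined in the context: (i) the moment generating function of $\gamma_1$ is $\mathbb E\{e^{s\gamma_1}\}=S[(M_{n}(s))]$ for complex $s$ with $\operatorname{Re}s<1/\Gamma_1$; (ii) the probability density function of $\gamma_1$ is $p_{\gamma_1}(t)=S[(p_{n}(t))]$, $t>0$; (iii) for every threshold $\tau>0$, the outage probability $P_{\mathrm o}=\int_0^\tau p_{\gamma_1}(t)\,dt$ equals $S[(P_{\mathrm o,n})]$; (iv) the ergodic capacity $C=\frac1{\ln2}\int_0^\infty\ln(1+t)\,p_{\gamma_1}(t)\,dt$ equals $S[(C_{n})]$.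
   Context: Notation: $\cdot^{\mathsf H}$ is conjugate transpose, $\cdot^*$ complex conjugation, $\|\cdot\|$ the Euclidean/Frobenius norm; $(\alpha)_0=1$, $(\alpha)_n=\alpha(\alpha+1)\cdots(\alpha+n-1)$. Model (full-Rician fading with rank-one mean). $K>0$ is a real number (Rician $K$-factor). $R_T$ is an $N_T\times N_T$ Hermitian positive definite matrix with trace $N_T$, and $R=\frac{1}{K+1}R_T$. $H_d=ab^{\mathsf H}$ where $a\in\mathbb C^{N_R}$, $\|a\|=1$, $b=(b_1,\dots,b_{N_T})^{\mathsf T}\in\mathbb C^{N_T}$ has all entries nonzero and $\|b\|^2=\frac{K}{K+1}N_RN_T$. $H_r=H_wR^{1/2}$, where $R^{1/2}$ is the Hermitian square root of $R$ and $H_w$ is $N_R\times N_T$ with i.i.d. standard circularly-symmetric complex Gaussian entries (mean $0$, $\mathbb E|\cdot|^2=1$). Thus the rows of $H_r$ are independent and $\mathbb E\{H_r^{\mathsf H}H_r\}=N_R R$. $H=H_d+H_r$ has rank $N_T$ almost surely. Partition $R=\begin{pmatrix} r_{11}& \rho^{\mathsf H}\\ \rho & R_{22}\end{pmatrix}$ with $r_{11}$ scalar, $\rho\in\mathbb C^{N_T-1}$, and $R_{22}$ of size $(N_T-1)\times(N_T-1)$. Put $r_{2,1}=R_{22}^{-1}\rho$, $\tilde b=(b_2,\dots,b_{N_T})^{\mathsf T}$, $\mu_1=b_1^*-\tilde b^{\mathsf H}r_{2,1}$, and $$\Gamma_1=\frac{\Gamma_s}{[R^{-1}]_{1,1}},\qquad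 x_1=[R^{-1}]_{1,1}\,|\mu_1|^2,\qquad x_2=\tilde b^{\mathsf H}R_{22}^{-1}\tilde b .$$ For integers $0\le m\le n$ let $$M_{n,m}(s)=\frac1{(1-s\Gamma_1)^{N+n-m}},\qquad p_{n,m}(t)=\frac{t^{N+n-m-1}e^{-t/\Gamma_1}}{(N+n-m-1)!\,\Gamma_1^{N+n-m}},$$ $$P_{\mathrm o,n,m}=\int_0^\tau p_{n,m}(t)\,dt=\frac{\gamma(N+n-m,\tau/\Gamma_1)}{(N+n-m-1)!},\qquad C_{n,m}=\frac1{\ln2}\int_0^\infty\ln(1+t)\,p_{n,m}(t)\,dt,$$ where $\gamma(k,x)=\int_0^x t^{k-1}e^{-t}dt$. For $X$ standing for each of $M(s)$, $p(t)$, $P_{\mathrm o}$, $C$, define $X_{n}=\sum_{m=0}^{n}\binom{n}{m}(-1)^{m}X_{n,m}$, i.e. $M_n(s)=\sum_m\binom nm(-1)^mM_{n,m}(s)$, $p_n(t)=\sum_m\binom nm(-1)^mp_{n,m}(t)$, $P_{\mathrm o,n}=\sum_m\binom nm(-1)^mP_{\mathrm o,n,m}$, $C_n=\sum_m\binom nm(-1)^mC_{n,m}$. *)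

theory Defs
  imports
    "HOL-Probability.Probability"
    "Jordan_Normal_Form.Gauss_Jordan_Elimination"
    "Jordan_Normal_Form.Determinant"
    "Jordan_Normal_Form.Schur_Decomposition"
begin

text \<open>
  Matrices and vectors have explicit dimensions and are indexed from 0, so the entry written
  (1,1) in the mathematical text is \<open>A $$ (0,0)\<close> and the entry \<open>b\<^sub>1\<close> is \<open>b $ 0\<close>.
\<close>

subsection \<open>Linear algebra\<close>

definition hermitian_mat :: "nat \<Rightarrow> complex mat \<Rightarrow> bool" where
  "hermitian_mat n A \<longleftrightarrow> A \<in> carrier_mat n n \<and> mat_adjoint A = A"

text \<open>\<open>(A *\<^sub>v v) \<bullet>c v\<close> is the quadratic form of \<open>A\<close> at \<open>v\<close>; the product \<open>\<bullet>c\<close> conjugates its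
  second argument.\<close>

definition hermitian_pos_def :: "nat \<Rightarrow> complex mat \<Rightarrow> bool" where
  "hermitian_pos_def n A \<longleftrightarrow> hermitian_mat n A \<and>
     (\<forall>v \<in> carrier_vec n. v \<noteq> 0\<^sub>v n \<longrightarrow> 0 < Re ((A *\<^sub>v v) \<bullet>c v))"

definition hermitian_pos_semidef :: "nat \<Rightarrow> complex mat \<Rightarrow> bool" where
  "hermitian_pos_semidef n A \<longleftrightarrow> hermitian_mat n A \<and>
     (\<forall>v \<in> carrier_vec n. 0 \<le> Re ((A *\<^sub>v v) \<bullet>c v))"

definition hermitian_sqrt :: "complex mat \<Rightarrow> complex mat" where
  "hermitian_sqrt A = (THE S. hermitian_pos_semidef (dim_row A) S \<and> S * S = A)"

text \<open>Unspecified for singular matrices.\<close>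

definition mat_inv :: "complex mat \<Rightarrow> complex mat" where
  "mat_inv A = the (mat_inverse A)"

definition euclid_norm :: "complex vec \<Rightarrow> real" where
  "euclid_norm v = sqrt (\<Sum>i<dim_vec v. (cmod (v $ i))\<^sup>2)"

definition outer_prod :: "complex vec \<Rightarrow> complex vec \<Rightarrow> complex mat" where
  "outer_prod a b = mat (dim_vec a) (dim_vec b) (\<lambda>(i,j). a $ i * cnj (b $ j))"

subsection \<open>The channel\<close>

definition std_complex_normal :: "'w measure \<Rightarrow> ('w \<Rightarrow> complex) \<Rightarrow> bool" where
  "std_complex_normal M X \<longleftrightarrow> distributed M lborel X (\<lambda>z. ennreal (exp (- (cmod z)\<^sup>2) / pi))"

definition iid_std_complex_normal_mat ::
    "'w measure \<Rightarrow> nat \<Rightarrow> nat \<Rightarrow> ('w \<Rightarrow> complex mat) \<Rightarrow> bool" where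
  "iid_std_complex_normal_mat M nr nc W \<longleftrightarrow>
     (\<forall>\<omega> \<in> space M. W \<omega> \<in> carrier_mat nr nc) \<and>
     (\<forall>i<nr. \<forall>j<nc. std_complex_normal M (\<lambda>\<omega>. W \<omega> $$ (i,j))) \<and>
     prob_space.indep_vars M (\<lambda>_. borel) (\<lambda>(i,j) \<omega>. W \<omega> $$ (i,j)) ({..<nr} \<times> {..<nc})"

definition rician_channel ::
    "complex vec \<Rightarrow> complex vec \<Rightarrow> complex mat \<Rightarrow> ('w \<Rightarrow> complex mat) \<Rightarrow> 'w \<Rightarrow> complex mat" where
  "rician_channel a b R Hw \<omega> = outer_prod a b + Hw \<omega> * hermitian_sqrt R"

text \<open>The diagonal entries below are real since the matrices are Hermitian; \<open>Re\<close> only changes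
  their type.\<close>

definition zf_snr :: "real \<Rightarrow> complex mat \<Rightarrow> real" where
  "zf_snr \<Gamma>s H = \<Gamma>s / Re (mat_inv (mat_adjoint H * H) $$ (0,0))"

subsection \<open>Parameters\<close>

definition cov_rho :: "complex mat \<Rightarrow> complex vec" where
  "cov_rho R = vec (dim_row R - 1) (\<lambda>i. R $$ (Suc i, 0))"

definition cov_R22 :: "complex mat \<Rightarrow> complex mat" where
  "cov_R22 R = mat_delete R 0 0"

definition cov_r21 :: "complex mat \<Rightarrow> complex vec" where
  "cov_r21 R = mat_inv (cov_R22 R) *\<^sub>v cov_rho R"

definition tail_vec :: "complex vec \<Rightarrow> complex vec" where
  "tail_vec b = vec (dim_vec b - 1) (\<lambda>i. b $ Suc i)"

definition mu1 :: "complex mat \<Rightarrow> complex vec \<Rightarrow> complex" where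
  "mu1 R b = cnj (b $ 0) - cov_r21 R \<bullet>c tail_vec b"

definition Gamma1 :: "real \<Rightarrow> complex mat \<Rightarrow> real" where
  "Gamma1 \<Gamma>s R = \<Gamma>s / Re (mat_inv R $$ (0,0))"

definition par_x1 :: "complex mat \<Rightarrow> complex vec \<Rightarrow> real" where
  "par_x1 R b = Re (mat_inv R $$ (0,0)) * (cmod (mu1 R b))\<^sup>2"

definition par_x2 :: "complex mat \<Rightarrow> complex vec \<Rightarrow> real" where
  "par_x2 R b = Re ((mat_inv (cov_R22 R) *\<^sub>v tail_vec b) \<bullet>c tail_vec b)"

subsection \<open>The sequences entering the series\<close>

definition alt_binom_sum :: "(nat \<Rightarrow> nat \<Rightarrow> 'c) \<Rightarrow> nat \<Rightarrow> 'c :: comm_ring_1" where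
  "alt_binom_sum X n = (\<Sum>m=0..n. of_nat (n choose m) * (-1) ^ m * X n m)"

definition M_nm :: "nat \<Rightarrow> real \<Rightarrow> complex \<Rightarrow> nat \<Rightarrow> nat \<Rightarrow> complex" where
  "M_nm N G s n m = 1 / (1 - s * complex_of_real G) ^ (N + n - m)"

definition p_nm :: "nat \<Rightarrow> real \<Rightarrow> real \<Rightarrow> nat \<Rightarrow> nat \<Rightarrow> real" where
  "p_nm N G t n m =
     t ^ (N + n - m - 1) * exp (- t / G) / (fact (N + n - m - 1) * G ^ (N + n - m))"

definition Po_nm :: "nat \<Rightarrow> real \<Rightarrow> real \<Rightarrow> nat \<Rightarrow> nat \<Rightarrow> real" where
  "Po_nm N G \<tau> n m = (LBINT t:{0..\<tau>}. p_nm N G t n m)"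

definition C_nm :: "nat \<Rightarrow> real \<Rightarrow> nat \<Rightarrow> nat \<Rightarrow> real" where
  "C_nm N G n m = 1 / ln 2 * (LBINT t:{0..}. ln (1 + t) * p_nm N G t n m)"

subsection \<open>The double series\<close>

definition S_term ::
    "nat \<Rightarrow> nat \<Rightarrow> real \<Rightarrow> real \<Rightarrow> (nat \<Rightarrow> 'c) \<Rightarrow> nat \<Rightarrow> nat \<Rightarrow> 'c :: real_normed_vector" where
  "S_term N NR x1 x2 h n1 n2 =
     (pochhammer (real N) n1 / pochhammer (real (n2 + NR)) n1
       * (x1 ^ n1 / fact n1) * (x2 ^ n2 / fact n2)) *\<^sub>R h n1"

definition S_sum ::
    "nat \<Rightarrow> nat \<Rightarrow> real \<Rightarrow> real \<Rightarrow> (nat \<Rightarrow> 'c) \<Rightarrow> 'c :: real_normed_vector" where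
  "S_sum N NR x1 x2 h = exp (- x2) *\<^sub>R (\<Sum>n1. \<Sum>n2. S_term N NR x1 x2 h n1 n2)"

text \<open>Since \<open>suminf\<close> is total, convergence of the iterated series is a separate claim.\<close>

definition S_convergent ::
    "nat \<Rightarrow> nat \<Rightarrow> real \<Rightarrow> real \<Rightarrow> (nat \<Rightarrow> 'c :: real_normed_vector) \<Rightarrow> bool" where
  "S_convergent N NR x1 x2 h \<longleftrightarrow>
     (\<forall>n1. summable (\<lambda>n2. S_term N NR x1 x2 h n1 n2)) \<and>
     summable (\<lambda>n1. \<Sum>n2. S_term N NR x1 x2 h n1 n2)"

end

theory Submission
  imports Defs "Jordan_Normal_Form.Spectral_Radius"
begin

text \<open>
  With \<open>D(v; g\<^sub>1, \<dots>, g\<^sub>k)\<close> the squared norm of the part of \<open>v\<close> orthogonal to all \<open>g\<^sub>j\<close>,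
  the entry \<open>[(H\<^sup>HH)\<^sup>-\<^sup>1]\<^sub>1\<^sub>1\<close> is the inverse of \<open>D\<close> of the first column of \<open>H\<close> with respect to
  the other ones. A unitary change of the columns of \<open>H\<^sub>w\<close> that adapts them to \<open>R\<close> and \<open>b\<close> gives
  \<open>\<gamma>\<^sub>1 = \<Gamma>\<^sub>1 D(z + \<kappa>a; w\<^sub>1 + \<eta>a, w\<^sub>2, \<dots>)\<close> with independent standard Gaussian columns,
  \<open>\<bar>\<kappa>\<bar>\<^sup>2 = x\<^sub>1\<close> and \<open>\<bar>\<eta>\<bar>\<^sup>2 = x\<^sub>2\<close>. Projecting a standard Gaussian vector along a fixed nonzero
  vector yields a standard Gaussian vector in one dimension less, so columns can be eliminated one at
  a time. Hence, given the \<open>w\<^sub>j\<close>, the variable \<open>\<gamma>\<^sub>1 / \<Gamma>\<^sub>1\<close> is noncentral chi-square with noncentrality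
  \<open>x\<^sub>1\<beta>\<close>, where \<open>\<beta> = D(a; w\<^sub>1 + \<eta>a, w\<^sub>2, \<dots>)\<close>, and the moments of \<open>\<beta>\<close> come from beta integrals:
  \<open>E \<beta>\<^sup>j = \<Sum>\<^sub>i e\<^sup>-\<^sup>x\<^sup>2 x\<^sub>2\<^sup>i / i! (N)\<^sub>j / (N\<^sub>R + i)\<^sub>j\<close>. Thus \<open>\<gamma>\<^sub>1\<close> is a mixture of gamma laws with
  weights \<open>E (e\<^sup>-\<^sup>x\<^sup>1\<^sup>\<beta> (x\<^sub>1\<beta>)\<^sup>i / i!)\<close>. The Cauchy product of \<open>e\<^sup>-\<^sup>y\<close> with
  \<open>\<Sum>\<^sub>i y\<^sup>i / i! X\<^sub>i\<close> turns the mixture sum into the alternating binomial sums of the statement.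
\<close>

subsection \<open>Complex Gaussian variables\<close>

text \<open>The moments of \<open>\<beta>\<close> dictate the order of elimination. The column
  \<open>w + \<eta> * a\<close> goes first: with \<open>a\<close> rotated to a coordinate axis, it
  leaves the fraction \<open>Y / (X + Y)\<close> of the squared length of \<open>a\<close>, where
  \<open>X\<close> is noncentral of one complex dimension and \<open>Y\<close> is central of
  dimension \<open>N_R - 1\<close>. Given the Poisson index \<open>i\<close> of \<open>X\<close>
  this is a beta variable with moments \<open>(N_R - 1)_j / (N_R + i)_j\<close>. The other columns
  stay central under the projection; each lowers the dimension from \<open>d\<close> to
  \<open>d - 1\<close> with the factor \<open>(d - 1)_j / (d)_j\<close>, and the product telescopes.

  Unitary invariance is used for products of Givens rotations only, which reduces it to a
  substitution in two complex planes. Laws are stated as identities of nonnegative integrals for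
  arbitrary measurable \<open>F\<close>, so that sums and integrals may be exchanged freely.
  Convergence becomes an issue with the alternating sums alone; there a geometric bound on the
  components is set against \<open>x1 ^ i / fact i\<close>.\<close>

lemma complex_lborel_distr: "(lborel :: complex measure) = distr (lborel \<Otimes>\<^sub>M lborel) borel (\<lambda>(x,y). Complex x y)"
proof (rule lborel_eqI)
  have [measurable]: "(\<lambda>(x,y). Complex x y) \<in> borel_measurable (borel \<Otimes>\<^sub>M borel)"
    unfolding Complex_eq by (simp add: case_prod_beta')
  fix l u :: complex assume le: "\<And>b. b \<in> Basis \<Longrightarrow> l \<bullet> b \<le> u \<bullet> b"
  have "(\<lambda>(x,y). Complex x y) -` box l u \<inter> space (lborel \<Otimes>\<^sub>M lborel) = {Re l<..<Re u} \<times> {Im l<..<Im u}"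
    by (auto simp: box_def Basis_complex_def space_pair_measure)
  hence "emeasure (distr (lborel \<Otimes>\<^sub>M lborel) borel (\<lambda>(x,y). Complex x y)) (box l u)
      = emeasure (lborel \<Otimes>\<^sub>M lborel) ({Re l<..<Re u} \<times> {Im l<..<Im u})"
    by (simp add: emeasure_distr)
  also have "\<dots> = ennreal (Re u - Re l) * ennreal (Im u - Im l)"
    using le[of 1] le[of \<i>] by (simp add: lborel.emeasure_pair_measure_Times Basis_complex_def)
  also have "\<dots> = (\<Prod>b\<in>Basis. (u - l) \<bullet> b)"
    using le[of 1] le[of \<i>] by (simp add: Basis_complex_def ennreal_mult prod.insert)
  finally show "emeasure (distr (lborel \<Otimes>\<^sub>M lborel) borel (\<lambda>(x,y). Complex x y)) (box l u)
     = (\<Prod>b\<in>Basis. (u - l) \<bullet> b)" .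
qed simp

lemma borel_measurable_Complex[measurable (raw)]:
  assumes [measurable]: "f \<in> borel_measurable M" "g \<in> borel_measurable M"
  shows "(\<lambda>x. Complex (f x) (g x)) \<in> borel_measurable M"
  unfolding Complex_eq by simp

lemma nn_integral_complex:
  fixes f :: "complex \<Rightarrow> ennreal"
  assumes [measurable]: "f \<in> borel_measurable borel"
  shows "(\<integral>\<^sup>+z. f z \<partial>lborel) = (\<integral>\<^sup>+x. \<integral>\<^sup>+y. f (Complex x y) \<partial>lborel \<partial>lborel)"
  by (subst complex_lborel_distr, subst nn_integral_distr)
     (simp_all add: case_prod_beta' lborel.nn_integral_fst[symmetric])

section \<open>Linear substitutions in one and two complex planes\<close>

lemma nn_integral_lborel_swap:
  fixes f :: "'a :: euclidean_space \<Rightarrow> 'b :: euclidean_space \<Rightarrow> ennreal"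
  assumes [measurable]: "case_prod f \<in> borel_measurable (borel \<Otimes>\<^sub>M borel)"
  shows "(\<integral>\<^sup>+x. \<integral>\<^sup>+y. f x y \<partial>lborel \<partial>lborel) = (\<integral>\<^sup>+y. \<integral>\<^sup>+x. f x y \<partial>lborel \<partial>lborel)"
  by (rule lborel_pair.Fubini'[symmetric]) (simp add: assms)

lemma nn_integral_real_affine':
  fixes f :: "real \<Rightarrow> ennreal"
  assumes "f \<in> borel_measurable borel" "c \<noteq> 0"
  shows "(\<integral>\<^sup>+x. f (t + c * x) \<partial>lborel) = ennreal (1 / \<bar>c\<bar>) * (\<integral>\<^sup>+x. f x \<partial>lborel)"
  using assms by (subst nn_integral_real_affine[of f c t])
    (simp_all add: mult.assoc[symmetric] ennreal_mult[symmetric])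

text \<open>The real 2x2 matrix of multiplication by \<open>c\<close> has determinant
  \<open>|c|^2\<close>. It is treated by one-dimensional substitutions, that is, elimination with
  pivot \<open>Re c\<close>; for \<open>Re c = 0\<close> the map exchanges the axes up to
  scaling.\<close>

lemma nn_integral_complex_mult:
  fixes f :: "complex \<Rightarrow> ennreal"
  assumes f[measurable]: "f \<in> borel_measurable borel" and "c \<noteq> 0"
  shows "(\<integral>\<^sup>+z. f (c * z) \<partial>lborel) = ennreal (1 / (cmod c)\<^sup>2) * (\<integral>\<^sup>+z. f z \<partial>lborel)"
proof -
  define p q where "p = Re c" and "q = Im c"
  have c: "c = Complex p q" by (simp add: p_def q_def)
  have nc: "(cmod c)\<^sup>2 = p\<^sup>2 + q\<^sup>2" by (simp add: c cmod_def)
  have pos: "p\<^sup>2 + q\<^sup>2 > 0" using nc \<open>c \<noteq> 0\<close> by (metis zero_less_norm_iff zero_less_power)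
  have 1: "(\<integral>\<^sup>+z. f (c * z) \<partial>lborel) = (\<integral>\<^sup>+x. \<integral>\<^sup>+y. f (Complex (p * x - q * y) (q * x + p * y)) \<partial>lborel \<partial>lborel)"
  proof -
    have "c * Complex x y = Complex (p * x - q * y) (q * x + p * y)" for x y
      by (simp add: c complex_eq_iff algebra_simps)
    then show ?thesis by (subst nn_integral_complex) simp_all
  qed
  show ?thesis
  proof (cases "p = 0")
    case True
    then have q: "q \<noteq> 0" using pos by auto
    have "(\<integral>\<^sup>+z. f (c * z) \<partial>lborel) = (\<integral>\<^sup>+x. \<integral>\<^sup>+y. f (Complex (0 + (- q) * y) (q * x)) \<partial>lborel \<partial>lborel)"
      using True 1 by simp
    also have "\<dots> = (\<integral>\<^sup>+x. ennreal (1/\<bar>q\<bar>) * (\<integral>\<^sup>+y. f (Complex y (q * x)) \<partial>lborel) \<partial>lborel)"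
      using q by (subst nn_integral_real_affine'[where f="\<lambda>y. f (Complex y (q * x))" for x]) auto
    also have "\<dots> = ennreal (1/\<bar>q\<bar>) * (\<integral>\<^sup>+x. (\<integral>\<^sup>+y. f (Complex y (0 + q * x)) \<partial>lborel) \<partial>lborel)"
      by (simp add: nn_integral_cmult)
    also have "\<dots> = ennreal (1/\<bar>q\<bar>) * (ennreal (1/\<bar>q\<bar>) * (\<integral>\<^sup>+x. (\<integral>\<^sup>+y. f (Complex y x) \<partial>lborel) \<partial>lborel))"
      using q by (subst nn_integral_real_affine'[where f="\<lambda>x. \<integral>\<^sup>+y. f (Complex y x) \<partial>lborel"]) auto
    also have "(\<integral>\<^sup>+x. (\<integral>\<^sup>+y. f (Complex y x) \<partial>lborel) \<partial>lborel) = (\<integral>\<^sup>+z. f z \<partial>lborel)"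
      by (subst nn_integral_complex, simp, subst nn_integral_lborel_swap) simp_all
    finally show ?thesis
      unfolding nc by (simp add: mult.assoc[symmetric] ennreal_mult[symmetric] True power2_eq_square)
  next
    case False
    \<comment> \<open>The second pivot: with \<open>u = p * x - q * y\<close> the imaginary part
      \<open>q * x + p * y\<close> becomes \<open>q / p * u + d * y\<close>.\<close>
    define d where "d = (p\<^sup>2 + q\<^sup>2) / p"
    have d: "d \<noteq> 0" using pos False by (simp add: d_def)
    have "(\<integral>\<^sup>+z. f (c * z) \<partial>lborel)
      = (\<integral>\<^sup>+y. \<integral>\<^sup>+x. f (Complex (p * x - q * y) (q * x + p * y)) \<partial>lborel \<partial>lborel)"
      unfolding 1 by (rule nn_integral_lborel_swap) simp
    also have "\<dots> = (\<integral>\<^sup>+y. \<integral>\<^sup>+x. (\<lambda>u. f (Complex u (q / p * u + d * y))) (- q * y + p * x) \<partial>lborel \<partial>lborel)"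
    proof (intro nn_integral_cong)
      fix x y :: real
      have "q * x + p * y = q / p * (- q * y + p * x) + d * y"
        using False by (simp add: d_def field_simps power2_eq_square)
      moreover have "p * x - q * y = - q * y + p * x" by simp
      ultimately show "f (Complex (p * x - q * y) (q * x + p * y)) = (\<lambda>u. f (Complex u (q / p * u + d * y))) (- q * y + p * x)"
        by (simp only:)
    qed
    also have "\<dots> = (\<integral>\<^sup>+y. ennreal (1/\<bar>p\<bar>) * (\<integral>\<^sup>+u. f (Complex u (q / p * u + d * y)) \<partial>lborel) \<partial>lborel)"
      using False by (subst nn_integral_real_affine') auto
    also have "\<dots> = ennreal (1/\<bar>p\<bar>) * (\<integral>\<^sup>+y. (\<integral>\<^sup>+u. f (Complex u (q / p * u + d * y)) \<partial>lborel) \<partial>lborel)"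
      by (simp add: nn_integral_cmult)
    also have "(\<integral>\<^sup>+y. (\<integral>\<^sup>+u. f (Complex u (q / p * u + d * y)) \<partial>lborel) \<partial>lborel)
       = (\<integral>\<^sup>+u. (\<integral>\<^sup>+y. f (Complex u (q / p * u + d * y)) \<partial>lborel) \<partial>lborel)"
      by (rule nn_integral_lborel_swap) simp
    also have "\<dots> = (\<integral>\<^sup>+u. ennreal (1/\<bar>d\<bar>) * (\<integral>\<^sup>+y. f (Complex u y) \<partial>lborel) \<partial>lborel)"
      using d by (subst nn_integral_real_affine'[where f="\<lambda>y. f (Complex u y)" for u]) auto
    also have "\<dots> = ennreal (1/\<bar>d\<bar>) * (\<integral>\<^sup>+z. f z \<partial>lborel)"
      by (simp add: nn_integral_cmult nn_integral_complex)
    finally have *: "(\<integral>\<^sup>+z. f (c * z) \<partial>lborel) = ennreal (1/\<bar>p\<bar>) * (ennreal (1/\<bar>d\<bar>) * (\<integral>\<^sup>+z. f z \<partial>lborel))" .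
    have "\<bar>p\<bar> * \<bar>d\<bar> = p\<^sup>2 + q\<^sup>2"
      unfolding d_def abs_divide using False abs_of_pos[OF pos] by simp
    then have "ennreal (1/\<bar>p\<bar>) * ennreal (1/\<bar>d\<bar>) = ennreal (1 / (p\<^sup>2 + q\<^sup>2))"
      by (subst ennreal_mult[symmetric]) auto
    then show ?thesis
      unfolding * nc by (simp only: mult.assoc[symmetric])
  qed
qed

lemma nn_integral_complex_translate:
  fixes f :: "complex \<Rightarrow> ennreal"
  assumes [measurable]: "f \<in> borel_measurable borel"
  shows "(\<integral>\<^sup>+z. f (t + z) \<partial>lborel) = (\<integral>\<^sup>+z. f z \<partial>lborel)"
  using lborel_distr_plus[of t]
  by (subst (2) lborel_distr_plus[of t, symmetric], subst nn_integral_distr) simp_all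

lemma nn_integral_complex_affine:
  fixes f :: "complex \<Rightarrow> ennreal"
  assumes [measurable]: "f \<in> borel_measurable borel" and c: "c \<noteq> 0"
  shows "(\<integral>\<^sup>+z. f (t + c * z) \<partial>lborel) = ennreal (1 / (cmod c)\<^sup>2) * (\<integral>\<^sup>+z. f z \<partial>lborel)"
  using nn_integral_complex_mult[OF _ c, of "\<lambda>z. f (t + z)"]
  by (simp add: nn_integral_complex_translate)

text \<open>Unitarity makes the Jacobian 1. Elimination with pivot \<open>c\<close> produces the
  factors \<open>1 / |c|^2\<close> and \<open>|c|^2\<close>, which cancel; for \<open>c = 0\<close>
  the two planes are exchanged and multiplied by phases.\<close>

lemma nn_integral_givens_lborel:
  fixes f :: "complex \<Rightarrow> complex \<Rightarrow> ennreal"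
  assumes [measurable]: "case_prod f \<in> borel_measurable (borel \<Otimes>\<^sub>M borel)"
    and cs: "(cmod c)\<^sup>2 + (cmod s)\<^sup>2 = 1"
  shows "(\<integral>\<^sup>+x. \<integral>\<^sup>+y. f (c * x + s * y) (cnj c * y - cnj s * x) \<partial>lborel \<partial>lborel) = (\<integral>\<^sup>+x. \<integral>\<^sup>+y. f x y \<partial>lborel \<partial>lborel)"
proof (cases "c = 0")
  case True
  then have s: "cmod s = 1" using cs power2_eq_1_iff[of "cmod s"] norm_ge_zero[of s] by auto
  then have s0: "s \<noteq> 0" by auto
  have "(\<integral>\<^sup>+x. \<integral>\<^sup>+y. f (c * x + s * y) (cnj c * y - cnj s * x) \<partial>lborel \<partial>lborel)
     = (\<integral>\<^sup>+x. \<integral>\<^sup>+y. f (s * y) (- cnj s * x) \<partial>lborel \<partial>lborel)" by (simp add: True)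
  also have "\<dots> = (\<integral>\<^sup>+x. \<integral>\<^sup>+y. f y (- cnj s * x) \<partial>lborel \<partial>lborel)"
    using s0 by (subst nn_integral_complex_mult[where f="\<lambda>y. f y (- cnj s * x)" for x]) (auto simp: s)
  also have "\<dots> = (\<integral>\<^sup>+x. \<integral>\<^sup>+y. f y x \<partial>lborel \<partial>lborel)"
    using s0 by (subst nn_integral_complex_mult[where f="\<lambda>x. \<integral>\<^sup>+y. f y x \<partial>lborel"]) (auto simp: s)
  finally show ?thesis by (subst nn_integral_lborel_swap) simp_all
next
  case False
  have "(\<integral>\<^sup>+x. \<integral>\<^sup>+y. f (c * x + s * y) (cnj c * y - cnj s * x) \<partial>lborel \<partial>lborel)
    = (\<integral>\<^sup>+y. \<integral>\<^sup>+x. f (c * x + s * y) (cnj c * y - cnj s * x) \<partial>lborel \<partial>lborel)"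
    by (rule nn_integral_lborel_swap) simp
  also have "\<dots> = (\<integral>\<^sup>+y. \<integral>\<^sup>+x. (\<lambda>u. f u (- cnj s / c * u + 1 / c * y)) (s * y + c * x) \<partial>lborel \<partial>lborel)"
  proof (intro nn_integral_cong)
    fix x y :: complex
    have 1: "c * cnj c + s * cnj s = 1"
      using cs by (simp add: complex_norm_square[symmetric] of_real_add[symmetric] del: of_real_power)
    have "cnj c * y - cnj s * x = - cnj s / c * (s * y + c * x) + (c * cnj c + s * cnj s) / c * y"
      using False by (simp add: field_simps)
    then have "cnj c * y - cnj s * x = - cnj s / c * (s * y + c * x) + 1 / c * y"
      unfolding 1 .
    then show "f (c * x + s * y) (cnj c * y - cnj s * x) = (\<lambda>u. f u (- cnj s / c * u + 1 / c * y)) (s * y + c * x)"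
      by (simp only: add.commute[of "c * x"])
  qed
  also have "\<dots> = (\<integral>\<^sup>+y. ennreal (1 / (cmod c)\<^sup>2) * (\<integral>\<^sup>+u. f u (- cnj s / c * u + 1 / c * y) \<partial>lborel) \<partial>lborel)"
    using False by (subst nn_integral_complex_affine) auto
  also have "\<dots> = ennreal (1 / (cmod c)\<^sup>2) * (\<integral>\<^sup>+y. (\<integral>\<^sup>+u. f u (- cnj s / c * u + 1 / c * y) \<partial>lborel) \<partial>lborel)"
    by (simp add: nn_integral_cmult)
  also have "(\<integral>\<^sup>+y. (\<integral>\<^sup>+u. f u (- cnj s / c * u + 1 / c * y) \<partial>lborel) \<partial>lborel)
     = (\<integral>\<^sup>+u. (\<integral>\<^sup>+y. f u (- cnj s / c * u + 1 / c * y) \<partial>lborel) \<partial>lborel)"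
    by (rule nn_integral_lborel_swap) simp
  also have "\<dots> = (\<integral>\<^sup>+u. ennreal ((cmod c)\<^sup>2) * (\<integral>\<^sup>+y. f u y \<partial>lborel) \<partial>lborel)"
    using False by (subst nn_integral_complex_affine[where f="\<lambda>y. f u y" for u]) (auto simp: norm_divide power_divide)
  also have "\<dots> = ennreal ((cmod c)\<^sup>2) * (\<integral>\<^sup>+u. (\<integral>\<^sup>+y. f u y \<partial>lborel) \<partial>lborel)"
    by (simp add: nn_integral_cmult)
  finally show ?thesis
    using False by (simp add: mult.assoc[symmetric] ennreal_mult[symmetric])
qed

section \<open>The standard complex Gaussian law\<close>

definition cgauss :: "complex measure" where
  "cgauss = density lborel (\<lambda>z. ennreal (exp (- (cmod z)\<^sup>2) / pi))"

lemma sets_cgauss[simp, measurable_cong]: "sets cgauss = sets borel"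
  by (simp add: cgauss_def)

lemma space_cgauss[simp]: "space cgauss = UNIV"
  by (simp add: cgauss_def)

lemma nn_integral_cgauss:
  "f \<in> borel_measurable borel \<Longrightarrow>
   (\<integral>\<^sup>+z. f z \<partial>cgauss) = (\<integral>\<^sup>+z. ennreal (exp (- (cmod z)\<^sup>2) / pi) * f z \<partial>lborel)"
  unfolding cgauss_def by (subst nn_integral_density) simp_all

text \<open>The joint density is a function of \<open>|x|^2 + |y|^2\<close>, which the rotation
  preserves, so the Gaussian weight passes unchanged through the substitution for Lebesgue
  measure.\<close>

lemma nn_integral_givens_cgauss:
  fixes f :: "complex \<Rightarrow> complex \<Rightarrow> ennreal"
  assumes [measurable]: "case_prod f \<in> borel_measurable (borel \<Otimes>\<^sub>M borel)"
    and cs: "(cmod c)\<^sup>2 + (cmod s)\<^sup>2 = 1"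
  shows "(\<integral>\<^sup>+x. \<integral>\<^sup>+y. f (c * x + s * y) (cnj c * y - cnj s * x) \<partial>cgauss \<partial>cgauss) = (\<integral>\<^sup>+x. \<integral>\<^sup>+y. f x y \<partial>cgauss \<partial>cgauss)"
proof -
  define g where "g x = ennreal (exp (- (cmod x)\<^sup>2) / pi)" for x :: complex
  have [measurable]: "g \<in> borel_measurable borel" unfolding g_def by measurable
  have g: "g (c * x + s * y) * g (cnj c * y - cnj s * x) = g x * g y" for x y
  proof -
    have 1: "c * cnj c + s * cnj s = 1"
      using cs by (simp add: complex_norm_square[symmetric] of_real_add[symmetric] del: of_real_power)
    have "complex_of_real ((cmod (c * x + s * y))\<^sup>2 + (cmod (cnj c * y - cnj s * x))\<^sup>2)
      = (c * cnj c + s * cnj s) * (x * cnj x + y * cnj y)"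
      unfolding of_real_add complex_norm_square by (simp add: algebra_simps)
    also have "\<dots> = complex_of_real ((cmod x)\<^sup>2 + (cmod y)\<^sup>2)"
      unfolding 1 of_real_add complex_norm_square by simp
    finally have "(cmod (c * x + s * y))\<^sup>2 + (cmod (cnj c * y - cnj s * x))\<^sup>2 = (cmod x)\<^sup>2 + (cmod y)\<^sup>2"
      using of_real_eq_iff by blast
    then show ?thesis unfolding g_def
      by (simp add: ennreal_mult[symmetric] exp_add[symmetric])
  qed
  have *: "(\<integral>\<^sup>+x. \<integral>\<^sup>+y. h x y \<partial>cgauss \<partial>cgauss) = (\<integral>\<^sup>+x. \<integral>\<^sup>+y. (g x * g y) * h x y \<partial>lborel \<partial>lborel)"
    if [measurable]: "case_prod h \<in> borel_measurable (borel \<Otimes>\<^sub>M borel)" for h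
    by (simp add: nn_integral_cgauss g_def[symmetric] mult.assoc nn_integral_cmult)
  have "(\<integral>\<^sup>+x. \<integral>\<^sup>+y. f (c * x + s * y) (cnj c * y - cnj s * x) \<partial>cgauss \<partial>cgauss)
     = (\<integral>\<^sup>+x. \<integral>\<^sup>+y. (g x * g y) * f (c * x + s * y) (cnj c * y - cnj s * x) \<partial>lborel \<partial>lborel)"
    by (subst *) simp_all
  also have "\<dots> = (\<integral>\<^sup>+x. \<integral>\<^sup>+y. (g (c * x + s * y) * g (cnj c * y - cnj s * x)) *
        f (c * x + s * y) (cnj c * y - cnj s * x) \<partial>lborel \<partial>lborel)"
    by (simp only: g)
  also have "\<dots> = (\<integral>\<^sup>+x. \<integral>\<^sup>+y. (g x * g y) * f x y \<partial>lborel \<partial>lborel)"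
    by (rule nn_integral_givens_lborel[where f="\<lambda>x y. g x * g y * f x y", OF _ cs]) simp
  also have "\<dots> = (\<integral>\<^sup>+x. \<integral>\<^sup>+y. f x y \<partial>cgauss \<partial>cgauss)"
    by (subst *) simp_all
  finally show ?thesis .
qed

text \<open>Read off from the total mass of the normal density with variance 1/2.\<close>

lemma nn_integral_real_gauss: "(\<integral>\<^sup>+x. ennreal (exp (- x\<^sup>2)) \<partial>lborel) = ennreal (sqrt pi)"
proof -
  have n: "normal_density 0 (1 / sqrt 2) x = 1 / sqrt pi * exp (- x\<^sup>2)" for x
    by (simp add: normal_density_def power_divide)
  have "1 = (\<integral>\<^sup>+x. ennreal (normal_density 0 (1 / sqrt 2) x) \<partial>lborel)"
    using prob_space.emeasure_space_1[OF prob_space_normal_density[of "1 / sqrt 2" 0]]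
    by (simp add: emeasure_density)
  also have "\<dots> = (\<integral>\<^sup>+x. ennreal (1 / sqrt pi) * ennreal (exp (- x\<^sup>2)) \<partial>lborel)"
    unfolding n by (intro nn_integral_cong ennreal_mult) auto
  also have "\<dots> = ennreal (1 / sqrt pi) * (\<integral>\<^sup>+x. ennreal (exp (- x\<^sup>2)) \<partial>lborel)"
    by (rule nn_integral_cmult) simp
  finally have "ennreal (sqrt pi) * 1 = ennreal (sqrt pi) * (ennreal (1 / sqrt pi) * (\<integral>\<^sup>+x. ennreal (exp (- x\<^sup>2)) \<partial>lborel))"
    by (rule arg_cong)
  also have "\<dots> = ennreal (sqrt pi * (1 / sqrt pi)) * (\<integral>\<^sup>+x. ennreal (exp (- x\<^sup>2)) \<partial>lborel)"
    unfolding mult.assoc[symmetric] by (subst ennreal_mult) auto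
  finally show ?thesis by simp
qed

lemma prob_space_cgauss: "prob_space cgauss"
proof
  have e: "ennreal (exp (- (cmod (Complex x y))\<^sup>2) / pi) = ennreal (1 / pi * exp (- x\<^sup>2)) * ennreal (exp (- y\<^sup>2))" for x y
    by (simp add: cmod_def exp_add[symmetric] ennreal_mult[symmetric])
  have "emeasure cgauss (space cgauss) = (\<integral>\<^sup>+z. ennreal (exp (- (cmod z)\<^sup>2) / pi) \<partial>lborel)"
    by (simp add: cgauss_def emeasure_density)
  also have "\<dots> = (\<integral>\<^sup>+x. \<integral>\<^sup>+y. ennreal (1 / pi * exp (- x\<^sup>2)) * ennreal (exp (- y\<^sup>2)) \<partial>lborel \<partial>lborel)"
    unfolding e[symmetric] by (rule nn_integral_complex) measurable
  also have "\<dots> = (\<integral>\<^sup>+x. ennreal (1 / pi * exp (- x\<^sup>2)) * ennreal (sqrt pi) \<partial>lborel)"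
    by (subst nn_integral_cmult) (auto simp: nn_integral_real_gauss)
  also have "\<dots> = (\<integral>\<^sup>+x. ennreal (1 / pi * sqrt pi) * ennreal (exp (- x\<^sup>2)) \<partial>lborel)"
    by (intro nn_integral_cong) (simp add: ennreal_mult[symmetric] field_simps)
  also have "\<dots> = ennreal (1 / pi * sqrt pi) * ennreal (sqrt pi)"
    by (subst nn_integral_cmult) (auto simp: nn_integral_real_gauss)
  also have "\<dots> = 1" by (subst ennreal_mult[symmetric]) (auto simp: mult.assoc)
  finally show "emeasure cgauss (space cgauss) = 1" .
qed

subsection \<open>Gaussian vectors and rotations\<close>

text \<open>Vectors are functions on an index set, the form in which points of \<open>PiM\<close>
  come. Summing over \<open>I\<close> alone allows total functions and points of the product space
  to be mixed.\<close>

definition ip :: "'i set \<Rightarrow> ('i \<Rightarrow> complex) \<Rightarrow> ('i \<Rightarrow> complex) \<Rightarrow> complex" where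
  "ip I x y = (\<Sum>i\<in>I. x i * cnj (y i))"

lemma ip_cong: "(\<And>i. i \<in> I \<Longrightarrow> x i = x' i) \<Longrightarrow> (\<And>i. i \<in> I \<Longrightarrow> y i = y' i) \<Longrightarrow> ip I x y = ip I x' y'"
  unfolding ip_def by (rule sum.cong) auto

lemma ip_add_left: "ip I (\<lambda>i. a * x i + y i) z = a * ip I x z + ip I y z"
  by (simp add: ip_def sum.distrib sum_distrib_left algebra_simps)

lemma ip_commute: "ip I y x = cnj (ip I x y)"
  by (simp add: ip_def mult.commute)

lemma ip_add_right: "ip I z (\<lambda>i. a * x i + y i) = cnj a * ip I z x + ip I z y"
  by (simp add: ip_def sum.distrib sum_distrib_left algebra_simps)

lemma ip_self: "ip I x x = complex_of_real (\<Sum>i\<in>I. (cmod (x i))\<^sup>2)"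
  by (simp add: ip_def complex_norm_square del: of_real_power)

lemma Re_ip_self: "Re (ip I x x) = (\<Sum>i\<in>I. (cmod (x i))\<^sup>2)"
  by (simp add: ip_self)

lemma Re_ip_self_nonneg: "0 \<le> Re (ip I x x)"
  by (simp add: Re_ip_self sum_nonneg)

lemma ip_self_eq_0_iff: "finite I \<Longrightarrow> ip I x x = 0 \<longleftrightarrow> (\<forall>i\<in>I. x i = 0)"
  by (simp only: ip_self of_real_eq_0_iff sum_nonneg_eq_0_iff zero_le_power2) simp

abbreviation CG :: "'i set \<Rightarrow> ('i \<Rightarrow> complex) measure" where
  "CG I \<equiv> PiM I (\<lambda>_. cgauss)"

lemma prob_space_CG: "prob_space (CG I)"
  by (intro prob_space_PiM prob_space_cgauss)

lemma product_sigma_finite_cgauss: "product_sigma_finite (\<lambda>_. cgauss)"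
  by (simp add: product_sigma_finite_def prob_space_cgauss prob_space_imp_sigma_finite)

lemma nn_integral_CG_insert:
  assumes "finite I" "i \<notin> I" "f \<in> borel_measurable (CG (insert i I))"
  shows "(\<integral>\<^sup>+x. f x \<partial>CG (insert i I)) = (\<integral>\<^sup>+y. \<integral>\<^sup>+x. f (x(i := y)) \<partial>CG I \<partial>cgauss)"
  by (rule product_sigma_finite.product_nn_integral_insert_rev[OF product_sigma_finite_cgauss assms])

section \<open>Givens rotations and their products\<close>

definition givens :: "'i \<Rightarrow> 'i \<Rightarrow> complex \<Rightarrow> complex \<Rightarrow> ('i \<Rightarrow> complex) \<Rightarrow> 'i \<Rightarrow> complex" where
  "givens p q c s x = x(p := c * x p + s * x q, q := cnj c * x q - cnj s * x p)"

lemma measurable_CG_component[measurable (raw)]: "i \<in> I \<Longrightarrow> (\<lambda>x. x i) \<in> borel_measurable (CG I)"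
  by measurable

lemma measurable_givens:
  assumes "p \<in> I" "q \<in> I"
  shows "givens p q c s \<in> measurable (CG I) (CG I)"
proof -
  have [measurable]: "(\<lambda>x. x p) \<in> borel_measurable (CG I)" "(\<lambda>x. x q) \<in> borel_measurable (CG I)"
    using assms by auto
  have "(\<lambda>x. x(p := c * x p + s * x q, q := cnj c * x q - cnj s * x p)) \<in> measurable (CG I) (CG I)"
  proof (rule measurable_PiM_single')
    fix i assume "i \<in> I"
    then have [measurable]: "(\<lambda>x. x i) \<in> borel_measurable (CG I)" by auto
    show "(\<lambda>x. (x(p := c * x p + s * x q, q := cnj c * x q - cnj s * x p)) i) \<in> measurable (CG I) cgauss"
      by (cases "i = q"; cases "i = p") (simp_all add: measurable_cong_sets[OF refl sets_cgauss])
  qed (use assms in \<open>auto simp: space_PiM extensional_def PiE_def\<close>)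
  then show ?thesis by (simp add: givens_def[abs_def])
qed

text \<open>Fubini isolates the coordinates \<open>p\<close> and \<open>q\<close>; the others are
  integrated out first and take no part in the substitution.\<close>

lemma nn_integral_givens:
  assumes I: "finite I" "p \<in> I" "q \<in> I" "p \<noteq> q" and cs: "(cmod c)\<^sup>2 + (cmod s)\<^sup>2 = 1"
    and F: "F \<in> borel_measurable (CG I)"
  shows "(\<integral>\<^sup>+x. F (givens p q c s x) \<partial>CG I) = (\<integral>\<^sup>+x. F x \<partial>CG I)"
proof -
  define J where "J = I - {p, q}"
  have IJ: "I = insert p (insert q J)" "finite J" "p \<notin> insert q J" "q \<notin> J" using I by (auto simp: J_def)
  have *: "(\<integral>\<^sup>+x. H x \<partial>CG I) = (\<integral>\<^sup>+u. \<integral>\<^sup>+v. \<integral>\<^sup>+x. H (x(q := v, p := u)) \<partial>CG J \<partial>cgauss \<partial>cgauss)"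
    if H: "H \<in> borel_measurable (CG I)" for H
  proof -
    have "(\<integral>\<^sup>+x. H x \<partial>CG I) = (\<integral>\<^sup>+u. \<integral>\<^sup>+x. H (x(p := u)) \<partial>CG (insert q J) \<partial>cgauss)"
      using H unfolding IJ(1) by (intro nn_integral_CG_insert) (use IJ in auto)
    also have "\<dots> = (\<integral>\<^sup>+u. \<integral>\<^sup>+v. \<integral>\<^sup>+x. H (x(q := v, p := u)) \<partial>CG J \<partial>cgauss \<partial>cgauss)"
    proof (intro nn_integral_cong nn_integral_CG_insert)
      fix u :: complex
      have "(\<lambda>x. x(p := u)) \<in> measurable (CG (insert q J)) (CG (insert p (insert q J)))"
        by (rule measurable_fun_upd[where J="insert q J"]) auto
      from measurable_comp[OF this H[unfolded IJ(1)]]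
      show "(\<lambda>x. H (x(p := u))) \<in> borel_measurable (CG (insert q J))" by (simp add: comp_def)
    qed (use IJ in auto)
    finally show ?thesis .
  qed
  define f where "f u v = (\<integral>\<^sup>+x. F (x(q := v, p := u)) \<partial>CG J)" for u v
  have m: "case_prod f \<in> borel_measurable (borel \<Otimes>\<^sub>M borel)"
  proof -
    interpret prob_space "CG J" by (rule prob_space_CG)
    have m1: "(\<lambda>w. (snd w)(q := snd (fst w), p := fst (fst w))) \<in> measurable ((borel \<Otimes>\<^sub>M borel) \<Otimes>\<^sub>M CG J) (CG I)"
      unfolding IJ(1)
      by (intro measurable_fun_upd[where J="insert q J"] measurable_fun_upd[where J=J]) 
         (auto simp: measurable_cong_sets[OF refl sets_cgauss])
    have "(\<lambda>w. \<integral>\<^sup>+x. F (x(q := snd w, p := fst w)) \<partial>CG J) \<in> borel_measurable (borel \<Otimes>\<^sub>M borel)"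
      using measurable_comp[OF m1 F]
      by (intro borel_measurable_nn_integral) (simp add: comp_def case_prod_beta')
    then show ?thesis by (simp add: f_def case_prod_beta')
  qed
  have "(\<integral>\<^sup>+x. F (givens p q c s x) \<partial>CG I)
     = (\<integral>\<^sup>+u. \<integral>\<^sup>+v. \<integral>\<^sup>+x. F (givens p q c s (x(q := v, p := u))) \<partial>CG J \<partial>cgauss \<partial>cgauss)"
    by (rule *) (rule measurable_compose[OF measurable_givens[OF I(2,3)] F])
  also have "\<dots> = (\<integral>\<^sup>+u. \<integral>\<^sup>+v. f (c * u + s * v) (cnj c * v - cnj s * u) \<partial>cgauss \<partial>cgauss)"
  proof (unfold f_def, intro nn_integral_cong arg_cong[where f=F])
    fix u v x
    show "givens p q c s (x(q := v, p := u)) = x(q := cnj c * v - cnj s * u, p := c * u + s * v)"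
      using I(4) by (auto simp: givens_def)
  qed
  also have "\<dots> = (\<integral>\<^sup>+u. \<integral>\<^sup>+v. f u v \<partial>cgauss \<partial>cgauss)"
    by (rule nn_integral_givens_cgauss[OF m cs])
  also have "\<dots> = (\<integral>\<^sup>+x. F x \<partial>CG I)"
    unfolding f_def by (rule *[OF F, symmetric])
  finally show ?thesis .
qed

text \<open>Finite products of Givens rotations stand in for general unitary maps: isometry,
  linearity, measurability and invariance of the Gaussian measure each follow by induction from a
  single step, and these products already carry any vector to a coordinate axis.\<close>

inductive rot :: "'i set \<Rightarrow> (('i \<Rightarrow> complex) \<Rightarrow> 'i \<Rightarrow> complex) \<Rightarrow> bool" for I where
  rot_id: "rot I (\<lambda>x. x)"
| rot_givens: "rot I T \<Longrightarrow> p \<in> I \<Longrightarrow> q \<in> I \<Longrightarrow> p \<noteq> q \<Longrightarrow> (cmod c)\<^sup>2 + (cmod s)\<^sup>2 = 1 \<Longrightarrow>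
    rot I (\<lambda>x. givens p q c s (T x))"

definition clin :: "(('i \<Rightarrow> complex) \<Rightarrow> 'j \<Rightarrow> complex) \<Rightarrow> bool" where
  "clin T \<longleftrightarrow> (\<forall>a x y. T (\<lambda>i. a * x i + y i) = (\<lambda>j. a * T x j + T y j))"

lemma clinD: "clin T \<Longrightarrow> T (\<lambda>i. a * x i + y i) j = a * T x j + T y j"
  by (simp add: clin_def)

lemma rot_clin: "rot I T \<Longrightarrow> clin T"
  by (induction rule: rot.induct) (auto simp: clin_def givens_def fun_eq_iff algebra_simps)

lemma rot_ip:
  assumes "rot I T" "finite I"
  shows "ip I (T x) (T y) = ip I x y"
  using assms(1)
proof (induction rule: rot.induct)
  case (rot_givens T p q c s)
  define J where "J = I - {p, q}"
  have IJ: "I = insert p (insert q J)" "finite J" "p \<notin> insert q J" "q \<notin> J" 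
    using rot_givens assms by (auto simp: J_def)
  have cs: "c * cnj c + s * cnj s = 1"
    using rot_givens(5) by (simp add: complex_norm_square[symmetric] of_real_add[symmetric] del: of_real_power)
  have e: "ip I u v = u p * cnj (v p) + u q * cnj (v q) + ip J u v" for u v
    using IJ by (simp add: ip_def)
  have J: "ip J (givens p q c s u) (givens p q c s v) = ip J u v" for u v
    by (rule ip_cong) (auto simp: givens_def J_def)
  have "ip I (givens p q c s u) (givens p q c s v) = 
     (c * cnj c + s * cnj s) * (u p * cnj (v p) + u q * cnj (v q)) + ip J u v" for u v
    unfolding e J using rot_givens(4) by (simp add: givens_def algebra_simps)
  then show ?case using rot_givens(6) unfolding cs by (simp add: e)
qed simp

lemma rot_outside: "rot I T \<Longrightarrow> i \<notin> I \<Longrightarrow> T x i = x i"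
  by (induction rule: rot.induct) (auto simp: givens_def)

lemma measurable_rot: "rot I T \<Longrightarrow> T \<in> measurable (CG I) (CG I)"
proof (induction rule: rot.induct)
  case (rot_givens T p q c s)
  then show ?case
    using measurable_comp[OF rot_givens(6) measurable_givens[OF rot_givens(2,3)]] by (simp add: comp_def)
qed simp

lemma distr_rot:
  assumes "rot I T" "finite I"
  shows "distr (CG I) (CG I) T = CG I"
  using assms(1)
proof (induction rule: rot.induct)
  case (rot_givens T p q c s)
  have "distr (CG I) (CG I) (\<lambda>x. givens p q c s (T x)) = distr (distr (CG I) (CG I) T) (CG I) (givens p q c s)"
    using measurable_rot[OF rot_givens(1)] measurable_givens[OF rot_givens(2,3)]
    by (simp add: distr_distr comp_def)
  also have "\<dots> = distr (CG I) (CG I) (givens p q c s)" by (simp only: rot_givens)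
  also have "\<dots> = CG I"
  proof (rule measure_eqI)
    fix A assume "A \<in> sets (distr (CG I) (CG I) (givens p q c s))"
    then have A[measurable]: "A \<in> sets (CG I)" by simp
    note [measurable] = measurable_givens[OF rot_givens(2,3)]
    have "emeasure (distr (CG I) (CG I) (givens p q c s)) A = (\<integral>\<^sup>+x. indicator A (givens p q c s x) \<partial>CG I)"
      by (simp add: nn_integral_distr flip: nn_integral_indicator)
    also have "\<dots> = (\<integral>\<^sup>+x. indicator A x \<partial>CG I)"
      by (rule nn_integral_givens) (use rot_givens assms in auto)
    finally show "emeasure (distr (CG I) (CG I) (givens p q c s)) A = emeasure (CG I) A" by simp
  qed simp
  finally show ?case .
qed simp

lemma rot_mono: "rot I T \<Longrightarrow> I \<subseteq> J \<Longrightarrow> rot J T"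
  by (induction rule: rot.induct) (auto intro!: rot.intros)

lemma rot_comp: "rot I U \<Longrightarrow> rot I T \<Longrightarrow> rot I (\<lambda>x. U (T x))"
  by (induction rule: rot.induct) (auto intro!: rot.intros)

text \<open>Coordinates are cleared one at a time by a rotation in the plane of \<open>j\<close> and
  \<open>l\<close>, which moves the content of \<open>j\<close> into \<open>l\<close> and does not
  touch the coordinates cleared before.\<close>

lemma rot_annihilate_exists:
  assumes "finite I" "l \<in> I"
  shows "\<exists>T. rot I T \<and> (\<forall>i\<in>I - {l}. T g i = 0)"
proof -
  have "\<exists>T. rot I T \<and> (\<forall>i\<in>J. T g i = 0)" if "J \<subseteq> I - {l}" "finite J" for J
    using that(2,1)
  proof (induction J rule: finite_induct)
    case empty
    then show ?case using rot_id by blast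
  next
    case (insert j J)
    then obtain T where T: "rot I T" "\<forall>i\<in>J. T g i = 0" by auto
    define u where "u = T g"
    define r where "r = sqrt ((cmod (u j))\<^sup>2 + (cmod (u l))\<^sup>2)"
    \<comment> \<open>\<open>(c, s)\<close> is a unit vector with
      \<open>c * u j + s * u l = 0\<close>. If \<open>r = 0\<close>, both entries vanish already and
      the identity is taken.\<close>
    define c where "c = (if r = 0 then 1 else u l / r)"
    define s where "s = (if r = 0 then 0 else - u j / r)"
    have r2: "r\<^sup>2 = (cmod (u j))\<^sup>2 + (cmod (u l))\<^sup>2" by (simp add: r_def)
    have cs: "(cmod c)\<^sup>2 + (cmod s)\<^sup>2 = 1"
      by (simp add: c_def s_def norm_divide power_divide add_divide_distrib[symmetric])
        (simp add: r2[symmetric] add.commute)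
    have z: "c * u j + s * u l = 0"
    proof (cases "r = 0")
      case True
      then have "u j = 0" by (simp add: r_def add_nonneg_eq_0_iff)
      then show ?thesis using True by (simp add: s_def)
    next
      case False then show ?thesis by (simp add: c_def s_def field_simps)
    qed
    have "rot I (\<lambda>x. givens j l c s (T x))"
      using insert T cs assms by (intro rot_givens) auto
    moreover have "\<forall>i\<in>insert j J. givens j l c s (T g) i = 0"
      using z T(2) insert by (auto simp: givens_def u_def)
    ultimately show ?case by blast
  qed
  from this[of "I - {l}"] assms show ?thesis by simp
qed

lemma clin_simps:
  assumes "clin T"
  shows "T (\<lambda>i. a * x i) j = a * T x j" "T (\<lambda>i. x i + y i) j = T x j + T y j"
    "T (\<lambda>i. x i - a * y i) j = T x j - a * T y j"
proof -
  have z: "T (\<lambda>i. 0) j = 0" using clinD[OF assms, of 1 "\<lambda>_. 0" "\<lambda>_. 0" j] by simp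
  show "T (\<lambda>i. a * x i) j = a * T x j" using clinD[OF assms, of a x "\<lambda>_. 0" j] z by simp
  show "T (\<lambda>i. x i + y i) j = T x j + T y j" using clinD[OF assms, of 1 x y j] by simp
  show "T (\<lambda>i. x i - a * y i) j = T x j - a * T y j" using clinD[OF assms, of "-a" y x j] by simp
qed

lemma distr_CG_restrict:
  assumes "J \<subseteq> I"
  shows "distr (CG I) (CG J) (\<lambda>x. restrict x J) = CG J"
  using distr_PiM_reindex[of I "\<lambda>_. cgauss" "\<lambda>x. x" J] assms
  by (auto simp: prob_space_cgauss restrict_def)

text \<open>A Gram--Schmidt step: projecting along \<open>g\<close> amounts to a standard Gaussian vector of one
  dimension less.\<close>

lemma coisometry_exists:
  assumes g: "ip {..<Suc n} g g \<noteq> 0"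
  shows "\<exists>P. clin P \<and> (\<forall>i<n. P g i = 0) \<and>
     (\<forall>x y. ip {..<n} (P x) (P y) = ip {..<Suc n} x y - ip {..<Suc n} x g * ip {..<Suc n} g y / ip {..<Suc n} g g) \<and>
     (\<lambda>x. restrict (P x) {..<n}) \<in> measurable (CG {..<Suc n}) (CG {..<n}) \<and>
     distr (CG {..<Suc n}) (CG {..<n}) (\<lambda>x. restrict (P x) {..<n}) = CG {..<n}"
proof -
  \<comment> \<open>\<open>P\<close> turns \<open>g\<close> to the last axis, so that deleting
    coordinate \<open>n\<close> is the projection onto the orthogonal complement of
    \<open>g\<close>.\<close>
  obtain P where P: "rot {..<Suc n} P" "\<And>i. i < n \<Longrightarrow> P g i = 0"
    using rot_annihilate_exists[of "{..<Suc n}" n g] by auto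
  have s: "ip {..<Suc n} x y = ip {..<n} x y + x n * cnj (y n)" for x y
    by (simp add: ip_def)
  have pz: "ip {..<n} x (P g) = 0" "ip {..<n} (P g) y = 0" for x y
    using P(2) by (auto simp: ip_def)
  have e1: "ip {..<Suc n} x y = ip {..<n} (P x) (P y) + P x n * cnj (P y n)" for x y
    using rot_ip[OF P(1), of x y] by (simp add: s)
  have e2: "ip {..<Suc n} x g = P x n * cnj (P g n)" for x
    using e1[of x g] by (simp add: pz)
  have e3: "ip {..<Suc n} g y = P g n * cnj (P y n)" for y
    using e1[of g y] by (simp add: pz)
  have Pg: "P g n \<noteq> 0" using g e2[of g] by auto
  have "ip {..<n} (P x) (P y) = ip {..<Suc n} x y - ip {..<Suc n} x g * ip {..<Suc n} g y / ip {..<Suc n} g g" for x y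
    unfolding e2 e3 using e1[of x y] Pg by (simp add: field_simps)
  moreover have m: "(\<lambda>x. restrict x {..<n}) \<in> measurable (CG {..<Suc n}) (CG {..<n})"
    by (rule measurable_restrict_subset) auto
  moreover note mP = measurable_rot[OF P(1)]
  moreover have m': "(\<lambda>x. restrict (P x) {..<n}) \<in> measurable (CG {..<Suc n}) (CG {..<n})"
    using measurable_comp[OF mP m] by (simp add: comp_def)
  moreover have "distr (CG {..<Suc n}) (CG {..<n}) (\<lambda>x. restrict (P x) {..<n}) = CG {..<n}"
  proof -
    have "distr (CG {..<Suc n}) (CG {..<n}) (\<lambda>x. restrict (P x) {..<n})
      = distr (distr (CG {..<Suc n}) (CG {..<Suc n}) P) (CG {..<n}) (\<lambda>x. restrict x {..<n})"
      by (subst distr_distr[OF m mP]) (simp add: comp_def)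
    also have "\<dots> = CG {..<n}"
      unfolding distr_rot[OF P(1) finite_lessThan] by (rule distr_CG_restrict) auto
    finally show ?thesis .
  qed
  ultimately show ?thesis using rot_clin[OF P(1)] P(2) by blast
qed

subsection \<open>The Gram--Schmidt residual\<close>

definition reject :: "nat \<Rightarrow> (nat \<Rightarrow> complex) \<Rightarrow> (nat \<Rightarrow> complex) \<Rightarrow> nat \<Rightarrow> complex" where
  "reject n g x = (\<lambda>i. x i - ip {..<n} x g / ip {..<n} g g * g i)"

text \<open>Since \<open>x / 0 = 0\<close>, a vanishing \<open>g\<close> rejects nothing; \<open>nondeg\<close> excludes this case.\<close>

fun residual :: "nat \<Rightarrow> (nat \<Rightarrow> complex) list \<Rightarrow> (nat \<Rightarrow> complex) \<Rightarrow> real" where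
  "residual n [] v = Re (ip {..<n} v v)"
| "residual n (g # gs) v = residual n (map (reject n g) gs) (reject n g v)"

fun nondeg :: "nat \<Rightarrow> (nat \<Rightarrow> complex) list \<Rightarrow> bool" where
  "nondeg n [] = True"
| "nondeg n (g # gs) = (ip {..<n} g g \<noteq> 0 \<and> nondeg n (map (reject n g) gs))"

lemma ip_diff_left: "ip I (\<lambda>i. x i - a * y i) z = ip I x z - a * ip I y z"
  using ip_add_left[of I "-a" y x z] by simp

lemma ip_diff_right: "ip I z (\<lambda>i. x i - a * y i) = ip I z x - cnj a * ip I z y"
  using ip_add_right[of I z "-a" y x] by simp

lemma ip_reject:
  assumes "ip {..<n} g g \<noteq> 0"
  shows "ip {..<n} (reject n g x) (reject n g y) = 
    ip {..<n} x y - ip {..<n} x g * ip {..<n} g y / ip {..<n} g g"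
    "ip {..<n} (reject n g x) g = 0"
proof -
  have r: "cnj (ip {..<n} g g) = ip {..<n} g g" by (metis ip_commute)
  have "cnj (ip {..<n} y g) = ip {..<n} g y" by (metis ip_commute)
  then show "ip {..<n} (reject n g x) (reject n g y) = 
    ip {..<n} x y - ip {..<n} x g * ip {..<n} g y / ip {..<n} g g"
    using assms unfolding reject_def ip_diff_left ip_diff_right by (simp add: r field_simps)
  show "ip {..<n} (reject n g x) g = 0"
    using assms unfolding reject_def ip_diff_left by simp
qed

lemma reject_lin: "reject n g (\<lambda>i. a * x i + y i) = (\<lambda>i. a * reject n g x i + reject n g y i)"
  unfolding reject_def ip_add_left by (simp add: fun_eq_iff algebra_simps add_divide_distrib)

lemma reject_scale: "reject n g (\<lambda>i. a * x i) = (\<lambda>i. a * reject n g x i)"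
proof -
  have "ip {..<n} (\<lambda>i. a * x i) g = a * ip {..<n} x g" by (simp add: ip_def sum_distrib_left mult.assoc)
  then show ?thesis by (simp add: reject_def fun_eq_iff algebra_simps)
qed

lemma residual_scale: "residual n gs (\<lambda>i. a * x i) = (cmod a)\<^sup>2 * residual n gs x"
\<comment> \<open>The recursive call is on \<open>map (reject n g) gs'\<close> and not on the tail
  itself, hence induction on the length, here and below.\<close>
proof (induction gs arbitrary: x rule: length_induct)
  case (1 gs)
  show ?case
  proof (cases gs)
    case Nil
    then show ?thesis by (simp add: Re_ip_self norm_mult power_mult_distrib sum_distrib_left)
  next
    case (Cons g gs')
    then show ?thesis using 1[rule_format, of "map (reject n g) gs'"] by (simp add: reject_scale)
  qed
qed

lemma residual_nonneg: "0 \<le> residual n gs x"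
proof (induction gs arbitrary: x rule: length_induct)
  case (1 gs)
  then show ?case by (cases gs) (auto simp: Re_ip_self_nonneg)
qed

text \<open>Pythagoras: by \<open>ip_reject\<close> the squared norm loses
  \<open>|ip x g|^2 / ip g g\<close>.\<close>

lemma reject_norm_le: "Re (ip {..<n} (reject n g x) (reject n g x)) \<le> Re (ip {..<n} x x)"
proof (cases "ip {..<n} g g = 0")
  case True
  then show ?thesis by (simp add: reject_def)
next
  case False
  define r where "r = (\<Sum>i<n. (cmod (g i))\<^sup>2)"
  have r: "ip {..<n} g g = of_real r" "r \<ge> 0" unfolding r_def by (simp_all add: ip_self sum_nonneg)
  have e: "ip {..<n} x g * ip {..<n} g x / ip {..<n} g g = of_real ((cmod (ip {..<n} x g))\<^sup>2 / r)"
    unfolding of_real_divide complex_norm_square r ip_commute[of _ g x] by simp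
  show ?thesis unfolding ip_reject(1)[OF False] e using r(2) by (simp del: of_real_divide of_real_power)
qed

lemma residual_le: "residual n gs x \<le> Re (ip {..<n} x x)"
proof (induction gs arbitrary: x rule: length_induct)
  case (1 gs)
  show ?case
  proof (cases gs)
    case (Cons g gs')
    then have "residual n gs x \<le> Re (ip {..<n} (reject n g x) (reject n g x))" using 1 by simp
    then show ?thesis using reject_norm_le order_trans by blast
  qed simp
qed

text \<open>Reduces independence of all columns to two facts with separate proofs: independence of
  the interfering columns, and a nonzero residual of the desired one.\<close>

lemma nondeg_snoc: "nondeg n (gs @ [v]) \<longleftrightarrow> nondeg n gs \<and> residual n gs v \<noteq> 0"
proof (induction gs arbitrary: v rule: length_induct)
  case (1 gs)
  show ?case
  proof (cases gs)
    case Nil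
    then show ?thesis by (simp add: ip_self del: of_real_sum of_real_power)
  next
    case (Cons g gs')
    then show ?thesis using 1[rule_format, of "map (reject n g) gs'"] by simp
  qed
qed

text \<open>The residual is built from inner products and combinations \<open>x - c * y\<close>, so
  a linear map that preserves inner products on a set closed under these combinations preserves it.
  The set \<open>V\<close> is there because the coisometries preserve inner products only
  orthogonally to \<open>g\<close>.\<close>

lemma residual_transport:
  assumes P: "clin P" and V: "\<And>x y c. V x \<Longrightarrow> V y \<Longrightarrow> V (\<lambda>i. x i - c * y i)"
    and iso: "\<And>x y. V x \<Longrightarrow> V y \<Longrightarrow> ip {..<m} (P x) (P y) = ip {..<n} x y"
    and gs: "\<forall>g\<in>set gs. V g" and v: "V v"
  shows "residual m (map P gs) (P v) = residual n gs v \<and> nondeg m (map P gs) = nondeg n gs"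
  using gs v
proof (induction gs arbitrary: v rule: length_induct)
  case (1 gs)
  show ?case
  proof (cases gs)
    case Nil
    then show ?thesis using iso[of v v] 1 by simp
  next
    case (Cons g gs')
    have r: "reject m (P g) (P x) = P (reject n g x)" if "V x" for x
    proof
      fix i
      have "V g" using 1 Cons by simp
      then show "reject m (P g) (P x) i = P (reject n g x) i"
        unfolding reject_def clin_simps(3)[OF P] using that by (simp add: iso)
    qed
    have Vr: "V (reject n g x)" if "V x" for x
      unfolding reject_def by (rule V) (use 1 Cons that in auto)
    have m: "map (reject m (P g) \<circ> P) gs' = map P (map (reject n g) gs')"
      using 1(2) Cons by (auto simp: r)
    have "residual m (map P (map (reject n g) gs')) (P (reject n g v)) = residual n (map (reject n g) gs') (reject n g v) 
       \<and> nondeg m (map P (map (reject n g) gs')) = nondeg n (map (reject n g) gs')"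
      by (rule 1(1)[rule_format]) (use 1(2,3) Cons Vr in auto)
    then show ?thesis using 1(2,3) Cons by (simp add: r m iso) 
  qed
qed

lemma reject_cong: "(\<And>i. i < n \<Longrightarrow> g i = g' i) \<Longrightarrow> (\<And>i. i < n \<Longrightarrow> x i = x' i) \<Longrightarrow> i < n \<Longrightarrow> reject n g x i = reject n g' x' i"
  unfolding reject_def
  using ip_cong[of "{..<n}" x x' g g'] ip_cong[of "{..<n}" g g' g g'] by simp

text \<open>The recursion looks at coordinates below \<open>n\<close> only. This bridges the gap
  between a projected vector and its restriction to \<open>{..<n}\<close>, which are different
  functions.\<close>

lemma residual_cong:
  assumes "length gs = length gs'" "\<And>j i. j < length gs \<Longrightarrow> i < n \<Longrightarrow> (gs ! j) i = (gs' ! j) i" "\<And>i. i < n \<Longrightarrow> x i = x' i"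
  shows "residual n gs x = residual n gs' x' \<and> nondeg n gs = nondeg n gs'"
  using assms
proof (induction gs arbitrary: gs' x x' rule: length_induct)
  case (1 gs)
  show ?case
  proof (cases gs)
    case Nil
    then show ?thesis using 1 ip_cong[of "{..<n}" x x' x x'] by simp
  next
    case (Cons g hs)
    then obtain g' hs' where gs': "gs' = g' # hs'" using 1 by (cases gs') auto
    have gg: "g i = g' i" if "i < n" for i using 1(3)[of 0 i] that Cons gs' by auto
    have hh: "(hs ! j) i = (hs' ! j) i" if "j < length hs" "i < n" for i j
      using 1(3)[of "Suc j" i] that Cons gs' by auto
    have l: "length hs = length hs'" using 1 Cons gs' by simp
    have "residual n (map (reject n g) hs) (reject n g x) = residual n (map (reject n g') hs') (reject n g' x') 
       \<and> nondeg n (map (reject n g) hs) = nondeg n (map (reject n g') hs')"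
      by (rule 1(1)[rule_format]) (use Cons l gg hh 1(4) in \<open>auto intro!: reject_cong\<close>)
    moreover have "ip {..<n} g g = ip {..<n} g' g'" by (rule ip_cong) (use gg in auto)
    ultimately show ?thesis using Cons gs' by simp
  qed
qed

text \<open>Once \<open>g\<close> is rejected, all vectors lie in its orthogonal complement, on
  which \<open>P\<close> preserves inner products. Since \<open>P g\<close> vanishes below
  \<open>m\<close>, the image under \<open>P\<close> does not show whether \<open>g\<close> has been
  rejected.\<close>

lemma residual_coisometry:
  assumes P: "clin P" and g: "ip {..<n} g g \<noteq> 0"
    and iso: "\<And>x y. ip {..<m} (P x) (P y) = ip {..<n} x y - ip {..<n} x g * ip {..<n} g y / ip {..<n} g g"
    and Pg: "\<And>i. i < m \<Longrightarrow> P g i = 0"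
  shows "residual n (g # gs) v = residual m (map P gs) (P v)"
    "nondeg n (g # gs) = nondeg m (map P gs)"
proof -
  define V where "V x \<longleftrightarrow> ip {..<n} x g = 0" for x
  have VV: "V (\<lambda>i. x i - c * y i)" if "V x" "V y" for x y c
    using that by (simp add: V_def ip_diff_left)
  have 1: "residual m (map P (map (reject n g) gs)) (P (reject n g v)) = residual n (map (reject n g) gs) (reject n g v) 
      \<and> nondeg m (map P (map (reject n g) gs)) = nondeg n (map (reject n g) gs)"
    by (rule residual_transport[where V=V, OF P VV]) (auto simp: iso V_def ip_reject(2)[OF g])
  have e: "P (reject n g x) i = P x i" if "i < m" for i x
    unfolding reject_def clin_simps(3)[OF P] using Pg that by simp
  have 2: "residual m (map P (map (reject n g) gs)) (P (reject n g v)) = residual m (map P gs) (P v)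
    \<and> nondeg m (map P (map (reject n g) gs)) = nondeg m (map P gs)"
    by (rule residual_cong) (auto simp: e)
  show "residual n (g # gs) v = residual m (map P gs) (P v)"
    "nondeg n (g # gs) = nondeg m (map P gs)"
    using 1 2 g by auto
qed

text \<open>The normal equations determine the projection: a point of \<open>v + span gs\<close>
  that is orthogonal to \<open>gs\<close> realises the residual. \<open>channel_reduction\<close>
  uses this to read the residual off the inverse Gram matrix.\<close>

lemma residual_eqI:
  assumes w: "\<And>i. i < n \<Longrightarrow> w i = v i + (\<Sum>j<length gs. c j * (gs ! j) i)"
    and orth: "\<And>j. j < length gs \<Longrightarrow> ip {..<n} w (gs ! j) = 0"
  shows "residual n gs v = Re (ip {..<n} w w)"
  using assms
proof (induction gs arbitrary: v c rule: length_induct)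
  case (1 gs)
  show ?case
  proof (cases gs)
    case Nil
    then show ?thesis using 1(2) ip_cong[of "{..<n}" w v w v] by simp
  next
    case (Cons g hs)
    have wg: "ip {..<n} w g = 0" using 1(3)[of 0] Cons by simp
    then have gw: "ip {..<n} g w = 0" by (metis complex_cnj_zero ip_commute)
    have rw: "reject n g w = w" by (simp add: reject_def wg)
    \<comment> \<open>If \<open>ip {..<n} g g = 0\<close>, nothing is subtracted, but then
      \<open>g\<close> itself vanishes below \<open>n\<close>.\<close>
    have rg: "reject n g g i = 0" if "i < n" for i
      using ip_self_eq_0_iff[of "{..<n}" g] that by (auto simp: reject_def)
    have lin: "reject n g (\<lambda>i. x i + (\<Sum>j\<in>J. c j * y j i)) i = reject n g x i + (\<Sum>j\<in>J. c j * reject n g (y j) i)" 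
      if "finite J" for J :: "nat set" and x y c i
      using that
    proof (induction J arbitrary: i rule: finite_induct)
      case (insert j J)
      have e: "(\<lambda>i. x i + (\<Sum>j\<in>insert j J. c j * y j i)) = (\<lambda>i. c j * y j i + (x i + (\<Sum>j\<in>J. c j * y j i)))"
        using insert by (simp add: fun_eq_iff)
      show ?case unfolding e reject_lin using insert by simp
    qed simp
    have "residual n (map (reject n g) hs) (reject n g v) = Re (ip {..<n} w w)"
    proof (rule 1(1)[rule_format])
      fix i assume i: "i < n"
      have "w i = reject n g w i" by (simp add: rw)
      also have "\<dots> = reject n g (\<lambda>i. v i + (\<Sum>j<length gs. c j * (gs ! j) i)) i"
        by (rule reject_cong) (use 1(2) i in auto)
      also have "\<dots> = reject n g v i + (\<Sum>j<length gs. c j * reject n g (gs ! j) i)"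
        by (rule lin) simp
      also have "(\<Sum>j<length gs. c j * reject n g (gs ! j) i) = (\<Sum>j<length hs. c (Suc j) * reject n g (hs ! j) i)"
        using rg[OF i] by (simp add: Cons sum.lessThan_Suc_shift del: sum.lessThan_Suc)
      finally show "w i = reject n g v i + (\<Sum>j<length (map (reject n g) hs). c (Suc j) * (map (reject n g) hs ! j) i)"
        by simp
    next
      fix j assume "j < length (map (reject n g) hs)"
      then show "ip {..<n} w (map (reject n g) hs ! j) = 0"
        using 1(3)[of "Suc j"] Cons wg unfolding reject_def by (simp add: ip_diff_right del: times_divide_eq_left)
    qed (simp add: Cons)
    then show ?thesis using Cons by simp
  qed
qed

text \<open>Rejecting \<open>g\<close> removes the first term of a linear relation. By induction the
  other coefficients vanish, and then so does the first, since \<open>g\<close> is nonzero.\<close>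

lemma nondeg_independent:
  assumes "nondeg n gs" and "\<And>i. i < n \<Longrightarrow> (\<Sum>j<length gs. c j * (gs ! j) i) = 0" and "j < length gs"
  shows "c j = 0"
  using assms
proof (induction gs arbitrary: c j rule: length_induct)
  case (1 gs)
  show ?case
  proof (cases gs)
    case (Cons g hs)
    have g: "ip {..<n} g g \<noteq> 0" using 1(2) Cons by simp
    have rg: "reject n g g i = 0" for i
      using g by (simp add: reject_def)
    have lin: "reject n g (\<lambda>i. (\<Sum>j\<in>J. c j * y j i)) i = (\<Sum>j\<in>J. c j * reject n g (y j) i)" 
      if "finite J" for J :: "nat set" and y c i
      using that
    proof (induction J arbitrary: i rule: finite_induct)
      case empty
      then show ?case by (simp add: reject_def ip_def)
    next
      case (insert j J)
      have e: "(\<lambda>i. (\<Sum>j\<in>insert j J. c j * y j i)) = (\<lambda>i. c j * y j i + (\<Sum>j\<in>J. c j * y j i))"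
        using insert by (simp add: fun_eq_iff)
      show ?case unfolding e reject_lin using insert by simp
    qed
    have c: "c (Suc j) = 0" if "j < length hs" for j
    proof (rule 1(1)[rule_format, of "map (reject n g) hs" "\<lambda>j. c (Suc j)"])
      fix i assume i: "i < n"
      have "0 = reject n g (\<lambda>i. (\<Sum>j<length gs. c j * (gs ! j) i)) i"
      proof -
        have "reject n g (\<lambda>i. (\<Sum>j<length gs. c j * (gs ! j) i)) i = reject n g (\<lambda>i. 0) i"
          by (rule reject_cong) (use 1(3) i in auto)
        then show ?thesis by (simp add: reject_def ip_def)
      qed
      also have "\<dots> = (\<Sum>j<length gs. c j * reject n g (gs ! j) i)"
        by (rule lin) simp
      also have "\<dots> = (\<Sum>j<length hs. c (Suc j) * reject n g (hs ! j) i)"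
        using rg[of i] by (simp add: Cons sum.lessThan_Suc_shift del: sum.lessThan_Suc)
      finally show "(\<Sum>j<length (map (reject n g) hs). c (Suc j) * (map (reject n g) hs ! j) i) = 0"
        by simp
    qed (use 1(2) Cons that in auto)
    have c0: "c 0 = 0"
    proof -
      obtain i where i: "i < n" "g i \<noteq> 0" using g ip_self_eq_0_iff[of "{..<n}" g] by auto
      have "(\<Sum>j<length gs. c j * (gs ! j) i) = c 0 * g i"
        using c by (simp add: Cons sum.lessThan_Suc_shift del: sum.lessThan_Suc)
      then show ?thesis using 1(3)[OF i(1)] i by simp
    qed
    show ?thesis using c c0 1(4) Cons by (cases j) auto
  qed (use 1 in simp)
qed

section \<open>Measurability of residuals\<close>

lemma measurable_ip[measurable (raw)]:
  assumes "\<And>i. i \<in> I \<Longrightarrow> (\<lambda>w. x w i) \<in> borel_measurable M" "\<And>i. i \<in> I \<Longrightarrow> (\<lambda>w. y w i) \<in> borel_measurable M"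
  shows "(\<lambda>w. ip I (x w) (y w)) \<in> borel_measurable M"
proof -
  have "cnj \<in> borel_measurable borel" by (intro borel_measurable_continuous_onI continuous_intros)
  then have "(\<lambda>w. cnj (y w i)) \<in> borel_measurable M" if "i \<in> I" for i
    using measurable_compose[OF assms(2)[OF that]] by auto
  then show ?thesis
    unfolding ip_def using assms by (intro borel_measurable_sum borel_measurable_times) auto
qed

text \<open>A list of random vectors and not a random list: its length is fixed, so that the
  recursion can be unfolded under the measurability statement.\<close>

lemma measurable_residual:
  assumes "\<And>i. i < n \<Longrightarrow> (\<lambda>w. v w i) \<in> borel_measurable M" 
    "\<And>g i. g \<in> set gs \<Longrightarrow> i < n \<Longrightarrow> (\<lambda>w. g w i) \<in> borel_measurable M"
  shows "(\<lambda>w. residual n (map (\<lambda>g. g w) gs) (v w)) \<in> borel_measurable M \<and> 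
    Measurable.pred M (\<lambda>w. nondeg n (map (\<lambda>g. g w) gs))"
  using assms
proof (induction gs arbitrary: v rule: length_induct)
  case (1 gs)
  have ipm: "(\<lambda>w. ip {..<n} (x w) (y w)) \<in> borel_measurable M" 
    if "\<And>i. i < n \<Longrightarrow> (\<lambda>w. x w i) \<in> borel_measurable M" "\<And>i. i < n \<Longrightarrow> (\<lambda>w. y w i) \<in> borel_measurable M" for x y
    by (rule measurable_ip) (use that in auto)
  show ?case
  proof (cases gs)
    case Nil
    then show ?thesis using ipm[of v v] 1(2) by simp
  next
    case (Cons g hs)
    have rm: "(\<lambda>w. reject n (g w) (x w) i) \<in> borel_measurable M" if x: "\<And>i. i < n \<Longrightarrow> (\<lambda>w. x w i) \<in> borel_measurable M" and "i < n" for i x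
    proof -
      have [measurable]: "(\<lambda>w. x w i) \<in> borel_measurable M" "(\<lambda>w. g w i) \<in> borel_measurable M"
        "(\<lambda>w. ip {..<n} (x w) (g w)) \<in> borel_measurable M" "(\<lambda>w. ip {..<n} (g w) (g w)) \<in> borel_measurable M"
        using that 1(3) Cons by (auto intro!: ipm)
      show ?thesis unfolding reject_def by measurable
    qed
    define hs' where "hs' = map (\<lambda>h w. reject n (g w) (h w)) hs"
    have h: "map (\<lambda>g. g w) hs' = map (reject n (g w)) (map (\<lambda>g. g w) hs)" for w
      by (simp add: hs'_def)
    have IH: "(\<lambda>w. residual n (map (\<lambda>g. g w) hs') (reject n (g w) (v w))) \<in> borel_measurable M \<and> 
      Measurable.pred M (\<lambda>w. nondeg n (map (\<lambda>g. g w) hs'))"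
    proof (rule 1(1)[rule_format])
      show "length hs' < length gs" by (simp add: hs'_def Cons)
      fix i assume i: "i < n"
      show "(\<lambda>w. reject n (g w) (v w) i) \<in> borel_measurable M"
        by (rule rm) (use 1(2) i in auto)
      fix h assume "h \<in> set hs'"
      then obtain h0 where h0: "h0 \<in> set hs" "h = (\<lambda>w. reject n (g w) (h0 w))" by (auto simp: hs'_def)
      show "(\<lambda>w. h w i) \<in> borel_measurable M"
        unfolding h0(2) by (rule rm) (use 1(3) h0(1) Cons i in auto)
    qed
    have [measurable]: "(\<lambda>w. ip {..<n} (g w) (g w)) \<in> borel_measurable M"
      using 1(3) Cons by (auto intro!: ipm)
    from IH have [measurable]: "Measurable.pred M (\<lambda>w. nondeg n (map (\<lambda>g. g w) hs'))" by simp
    have "Measurable.pred M (\<lambda>w. ip {..<n} (g w) (g w) \<noteq> 0 \<and> nondeg n (map (\<lambda>g. g w) hs'))"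
      by measurable
    then show ?thesis using IH unfolding h Cons by (simp only: list.map residual.simps nondeg.simps simp_thms)
  qed
qed

subsection \<open>The noncentral chi-square law\<close>

lemma nn_integral_exp_even_power:
  "(\<integral>\<^sup>+x. ennreal (exp (- x\<^sup>2) * x ^ (2 * k)) \<partial>lborel) = ennreal (sqrt pi * (fact (2 * k) / (2 ^ (2 * k) * fact k)))"
proof -
  have "has_bochner_integral lborel (\<lambda>x::real. exp (- x\<^sup>2) * x ^ (2 * k)) (2 *\<^sub>R ((sqrt pi / 2) * (fact (2 * k) / (2 ^ (2 * k) * fact k))))"
    by (rule has_bochner_integral_even_function[OF gaussian_moment_even_pos]) simp
  then show ?thesis
    by (subst nn_integral_eq_integral) (auto simp: has_bochner_integral_iff power_mult)
qed

text \<open>The image under \<open>\<bar>z\<bar>\<^sup>2\<close> of the measure \<open>(Re z)\<^sup>2\<^sup>k dz\<close> is homogeneous, hence a multiple of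
  \<open>t\<^sup>k dt\<close>; the Gaussian moments determine the factor.\<close>

definition disc_moment :: "nat \<Rightarrow> ennreal" where
  "disc_moment k = (\<integral>\<^sup>+z. ennreal ((Re z) ^ (2 * k)) * indicator {z. (cmod z)\<^sup>2 \<le> 1} z \<partial>lborel)"

text \<open>Substituting \<open>sqrt r * z\<close>, the integrand contributes \<open>r ^ k\<close>
  and the area element \<open>r\<close>.\<close>

lemma disc_moment_scale:
  assumes "r > 0"
  shows "(\<integral>\<^sup>+z. ennreal ((Re z) ^ (2 * k)) * indicator {z. (cmod z)\<^sup>2 \<le> r} z \<partial>lborel) = ennreal (r ^ Suc k) * disc_moment k"
proof -
  have "ennreal (r ^ k) * disc_moment k = (\<integral>\<^sup>+z. ennreal (r ^ k) * (ennreal ((Re z) ^ (2 * k)) * indicator {z. (cmod z)\<^sup>2 \<le> 1} z) \<partial>lborel)"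
    unfolding disc_moment_def by (rule nn_integral_cmult[symmetric]) measurable
  also have "\<dots> = (\<integral>\<^sup>+z. (\<lambda>z. ennreal ((Re z) ^ (2 * k)) * indicator {z. (cmod z)\<^sup>2 \<le> r} z) (of_real (sqrt r) * z) \<partial>lborel)"
  proof (rule nn_integral_cong)
    fix z :: complex
    have "(cmod (of_real (sqrt r) * z))\<^sup>2 = r * (cmod z)\<^sup>2"
      using assms by (simp add: norm_mult power_mult_distrib)
    then have "(cmod (of_real (sqrt r) * z))\<^sup>2 \<le> r \<longleftrightarrow> (cmod z)\<^sup>2 \<le> 1" using assms by simp
    moreover have "(Re (of_real (sqrt r) * z)) ^ (2 * k) = r ^ k * (Re z) ^ (2 * k)"
      using assms by (simp add: power_mult_distrib power_mult)
    ultimately show "ennreal (r ^ k) * (ennreal ((Re z) ^ (2 * k)) * indicator {z. (cmod z)\<^sup>2 \<le> 1} z) =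
       (\<lambda>z. ennreal ((Re z) ^ (2 * k)) * indicator {z. (cmod z)\<^sup>2 \<le> r} z) (of_real (sqrt r) * z)"
      using assms by (simp add: ennreal_mult indicator_def power_mult)
  qed
  also have "\<dots> = ennreal (1 / (cmod (of_real (sqrt r)))\<^sup>2) *
      (\<integral>\<^sup>+z. ennreal ((Re z) ^ (2 * k)) * indicator {z. (cmod z)\<^sup>2 \<le> r} z \<partial>lborel)"
    using assms by (intro nn_integral_complex_mult) auto
  finally have "ennreal (r ^ k) * disc_moment k = ennreal (1 / r) * (\<integral>\<^sup>+z. ennreal ((Re z) ^ (2 * k)) * indicator {z. (cmod z)\<^sup>2 \<le> r} z \<partial>lborel)"
    (is "_ = _ * ?I") using assms by simp
  then have "ennreal r * (ennreal (r ^ k) * disc_moment k) = ennreal r * (ennreal (1 / r) * ?I)" by simp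
  then show ?thesis using assms by (simp add: mult.assoc[symmetric] ennreal_mult[symmetric])
qed

lemma disc_moment_finite: "disc_moment k < \<infinity>"
proof -
  have "disc_moment k \<le> (\<integral>\<^sup>+z. indicator (cball 0 1) (z::complex) \<partial>lborel)"
    unfolding disc_moment_def
  proof (rule nn_integral_mono)
    fix z :: complex
    have "(Re z) ^ (2 * k) \<le> 1" if "(cmod z)\<^sup>2 \<le> 1"
    proof -
      have "cmod z \<le> 1" using that by (simp add: abs_square_le_1)
      then have "\<bar>Re z\<bar> \<le> 1" using abs_Re_le_cmod[of z] by linarith
      then have "\<bar>Re z\<bar> ^ (2 * k) \<le> 1" by (intro power_le_one) auto
      then show ?thesis by (simp add: power_even_abs)
    qed
    then show "ennreal ((Re z) ^ (2 * k)) * indicator {z. (cmod z)\<^sup>2 \<le> 1} z \<le> indicator (cball 0 1) z"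
      by (auto simp: indicator_def abs_square_le_1 ennreal_le_1)
  qed
  also have "\<dots> < \<infinity>"
    using emeasure_bounded_finite[of "cball 0 1 :: complex set"] by simp
  finally show ?thesis .
qed

text \<open>The image measure and the proposed density agree on all half-lines \<open>{..r}\<close>,
  which generate the Borel sets; both are finite there by \<open>disc_moment_finite\<close>. The
  factor \<open>Suc k\<close> comes from the derivative of \<open>r ^ Suc k\<close>.\<close>

lemma nn_integral_disc_power:
  assumes F: "F \<in> borel_measurable borel"
  shows "(\<integral>\<^sup>+z. F ((cmod z)\<^sup>2) * ennreal ((Re z) ^ (2 * k)) \<partial>lborel) = 
    (disc_moment k * of_nat (Suc k)) * (\<integral>\<^sup>+t. F t * (ennreal (t ^ k) * indicator {0..} t) \<partial>lborel)"
proof -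
  define A where "A = distr (density lborel (\<lambda>z::complex. ennreal ((Re z) ^ (2 * k)))) borel (\<lambda>z. (cmod z)\<^sup>2)"
  define B where "B = density lborel (\<lambda>t::real. (disc_moment k * of_nat (Suc k)) * (ennreal (t ^ k) * indicator {0..} t))"
  have A: "emeasure A {..r} = (if r > 0 then ennreal (r ^ Suc k) * disc_moment k else 0)" for r
  proof -
    have "emeasure A {..r} = (\<integral>\<^sup>+z. ennreal ((Re z) ^ (2 * k)) * indicator {z. (cmod z)\<^sup>2 \<le> r} z \<partial>lborel)"
    proof -
      have "emeasure A {..r} = emeasure (density lborel (\<lambda>z::complex. ennreal ((Re z) ^ (2 * k)))) {z. (cmod z)\<^sup>2 \<le> r}"
        unfolding A_def by (subst emeasure_distr) (auto intro!: arg_cong2[where f=emeasure])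
      then show ?thesis by (simp add: emeasure_density)
    qed
    moreover have "(\<integral>\<^sup>+z. ennreal ((Re z) ^ (2 * k)) * indicator {z. (cmod z)\<^sup>2 \<le> r} z \<partial>lborel) = 0" if "r \<le> 0"
    proof -
      have "AE z in lborel. z \<noteq> (0::complex)" by (rule AE_lborel_singleton)
      then have "AE z in lborel. ennreal ((Re z) ^ (2 * k)) * indicator {z. (cmod z)\<^sup>2 \<le> r} z = 0"
      proof eventually_elim
        case (elim z)
        then have "(cmod z)\<^sup>2 > 0" by simp
        then have "\<not> (cmod z)\<^sup>2 \<le> r" using that by linarith
        then show ?case by (simp add: indicator_def)
      qed
      then show ?thesis by (subst nn_integral_0_iff_AE) auto
    qed
    ultimately show ?thesis using disc_moment_scale[of r k] by auto
  qed
  have B: "emeasure B {..r} = (if r > 0 then ennreal (r ^ Suc k) * disc_moment k else 0)" for r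
  proof -
    have "emeasure B {..r} = (\<integral>\<^sup>+t. disc_moment k * (ennreal (real (Suc k) * t ^ k) * indicator {0..r} t) \<partial>lborel)"
      unfolding B_def by (subst emeasure_density)
        (auto intro!: nn_integral_cong simp: indicator_def ennreal_mult ennreal_of_nat_eq_real_of_nat mult.assoc)
    also have "\<dots> = disc_moment k * (\<integral>\<^sup>+t. (ennreal (real (Suc k) * t ^ k) * indicator {0..r} t) \<partial>lborel)"
      by (rule nn_integral_cmult) auto
    also have "(\<integral>\<^sup>+t. (ennreal (real (Suc k) * t ^ k) * indicator {0..r} t) \<partial>lborel) = (if r > 0 then ennreal (r ^ Suc k) else 0)"
    proof (cases "r > 0")
      case True
      have "(\<integral>\<^sup>+t. (ennreal (real (Suc k) * t ^ k) * indicator {0..r} t) \<partial>lborel) = ennreal (r ^ Suc k - 0 ^ Suc k)"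
      proof (rule nn_integral_FTC_Icc[where F="\<lambda>t. t ^ Suc k"])
        have "DERIV (\<lambda>t. t ^ Suc k) t :> real (Suc k) * t ^ k" for t :: real
          using DERIV_pow[of "Suc k" t] by (simp del: power_Suc)
        then show "DERIV (\<lambda>t. t ^ Suc k) t :> real (Suc k) * t ^ k" for t
          by blast
      qed (use True in auto)
      then show ?thesis using True by simp
    next
      case False
      have "AE z in lborel. z \<noteq> (0::real)" by (rule AE_lborel_singleton)
      then have "AE t in lborel. (ennreal (real (Suc k) * t ^ k) * indicator {0..r} t) = 0"
        by eventually_elim (use False in \<open>auto simp: indicator_def\<close>)
      then have "(\<integral>\<^sup>+t. (ennreal (real (Suc k) * t ^ k) * indicator {0..r} t) \<partial>lborel) = 0"
        by (subst nn_integral_0_iff_AE) auto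
      then show ?thesis using False by simp
    qed
    finally show ?thesis by (simp add: mult.commute)
  qed
  have "A = B"
  proof (rule measure_eqI_generator_eq[where E="range (\<lambda>r::real. {..r})" and \<Omega>=UNIV and A="\<lambda>n. {..real n}"])
    show "Int_stable (range (\<lambda>r::real. {..r}))" by (auto simp: Int_stable_def)
    show "sets A = sigma_sets UNIV (range atMost)" "sets B = sigma_sets UNIV (range atMost)"
      unfolding A_def B_def by (simp_all add: borel_eq_atMost)
    show "(\<Union>i. {..real i}) = UNIV" using real_arch_simple by auto
    show "emeasure A {..real i} \<noteq> \<infinity>" for i
      unfolding A using disc_moment_finite[of k] by (auto simp: ennreal_mult_eq_top_iff)
  qed (use A B in auto)
  then have "(\<integral>\<^sup>+t. F t \<partial>A) = (\<integral>\<^sup>+t. F t \<partial>B)" by simp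
  moreover have "(\<integral>\<^sup>+t. F t \<partial>A) = (\<integral>\<^sup>+z. F ((cmod z)\<^sup>2) * ennreal ((Re z) ^ (2 * k)) \<partial>lborel)"
    unfolding A_def using F by (subst nn_integral_distr, simp_all, subst nn_integral_density) (simp_all add: mult.commute)
  moreover have "(\<integral>\<^sup>+t. F t \<partial>B) = (disc_moment k * of_nat (Suc k)) * (\<integral>\<^sup>+t. F t * (ennreal (t ^ k) * indicator {0..} t) \<partial>lborel)"
    unfolding B_def using F
    by (subst nn_integral_density, simp_all, subst nn_integral_cmult[symmetric]) (auto intro!: nn_integral_cong simp: mult_ac)
  ultimately show ?thesis by simp
qed

section \<open>Erlang densities and Poisson weights\<close>

lemma erlang_1: "ennreal (erlang_density k 1 t) = ennreal (exp (- t)) * (ennreal (t ^ k) * indicator {0..} t) * ennreal (1 / fact k)"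
  by (auto simp: erlang_density_def indicator_def ennreal_mult[symmetric] mult.commute)

lemma nn_integral_erlang_total: "l > 0 \<Longrightarrow> (\<integral>\<^sup>+t. ennreal (erlang_density k l t) \<partial>lborel) = 1"
  using prob_space.emeasure_space_1[OF prob_space_erlang_density[of l k]] by (simp add: emeasure_density)

text \<open>\<open>nn_integral_disc_power\<close> is tested with \<open>exp (- t)\<close>: the left
  side factors into one-dimensional Gaussian moments, and the right side is \<open>fact k\<close>
  times the unknown constant.\<close>

lemma disc_moment_eq: "disc_moment k * of_nat (Suc k) = ennreal (pi * fact (2 * k) / (4 ^ k * (fact k)\<^sup>2))"
proof -
  have "(\<integral>\<^sup>+z. ennreal (exp (- (cmod z)\<^sup>2)) * ennreal ((Re z) ^ (2 * k)) \<partial>lborel)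
     = (\<integral>\<^sup>+x. \<integral>\<^sup>+y. ennreal (exp (- (cmod (Complex x y))\<^sup>2)) * ennreal ((Re (Complex x y)) ^ (2 * k)) \<partial>lborel \<partial>lborel)"
    by (rule nn_integral_complex) measurable
  also have "\<dots> = (\<integral>\<^sup>+x. \<integral>\<^sup>+y. ennreal (exp (- x\<^sup>2) * x ^ (2 * k)) * ennreal (exp (- y\<^sup>2)) \<partial>lborel \<partial>lborel)"
    by (intro nn_integral_cong) (simp add: cmod_def ennreal_mult[symmetric] exp_diff exp_minus power_mult field_simps exp_add)
  also have "\<dots> = (\<integral>\<^sup>+x. ennreal (exp (- x\<^sup>2) * x ^ (2 * k)) * ennreal (sqrt pi) \<partial>lborel)"
    by (subst nn_integral_cmult) (auto simp: nn_integral_real_gauss)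
  also have "\<dots> = ennreal (sqrt pi * (fact (2 * k) / (2 ^ (2 * k) * fact k))) * ennreal (sqrt pi)"
    by (subst nn_integral_multc) (auto simp: nn_integral_exp_even_power)
  also have "\<dots> = ennreal (pi * fact (2 * k) / (4 ^ k * fact k))"
    by (subst ennreal_mult[symmetric]) (auto simp: power_mult)
  finally have 1: "(\<integral>\<^sup>+z. ennreal (exp (- (cmod z)\<^sup>2)) * ennreal ((Re z) ^ (2 * k)) \<partial>lborel) = ennreal (pi * fact (2 * k) / (4 ^ k * fact k))" .
  have "1 = (\<integral>\<^sup>+t. ennreal (erlang_density k 1 t) \<partial>lborel)" by (simp add: nn_integral_erlang_total)
  also have "\<dots> = (\<integral>\<^sup>+t. ennreal (exp (- t)) * (ennreal (t ^ k) * indicator {0..} t) \<partial>lborel) * ennreal (1 / fact k)"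
    unfolding erlang_1 by (rule nn_integral_multc) measurable
  finally have "1 * ennreal (fact k) = (\<integral>\<^sup>+t. ennreal (exp (- t)) * (ennreal (t ^ k) * indicator {0..} t) \<partial>lborel) * ennreal (1 / fact k) * ennreal (fact k)" 
    by (rule arg_cong)
  then have 2: "(\<integral>\<^sup>+t. ennreal (exp (- t)) * (ennreal (t ^ k) * indicator {0..} t) \<partial>lborel) = ennreal (fact k)"
    by (simp add: mult.assoc ennreal_mult[symmetric])
  have "ennreal (pi * fact (2 * k) / (4 ^ k * fact k)) = disc_moment k * of_nat (Suc k) * ennreal (fact k)"
    using nn_integral_disc_power[of "\<lambda>t. ennreal (exp (- t))" k] unfolding 1 2 by simp
  then have "ennreal (pi * fact (2 * k) / (4 ^ k * fact k)) * ennreal (1 / fact k) = disc_moment k * of_nat (Suc k) * (ennreal (fact k) * ennreal (1 / fact k))"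
    by (simp only: mult.assoc)
  then show ?thesis
    by (simp add: ennreal_mult[symmetric] power2_eq_square mult.assoc)
qed

text \<open>Poisson weights. For \<open>r = 0\<close> the convention \<open>0 ^ 0 = 1\<close> gives
  the point mass at 0, so that central laws are the case \<open>r = 0\<close> of the noncentral ones
  (\<open>suminf_pois_0\<close>).\<close>

definition pois :: "real \<Rightarrow> nat \<Rightarrow> real" where
  "pois r i = exp (- r) * r ^ i / fact i"

lemma pois_nonneg: "r \<ge> 0 \<Longrightarrow> pois r i \<ge> 0" by (simp add: pois_def)

lemma cosh_sums: "(\<lambda>i. x ^ (2 * i) / fact (2 * i)) sums cosh (x::real)"
proof -
  have "(\<lambda>n. if even n then x ^ n /\<^sub>R fact n else 0) sums cosh x" by (rule cosh_converges)
  then have "(\<lambda>n. if even (2 * n) then x ^ (2 * n) /\<^sub>R fact (2 * n) else 0) sums cosh x"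
    by (subst (asm) sums_mono_reindex[of "\<lambda>n. 2 * n", symmetric]) (auto simp: strict_mono_def elim!: evenE)
  then show ?thesis by (simp add: divide_inverse mult.commute)
qed

lemma nn_integral_complex_uminus:
  assumes "f \<in> borel_measurable borel"
  shows "(\<integral>\<^sup>+z. f (- z) \<partial>lborel) = (\<integral>\<^sup>+z. f (z::complex) \<partial>lborel)"
  using nn_integral_complex_mult[OF assms, of "-1"] by simp

text \<open>Averaging over \<open>z\<close> and \<open>- z\<close> turns the factor \<open>exp (2 s Re z)\<close> of the shifted density into
  \<open>cosh (2 s Re z)\<close>, whose Taylor series has nonnegative terms.\<close>

lemma shifted_cgauss_norm_real:
  assumes F[measurable]: "F \<in> borel_measurable borel" and s: "s \<ge> 0"
  shows "(\<integral>\<^sup>+z. F ((cmod (z + of_real s))\<^sup>2) \<partial>cgauss) = (\<Sum>i. ennreal (pois (s\<^sup>2) i) * (\<integral>\<^sup>+t. F t * ennreal (erlang_density i 1 t) \<partial>lborel))"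
proof -
  define g where "g z = exp (- (cmod z)\<^sup>2) * exp (- s\<^sup>2) / pi" for z :: complex
  have g: "exp (- (cmod (z - of_real s))\<^sup>2) / pi = g z * exp (2 * s * Re z)" for z
    by (simp add: g_def cmod_power2 power2_diff exp_add[symmetric] algebra_simps)
  have [measurable]: "g \<in> borel_measurable borel" unfolding g_def by measurable
  have g0: "g z \<ge> 0" for z by (simp add: g_def)
  have "(\<integral>\<^sup>+z. F ((cmod (z + of_real s))\<^sup>2) \<partial>cgauss) = (\<integral>\<^sup>+z. ennreal (exp (- (cmod z)\<^sup>2) / pi) * F ((cmod (z + of_real s))\<^sup>2) \<partial>lborel)"
    by (rule nn_integral_cgauss) measurable
  also have "\<dots> = (\<integral>\<^sup>+z. ennreal (exp (- (cmod (- of_real s + z))\<^sup>2) / pi) * F ((cmod (- of_real s + z + of_real s))\<^sup>2) \<partial>lborel)"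
    by (subst nn_integral_complex_translate[where t="- of_real s"]) simp_all
  also have "\<dots> = (\<integral>\<^sup>+z. ennreal (g z * exp (2 * s * Re z)) * F ((cmod z)\<^sup>2) \<partial>lborel)"
    by (simp add: g[symmetric])
  finally have 1: "(\<integral>\<^sup>+z. F ((cmod (z + of_real s))\<^sup>2) \<partial>cgauss) = (\<integral>\<^sup>+z. ennreal (g z * exp (2 * s * Re z)) * F ((cmod z)\<^sup>2) \<partial>lborel)" (is "?L = ?R") .
  have 2: "?R = (\<integral>\<^sup>+z. ennreal (g z * exp (- (2 * s * Re z))) * F ((cmod z)\<^sup>2) \<partial>lborel)"
    by (subst nn_integral_complex_uminus[symmetric]) (simp_all add: g_def)
  \<comment> \<open>Doubling replaces the average by a sum of two integrals; the factor 2 is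
    cancelled at the end.\<close>
  have "2 * ?R = ?R + ?R" by (rule mult_2)
  also have "\<dots> = ?R + (\<integral>\<^sup>+z. ennreal (g z * exp (- (2 * s * Re z))) * F ((cmod z)\<^sup>2) \<partial>lborel)"
    by (rule arg_cong[OF 2])
  also have "\<dots> = (\<integral>\<^sup>+z. ennreal (g z * exp (2 * s * Re z)) * F ((cmod z)\<^sup>2) + ennreal (g z * exp (- (2 * s * Re z))) * F ((cmod z)\<^sup>2) \<partial>lborel)"
    by (rule nn_integral_add[symmetric]) measurable
  also have "\<dots> = (\<integral>\<^sup>+z. 2 * (ennreal (g z * cosh (2 * s * Re z)) * F ((cmod z)\<^sup>2)) \<partial>lborel)"
  proof (rule nn_integral_cong)
    fix z
    have "ennreal (g z * exp (2 * s * Re z)) + ennreal (g z * exp (- (2 * s * Re z))) = ennreal (2 * (g z * cosh (2 * s * Re z)))"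
      using g0[of z] by (simp add: ennreal_plus[symmetric] cosh_def algebra_simps del: ennreal_plus)
    also have "\<dots> = 2 * ennreal (g z * cosh (2 * s * Re z))"
      using g0[of z] by (simp add: ennreal_mult)
    finally show "ennreal (g z * exp (2 * s * Re z)) * F ((cmod z)\<^sup>2) + ennreal (g z * exp (- (2 * s * Re z))) * F ((cmod z)\<^sup>2)
      = 2 * (ennreal (g z * cosh (2 * s * Re z)) * F ((cmod z)\<^sup>2))"
      by (simp add: distrib_right[symmetric] mult.assoc)
  qed
  also have "\<dots> = 2 * (\<integral>\<^sup>+z. ennreal (g z * cosh (2 * s * Re z)) * F ((cmod z)\<^sup>2) \<partial>lborel)"
    by (rule nn_integral_cmult) (simp add: cosh_def)
  finally have "?R = (\<integral>\<^sup>+z. ennreal (g z * cosh (2 * s * Re z)) * F ((cmod z)\<^sup>2) \<partial>lborel)"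
    by (simp add: ennreal_mult_cancel_left)
  also have "\<dots> = (\<integral>\<^sup>+z. (\<Sum>i. ennreal (exp (- s\<^sup>2) * (2 * s) ^ (2 * i) / fact (2 * i) / pi) *
       ((F ((cmod z)\<^sup>2) * ennreal (exp (- (cmod z)\<^sup>2))) * ennreal ((Re z) ^ (2 * i)))) \<partial>lborel)"
  proof (rule nn_integral_cong)
    fix z
    have "(\<lambda>i. g z * ((2 * s * Re z) ^ (2 * i) / fact (2 * i))) sums (g z * cosh (2 * s * Re z))"
      by (intro sums_mult cosh_sums)
    then have "(\<lambda>i. ennreal (g z * ((2 * s * Re z) ^ (2 * i) / fact (2 * i)))) sums ennreal (g z * cosh (2 * s * Re z))"
      using g0[of z] by (subst sums_ennreal) (auto intro!: mult_nonneg_nonneg divide_nonneg_nonneg simp: power_mult)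
    then have "ennreal (g z * cosh (2 * s * Re z)) = (\<Sum>i. ennreal (g z * ((2 * s * Re z) ^ (2 * i) / fact (2 * i))))"
      by (simp add: sums_iff)
    then have "ennreal (g z * cosh (2 * s * Re z)) * F ((cmod z)\<^sup>2) = (\<Sum>i. ennreal (g z * ((2 * s * Re z) ^ (2 * i) / fact (2 * i))) * F ((cmod z)\<^sup>2))"
      by simp
    also have "\<dots> = (\<Sum>i. ennreal (exp (- s\<^sup>2) * (2 * s) ^ (2 * i) / fact (2 * i) / pi) *
       ((F ((cmod z)\<^sup>2) * ennreal (exp (- (cmod z)\<^sup>2))) * ennreal ((Re z) ^ (2 * i))))"
    proof (rule suminf_cong)
      fix i
      have eq: "g z * ((2 * s * Re z) ^ (2 * i) / fact (2 * i)) = (exp (- s\<^sup>2) * (2 * s) ^ (2 * i) / fact (2 * i) / pi) * exp (- (cmod z)\<^sup>2) * ((Re z) ^ (2 * i))"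
        by (simp add: g_def power_mult_distrib field_simps)
      have split: "ennreal (A * B * C) * E = ennreal A * ((E * ennreal B) * ennreal C)" if "A \<ge> 0" "B \<ge> 0" "C \<ge> 0" for A B C E
        using that by (simp add: ennreal_mult mult_ac)
      have "0 \<le> (2 * s) ^ (2 * i)" "0 \<le> (Re z) ^ (2 * i)" by (simp_all add: power_mult)
      then show "ennreal (g z * ((2 * s * Re z) ^ (2 * i) / fact (2 * i))) * F ((cmod z)\<^sup>2) = ennreal (exp (- s\<^sup>2) * (2 * s) ^ (2 * i) / fact (2 * i) / pi) *
       ((F ((cmod z)\<^sup>2) * ennreal (exp (- (cmod z)\<^sup>2))) * ennreal ((Re z) ^ (2 * i)))"
        unfolding eq by (intro split) auto
    qed
    finally show "ennreal (g z * cosh (2 * s * Re z)) * F ((cmod z)\<^sup>2) = (\<Sum>i. ennreal (exp (- s\<^sup>2) * (2 * s) ^ (2 * i) / fact (2 * i) / pi) *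
       ((F ((cmod z)\<^sup>2) * ennreal (exp (- (cmod z)\<^sup>2))) * ennreal ((Re z) ^ (2 * i))))" .
  qed
  also have "\<dots> = (\<Sum>i. \<integral>\<^sup>+z. ennreal (exp (- s\<^sup>2) * (2 * s) ^ (2 * i) / fact (2 * i) / pi) *
       ((F ((cmod z)\<^sup>2) * ennreal (exp (- (cmod z)\<^sup>2))) * ennreal ((Re z) ^ (2 * i))) \<partial>lborel)"
    by (rule nn_integral_suminf) measurable
  also have "\<dots> = (\<Sum>i. ennreal (pois (s\<^sup>2) i) * (\<integral>\<^sup>+t. F t * ennreal (erlang_density i 1 t) \<partial>lborel))"
  proof (rule suminf_cong)
    fix i
    define E where "E = (\<integral>\<^sup>+t. (F t * ennreal (exp (- t))) * (ennreal (t ^ i) * indicator {0..} t) \<partial>lborel)"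
    have E: "(\<integral>\<^sup>+t. F t * ennreal (erlang_density i 1 t) \<partial>lborel) = E * ennreal (1 / fact i)"
      unfolding E_def erlang_1 by (subst nn_integral_multc[symmetric]) (auto simp: mult.assoc)
    have "(\<integral>\<^sup>+z. ennreal (exp (- s\<^sup>2) * (2 * s) ^ (2 * i) / fact (2 * i) / pi) *
       ((F ((cmod z)\<^sup>2) * ennreal (exp (- (cmod z)\<^sup>2))) * ennreal ((Re z) ^ (2 * i))) \<partial>lborel)
      = ennreal (exp (- s\<^sup>2) * (2 * s) ^ (2 * i) / fact (2 * i) / pi) * (ennreal (pi * fact (2 * i) / (4 ^ i * (fact i)\<^sup>2)) * E)"
      using nn_integral_disc_power[of "\<lambda>t. F t * ennreal (exp (- t))" i, folded E_def, unfolded disc_moment_eq]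
      by (subst nn_integral_cmult) auto
    also have "\<dots> = ennreal ((exp (- s\<^sup>2) * (2 * s) ^ (2 * i) / fact (2 * i) / pi) * (pi * fact (2 * i) / (4 ^ i * (fact i)\<^sup>2))) * E"
      by (subst ennreal_mult) (auto simp: mult.assoc power_mult)
    \<comment> \<open>\<open>fact (2 * i)\<close> cancels, \<open>4 ^ i\<close> takes care of the
      powers of 2, and of the two factors \<open>1 / fact i\<close> one completes the Poisson weight
      and the other the Erlang density.\<close>
    also have "(exp (- s\<^sup>2) * (2 * s) ^ (2 * i) / fact (2 * i) / pi) * (pi * fact (2 * i) / (4 ^ i * (fact i)\<^sup>2)) = pois (s\<^sup>2) i * (1 / fact i)"
      using power_mult_distrib[of "2::real" 2 i]
      by (simp add: pois_def power_mult power_mult_distrib field_simps power2_eq_square)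
    also have "ennreal (pois (s\<^sup>2) i * (1 / fact i)) * E = ennreal (pois (s\<^sup>2) i) * (E * ennreal (1 / fact i))"
      by (subst ennreal_mult) (auto simp: pois_nonneg mult_ac)
    finally show "(\<integral>\<^sup>+z. ennreal (exp (- s\<^sup>2) * (2 * s) ^ (2 * i) / fact (2 * i) / pi) *
       ((F ((cmod z)\<^sup>2) * ennreal (exp (- (cmod z)\<^sup>2))) * ennreal ((Re z) ^ (2 * i))) \<partial>lborel)
       = ennreal (pois (s\<^sup>2) i) * (\<integral>\<^sup>+t. F t * ennreal (erlang_density i 1 t) \<partial>lborel)"
      unfolding E .
  qed
  finally show ?thesis using 1 by simp
qed

text \<open>The phase of \<open>s\<close> is moved into \<open>z\<close>, whose law is invariant
  under it; the real shift \<open>cmod s\<close> is left.\<close>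

lemma shifted_cgauss_norm:
  assumes F[measurable]: "F \<in> borel_measurable borel"
  shows "(\<integral>\<^sup>+z. F ((cmod (z + s))\<^sup>2) \<partial>cgauss) = (\<Sum>i. ennreal (pois ((cmod s)\<^sup>2) i) * (\<integral>\<^sup>+t. F t * ennreal (erlang_density i 1 t) \<partial>lborel))"
proof (cases "s = 0")
  case True
  then show ?thesis using shifted_cgauss_norm_real[OF F, of 0] by simp
next
  case False
  define u where "u = s / cmod s"
  have u: "cmod u = 1" "u \<noteq> 0" using False by (auto simp: u_def norm_divide)
  have s: "s = u * cmod s" using False by (simp add: u_def)
  have "cmod (u * z + s) = cmod (z + of_real (cmod s))" for z
  proof -
    have "u * z + s = u * (z + of_real (cmod s))" by (subst s) (simp add: algebra_simps)
    then show ?thesis by (simp only: norm_mult u mult_1)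
  qed
  moreover have "(\<integral>\<^sup>+z. F ((cmod (z + s))\<^sup>2) \<partial>cgauss) = (\<integral>\<^sup>+z. F ((cmod (u * z + s))\<^sup>2) \<partial>cgauss)"
  proof -
    have "(\<integral>\<^sup>+z. F ((cmod (u * z + s))\<^sup>2) \<partial>cgauss) = (\<integral>\<^sup>+z. ennreal (exp (- (cmod z)\<^sup>2) / pi) * F ((cmod (u * z + s))\<^sup>2) \<partial>lborel)"
      by (rule nn_integral_cgauss) measurable
    also have "\<dots> = (\<integral>\<^sup>+z. (\<lambda>z. ennreal (exp (- (cmod z)\<^sup>2) / pi) * F ((cmod (z + s))\<^sup>2)) (u * z) \<partial>lborel)"
      by (simp add: norm_mult u)
    also have "\<dots> = (\<integral>\<^sup>+z. ennreal (exp (- (cmod z)\<^sup>2) / pi) * F ((cmod (z + s))\<^sup>2) \<partial>lborel)"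
      using u by (subst nn_integral_complex_mult) simp_all
    also have "\<dots> = (\<integral>\<^sup>+z. F ((cmod (z + s))\<^sup>2) \<partial>cgauss)"
      by (rule nn_integral_cgauss[symmetric]) measurable
    finally show ?thesis by simp
  qed
  ultimately show ?thesis using shifted_cgauss_norm_real[OF F, of "cmod s"] by simp
qed

lemma suminf_pois_0: "(\<Sum>i. ennreal (pois 0 i) * X i) = X 0"
proof -
  have "(\<Sum>i. ennreal (pois 0 i) * X i) = (\<Sum>i\<in>{0}. ennreal (pois 0 i) * X i)"
    by (rule suminf_finite) (auto simp: pois_def)
  then show ?thesis by (simp add: pois_def)
qed

text \<open>The sum of two independent gamma variables. \<open>erlang_density k\<close> has shape
  \<open>k + 1\<close>, which accounts for the \<open>Suc\<close>.\<close>

lemma nn_integral_erlang_conv: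
  assumes F[measurable]: "F \<in> borel_measurable borel"
  shows "(\<integral>\<^sup>+u. (\<integral>\<^sup>+t. F (t + u) * ennreal (erlang_density a 1 t) \<partial>lborel) * ennreal (erlang_density b 1 u) \<partial>lborel)
    = (\<integral>\<^sup>+v. F v * ennreal (erlang_density (Suc (a + b)) 1 v) \<partial>lborel)"
proof -
  have "(\<integral>\<^sup>+u. (\<integral>\<^sup>+t. F (t + u) * ennreal (erlang_density a 1 t) \<partial>lborel) * ennreal (erlang_density b 1 u) \<partial>lborel)
     = (\<integral>\<^sup>+u. (\<integral>\<^sup>+v. F v * ennreal (erlang_density a 1 (v - u)) \<partial>lborel) * ennreal (erlang_density b 1 u) \<partial>lborel)"
  proof -
    have "(\<integral>\<^sup>+t. F (t + u) * ennreal (erlang_density a 1 t) \<partial>lborel) = (\<integral>\<^sup>+v. F v * ennreal (erlang_density a 1 (v - u)) \<partial>lborel)" for u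
      by (subst nn_integral_real_affine[where c=1 and t=u and f="\<lambda>v. F v * ennreal (erlang_density a 1 (v - u))"]) (simp_all add: add.commute)
    then show ?thesis by simp
  qed
  also have "\<dots> = (\<integral>\<^sup>+u. (\<integral>\<^sup>+v. F v * (ennreal (erlang_density a 1 (v - u)) * ennreal (erlang_density b 1 u)) \<partial>lborel) \<partial>lborel)"
    by (subst nn_integral_multc[symmetric]) (auto simp: mult.assoc)
  also have "\<dots> = (\<integral>\<^sup>+v. (\<integral>\<^sup>+u. F v * (ennreal (erlang_density a 1 (v - u)) * ennreal (erlang_density b 1 u)) \<partial>lborel) \<partial>lborel)"
    by (rule nn_integral_lborel_swap) simp
  also have "\<dots> = (\<integral>\<^sup>+v. F v * (\<integral>\<^sup>+u. (ennreal (erlang_density a 1 (v - u)) * ennreal (erlang_density b 1 u)) \<partial>lborel) \<partial>lborel)"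
    by (subst nn_integral_cmult) auto
  also have "\<dots> = (\<integral>\<^sup>+v. F v * ennreal (erlang_density (Suc (a + b)) 1 v) \<partial>lborel)"
    using convolution_erlang_density[of 1 a b] by (simp add: fun_eq_iff)
  finally show ?thesis .
qed

text \<open>The squared modulus of a standard complex Gaussian is exponential, that is, Erlang of
  index 0; this is the case of shift 0 in \<open>shifted_cgauss_norm\<close>.\<close>

lemma nn_integral_cgauss_add_erlang:
  assumes F[measurable]: "F \<in> borel_measurable borel"
  shows "(\<integral>\<^sup>+y. (\<integral>\<^sup>+t. F (t + (cmod y)\<^sup>2) * ennreal (erlang_density n 1 t) \<partial>lborel) \<partial>cgauss)
    = (\<integral>\<^sup>+t. F t * ennreal (erlang_density (Suc n) 1 t) \<partial>lborel)"
proof -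
  define H where "H u = (\<integral>\<^sup>+t. F (t + u) * ennreal (erlang_density n 1 t) \<partial>lborel)" for u
  have [measurable]: "H \<in> borel_measurable borel" unfolding H_def by simp
  have "(\<integral>\<^sup>+y. H ((cmod y)\<^sup>2) \<partial>cgauss) = (\<integral>\<^sup>+u. H u * ennreal (erlang_density 0 1 u) \<partial>lborel)"
    using shifted_cgauss_norm[of H 0] by (simp add: suminf_pois_0)
  also have "\<dots> = (\<integral>\<^sup>+t. F t * ennreal (erlang_density (Suc n) 1 t) \<partial>lborel)"
    unfolding H_def by (subst nn_integral_erlang_conv) simp_all
  finally show ?thesis unfolding H_def .
qed

text \<open>The whole shift sits in coordinate 0, whose squared modulus is a Poisson mixture. Every
  further coordinate is central and raises the Erlang index by one.\<close>

lemma gauss_vec_norm_aux: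
  assumes F: "F \<in> borel_measurable borel"
  shows "(\<integral>\<^sup>+z. F ((cmod (z 0 + s))\<^sup>2 + (\<Sum>i\<in>{1..n}. (cmod (z i))\<^sup>2)) \<partial>CG {..<Suc n})
    = (\<Sum>i. ennreal (pois ((cmod s)\<^sup>2) i) * (\<integral>\<^sup>+t. F t * ennreal (erlang_density (n + i) 1 t) \<partial>lborel))"
  using assms
proof (induction n arbitrary: F)
  case (0 F)
  note [measurable] = 0
  interpret prob_space "CG ({} :: nat set)" by (rule prob_space_CG)
  have "(\<integral>\<^sup>+z. F ((cmod (z 0 + s))\<^sup>2 + (\<Sum>i\<in>{1..0::nat}. (cmod (z i))\<^sup>2)) \<partial>CG {..<Suc 0})
     = (\<integral>\<^sup>+z. F ((cmod (z 0 + s))\<^sup>2) \<partial>CG (insert (0::nat) {}))" by (simp add: lessThan_Suc)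
  also have "\<dots> = (\<integral>\<^sup>+y. \<integral>\<^sup>+x. F ((cmod ((x(0 := y)) 0 + s))\<^sup>2) \<partial>CG ({} :: nat set) \<partial>cgauss)"
    by (rule nn_integral_CG_insert) auto
  also have "\<dots> = (\<integral>\<^sup>+y. F ((cmod (y + s))\<^sup>2) \<partial>cgauss)"
    by (simp add: emeasure_space_1)
  finally show ?case using shifted_cgauss_norm[OF 0] by simp
next
  case (Suc n F)
  note [measurable] = Suc.prems
  have [measurable]: "(\<lambda>z. z i) \<in> borel_measurable (CG {..<Suc m})" if "i \<le> m" for i m using that by simp
  have "(\<integral>\<^sup>+z. F ((cmod (z 0 + s))\<^sup>2 + (\<Sum>i\<in>{1..Suc n}. (cmod (z i))\<^sup>2)) \<partial>CG {..<Suc (Suc n)})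
    = (\<integral>\<^sup>+z. F ((cmod (z 0 + s))\<^sup>2 + (\<Sum>i\<in>{1..Suc n}. (cmod (z i))\<^sup>2)) \<partial>CG (insert (Suc n) {..<Suc n}))"
    by (simp add: lessThan_Suc)
  also have "\<dots> = (\<integral>\<^sup>+y. \<integral>\<^sup>+x. F ((cmod ((x(Suc n := y)) 0 + s))\<^sup>2 + (\<Sum>i\<in>{1..Suc n}. (cmod ((x(Suc n := y)) i))\<^sup>2)) \<partial>CG {..<Suc n} \<partial>cgauss)"
    by (rule nn_integral_CG_insert) (simp_all add: lessThan_Suc[symmetric] del: sum.cl_ivl_Suc)
  also have "\<dots> = (\<integral>\<^sup>+y. \<integral>\<^sup>+x. (\<lambda>t. F (t + (cmod y)\<^sup>2)) ((cmod (x 0 + s))\<^sup>2 + (\<Sum>i\<in>{1..n}. (cmod (x i))\<^sup>2)) \<partial>CG {..<Suc n} \<partial>cgauss)"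
    by (intro nn_integral_cong arg_cong[where f=F]) (simp add: add.assoc)
  also have "\<dots> = (\<integral>\<^sup>+y. (\<Sum>i. ennreal (pois ((cmod s)\<^sup>2) i) * (\<integral>\<^sup>+t. F (t + (cmod y)\<^sup>2) * ennreal (erlang_density (n + i) 1 t) \<partial>lborel)) \<partial>cgauss)"
    by (subst Suc.IH) simp_all
  also have "\<dots> = (\<Sum>i. \<integral>\<^sup>+y. ennreal (pois ((cmod s)\<^sup>2) i) * (\<integral>\<^sup>+t. F (t + (cmod y)\<^sup>2) * ennreal (erlang_density (n + i) 1 t) \<partial>lborel) \<partial>cgauss)"
    by (rule nn_integral_suminf) simp
  also have "\<dots> = (\<Sum>i. ennreal (pois ((cmod s)\<^sup>2) i) * (\<integral>\<^sup>+t. F t * ennreal (erlang_density (Suc n + i) 1 t) \<partial>lborel))"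
  proof (rule suminf_cong)
    fix i
    show "(\<integral>\<^sup>+y. ennreal (pois ((cmod s)\<^sup>2) i) * (\<integral>\<^sup>+t. F (t + (cmod y)\<^sup>2) * ennreal (erlang_density (n + i) 1 t) \<partial>lborel) \<partial>cgauss)
      = ennreal (pois ((cmod s)\<^sup>2) i) * (\<integral>\<^sup>+t. F t * ennreal (erlang_density (Suc n + i) 1 t) \<partial>lborel)"
      using nn_integral_cgauss_add_erlang[OF Suc.prems, of "n + i"] by (subst nn_integral_cmult) simp_all
  qed
  finally show ?case .
qed

text \<open>The noncentral chi-square law as a Poisson mixture. A rotation brings the mean
  \<open>\<alpha>\<close> to coordinate 0, so that only its length matters.\<close>

lemma gauss_vec_norm:
  assumes F[measurable]: "F \<in> borel_measurable borel"
  shows "(\<integral>\<^sup>+z. F (Re (ip {..<Suc n} (\<lambda>i. z i + \<alpha> i) (\<lambda>i. z i + \<alpha> i))) \<partial>CG {..<Suc n})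
    = (\<Sum>i. ennreal (pois (Re (ip {..<Suc n} \<alpha> \<alpha>)) i) * (\<integral>\<^sup>+t. F t * ennreal (erlang_density (n + i) 1 t) \<partial>lborel))"
proof -
  obtain T where T: "rot {..<Suc n} T" "\<forall>i\<in>{..<Suc n} - {0}. T \<alpha> i = 0"
    using rot_annihilate_exists[of "{..<Suc n}" 0 \<alpha>] by auto
  have split: "Re (ip {..<Suc n} v v) = (cmod (v 0))\<^sup>2 + (\<Sum>i\<in>{1..n}. (cmod (v i))\<^sup>2)" for v
  proof -
    have "{..<Suc n} = insert 0 {1..n}" by auto
    then show ?thesis by (simp add: Re_ip_self)
  qed
  have a: "Re (ip {..<Suc n} \<alpha> \<alpha>) = (cmod (T \<alpha> 0))\<^sup>2"
    using T(2) by (subst rot_ip[OF T(1), symmetric]) (simp_all add: split)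
  have "Re (ip {..<Suc n} (\<lambda>i. z i + \<alpha> i) (\<lambda>i. z i + \<alpha> i)) = (cmod (T z 0 + T \<alpha> 0))\<^sup>2 + (\<Sum>i\<in>{1..n}. (cmod (T z i))\<^sup>2)" for z
    using T(2) by (subst rot_ip[OF T(1), symmetric]) (simp_all add: split clin_simps(2)[OF rot_clin[OF T(1)]])
  then have "(\<integral>\<^sup>+z. F (Re (ip {..<Suc n} (\<lambda>i. z i + \<alpha> i) (\<lambda>i. z i + \<alpha> i))) \<partial>CG {..<Suc n})
    = (\<integral>\<^sup>+z. (\<lambda>w. F ((cmod (w 0 + T \<alpha> 0))\<^sup>2 + (\<Sum>i\<in>{1..n}. (cmod (w i))\<^sup>2))) (T z) \<partial>CG {..<Suc n})"
    by simp
  also have "\<dots> = (\<integral>\<^sup>+w. F ((cmod (w 0 + T \<alpha> 0))\<^sup>2 + (\<Sum>i\<in>{1..n}. (cmod (w i))\<^sup>2)) \<partial>distr (CG {..<Suc n}) (CG {..<Suc n}) T)"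
  proof -
    have [measurable]: "(\<lambda>w. w i) \<in> borel_measurable (CG {..<Suc n})" if "i \<le> n" for i using that by simp
    have "(\<lambda>w. F ((cmod (w 0 + T \<alpha> 0))\<^sup>2 + (\<Sum>i\<in>{1..n}. (cmod (w i))\<^sup>2))) \<in> borel_measurable (CG {..<Suc n})"
      by simp
    then show ?thesis by (subst nn_integral_distr[OF measurable_rot[OF T(1)]]) simp_all
  qed
  finally show ?thesis unfolding distr_rot[OF T(1) finite_lessThan] gauss_vec_norm_aux[OF F] a .
qed

subsection \<open>Residuals of Gaussian vectors\<close>

text \<open>The source of the rising factorials: multiplication by \<open>t ^ j\<close> raises the
  shape from \<open>b + 1\<close> to \<open>b + 1 + j\<close>, at the cost of a quotient of gamma
  values.\<close>

lemma erlang_mult_power: "t ^ j * erlang_density b 1 t = pochhammer (real (Suc b)) j * erlang_density (b + j) 1 t"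
proof -
  have "fact (b + j) = (fact b :: real) * pochhammer (real (Suc b)) j"
    using pochhammer_product'[of "1::real" b j] by (simp add: pochhammer_fact)
  then show ?thesis
    by (auto simp: erlang_density_def power_add field_simps)
qed

text \<open>A beta moment obtained from gamma densities alone: \<open>t ^ j\<close> is absorbed into
  the density of \<open>t\<close>, then \<open>x + t\<close> is a single gamma variable, and
  dividing by \<open>(x + t) ^ j\<close> lowers its shape again by \<open>j\<close>.\<close>

lemma beta_moment:
  assumes A: "A \<ge> 0"
  shows "(\<integral>\<^sup>+x. (\<integral>\<^sup>+t. (if x + t = 0 then 0 else ennreal ((A * t / (x + t)) ^ j)) * ennreal (erlang_density b 1 t) \<partial>lborel) * ennreal (erlang_density i 1 x) \<partial>lborel)
    = ennreal (A ^ j * pochhammer (real (Suc b)) j / pochhammer (real (Suc (Suc (b + i)))) j)"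
proof -
  \<comment> \<open>The Erlang index of \<open>x + t\<close> before \<open>t ^ j\<close> is
    absorbed; afterwards the index is \<open>c + j\<close>.\<close>
  define c where "c = Suc (b + i)"
  define F where "F v = ennreal (indicator {0<..} v / v ^ j)" for v :: real
  have [measurable]: "F \<in> borel_measurable borel" unfolding F_def by measurable
  have P: "pochhammer (real (Suc b)) j \<ge> 0" for b by (intro pochhammer_nonneg) auto
  have P0: "pochhammer (real (Suc b)) j > 0" for b by (intro pochhammer_pos) auto
  have "(\<integral>\<^sup>+x. (\<integral>\<^sup>+t. (if x + t = 0 then 0 else ennreal ((A * t / (x + t)) ^ j)) * ennreal (erlang_density b 1 t) \<partial>lborel) * ennreal (erlang_density i 1 x) \<partial>lborel)
    = (\<integral>\<^sup>+x. (\<integral>\<^sup>+t. ennreal (A ^ j * pochhammer (real (Suc b)) j) * (F (t + x) * ennreal (erlang_density (b + j) 1 t)) \<partial>lborel) * ennreal (erlang_density i 1 x) \<partial>lborel)"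
  proof (rule nn_integral_cong)
    fix x :: real
    show "(\<integral>\<^sup>+t. (if x + t = 0 then 0 else ennreal ((A * t / (x + t)) ^ j)) * ennreal (erlang_density b 1 t) \<partial>lborel) * ennreal (erlang_density i 1 x)
      = (\<integral>\<^sup>+t. ennreal (A ^ j * pochhammer (real (Suc b)) j) * (F (t + x) * ennreal (erlang_density (b + j) 1 t)) \<partial>lborel) * ennreal (erlang_density i 1 x)"
    proof (cases "x < 0")
      case True
      then show ?thesis by (simp add: erlang_density_def)
    next
      case False
      have "(if x + t = 0 then 0 else ennreal ((A * t / (x + t)) ^ j)) * ennreal (erlang_density b 1 t)
        = ennreal (A ^ j * pochhammer (real (Suc b)) j) * (F (t + x) * ennreal (erlang_density (b + j) 1 t))" for t
      proof (cases "t < 0 \<or> x + t = 0")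
        case True
        then show ?thesis by (auto simp: erlang_density_def F_def add.commute)
      next
        case t: False
        then have pos: "x + t > 0" using False by linarith
        have "((A * t / (x + t)) ^ j) * erlang_density b 1 t = A ^ j / (x + t) ^ j * (t ^ j * erlang_density b 1 t)"
          by (simp add: power_mult_distrib power_divide)
        also have "\<dots> = A ^ j * pochhammer (real (Suc b)) j * (1 / (x + t) ^ j * erlang_density (b + j) 1 t)"
          unfolding erlang_mult_power by simp
        finally have e: "((A * t / (x + t)) ^ j) * erlang_density b 1 t = A ^ j * pochhammer (real (Suc b)) j * (1 / (x + t) ^ j * erlang_density (b + j) 1 t)" .
        have "(if x + t = 0 then 0 else ennreal ((A * t / (x + t)) ^ j)) * ennreal (erlang_density b 1 t) = ennreal (((A * t / (x + t)) ^ j) * erlang_density b 1 t)"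
          using pos t A by (subst ennreal_mult) auto
        also have "\<dots> = ennreal (A ^ j * pochhammer (real (Suc b)) j) * (ennreal (1 / (x + t) ^ j) * ennreal (erlang_density (b + j) 1 t))"
          unfolding e using pos A P by (subst ennreal_mult, simp, simp, subst (2) ennreal_mult) auto
        also have "ennreal (1 / (x + t) ^ j) = F (t + x)" using pos by (simp add: F_def add.commute)
        finally show ?thesis .
      qed
      then show ?thesis by simp
    qed
  qed
  also have "\<dots> = (\<integral>\<^sup>+x. ennreal (A ^ j * pochhammer (real (Suc b)) j) * ((\<integral>\<^sup>+t. F (t + x) * ennreal (erlang_density (b + j) 1 t) \<partial>lborel) * ennreal (erlang_density i 1 x)) \<partial>lborel)"
    by (subst nn_integral_cmult) (auto simp: mult.assoc)
  also have "\<dots> = ennreal (A ^ j * pochhammer (real (Suc b)) j) * (\<integral>\<^sup>+v. F v * ennreal (erlang_density (Suc (b + j + i)) 1 v) \<partial>lborel)"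
    by (subst nn_integral_cmult) (simp_all add: nn_integral_erlang_conv)
  also have "(\<integral>\<^sup>+v. F v * ennreal (erlang_density (Suc (b + j + i)) 1 v) \<partial>lborel) = (\<integral>\<^sup>+v. ennreal (1 / pochhammer (real (Suc c)) j) * ennreal (erlang_density c 1 v) \<partial>lborel)"
  proof (rule nn_integral_cong_AE)
    have "AE v in lborel. v \<noteq> (0::real)" by (rule AE_lborel_singleton)
    then show "AE v in lborel. F v * ennreal (erlang_density (Suc (b + j + i)) 1 v) = ennreal (1 / pochhammer (real (Suc c)) j) * ennreal (erlang_density c 1 v)"
    proof eventually_elim
      case (elim v)
      show ?case
      proof (cases "v > 0")
        case True
        have cj: "Suc (b + j + i) = c + j" by (simp add: c_def)
        have "1 / v ^ j * erlang_density (c + j) 1 v = 1 / pochhammer (real (Suc c)) j * (1 / v ^ j * (v ^ j * erlang_density c 1 v))"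
          using P0[of c] unfolding erlang_mult_power by (simp add: field_simps)
        also have "\<dots> = 1 / pochhammer (real (Suc c)) j * erlang_density c 1 v" using True by simp
        finally have e: "1 / v ^ j * erlang_density (c + j) 1 v = 1 / pochhammer (real (Suc c)) j * erlang_density c 1 v" .
        have "F v * ennreal (erlang_density (Suc (b + j + i)) 1 v) = ennreal (1 / v ^ j * erlang_density (c + j) 1 v)"
          using True unfolding cj F_def by (subst ennreal_mult) auto
        also have "\<dots> = ennreal (1 / pochhammer (real (Suc c)) j) * ennreal (erlang_density c 1 v)"
          unfolding e using P[of c] by (subst ennreal_mult) auto
        finally show ?thesis .
      next
        case False
        then show ?thesis using elim by (simp add: F_def erlang_density_def)
      qed
    qed
  qed
  also have "\<dots> = ennreal (1 / pochhammer (real (Suc c)) j)"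
    by (subst nn_integral_cmult) (simp_all add: nn_integral_erlang_total)
  also have "ennreal (A ^ j * pochhammer (real (Suc b)) j) * ennreal (1 / pochhammer (real (Suc c)) j) = ennreal (A ^ j * pochhammer (real (Suc b)) j / pochhammer (real (Suc c)) j)"
    using A P[of b] P[of c] by (subst ennreal_mult[symmetric]) auto
  finally show ?thesis by (simp add: c_def)
qed

text \<open>With \<open>a\<close> rotated to the last axis, \<open>V w\<close> splits into a
  coordinate along \<open>a\<close>, shifted and of squared modulus \<open>X\<close>, and a central
  part of squared norm \<open>Y\<close> in the remaining \<open>Suc m\<close> coordinates. The part
  of \<open>a\<close> orthogonal to \<open>V w\<close> has squared norm
  \<open>A * Y / (X + Y)\<close>. Since \<open>X\<close> is a Poisson mixture of Erlang laws and
  \<open>Y\<close> is Erlang of index \<open>m\<close>, \<open>beta_moment\<close> applies to each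
  term.\<close>

lemma reject_moment:
  fixes a :: "nat \<Rightarrow> complex" and \<eta> :: complex and m j :: nat
  defines "V w \<equiv> (\<lambda>i. w i + \<eta> * a i)" and "A \<equiv> Re (ip {..<Suc (Suc m)} a a)"
  shows "(\<integral>\<^sup>+w. (if ip {..<Suc (Suc m)} (V w) (V w) = 0 then 0 else 
       ennreal (Re (ip {..<Suc (Suc m)} (reject (Suc (Suc m)) (V w) a) (reject (Suc (Suc m)) (V w) a)) ^ j)) \<partial>CG {..<Suc (Suc m)})
    = (\<Sum>i. ennreal (pois ((cmod \<eta>)\<^sup>2 * A) i) * ennreal (A ^ j * pochhammer (real (Suc m)) j / pochhammer (real (Suc (Suc (m + i)))) j))"
proof -
  let ?n = "Suc (Suc m)"
  let ?I = "{..<?n}"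
  obtain T where T: "rot ?I T" "\<forall>i\<in>?I - {Suc m}. T a i = 0"
    using rot_annihilate_exists[of ?I "Suc m" a] by auto
  have TV: "T (V w) i = T w i + \<eta> * T a i" for w i
    using clinD[OF rot_clin[OF T(1)], of \<eta> a w i] by (simp add: V_def add.commute)
  define s where "s = \<eta> * T a (Suc m)"
  define X where "X w = (cmod (w (Suc m) + s))\<^sup>2" for w
  define Y where "Y w = Re (ip {..<Suc m} w w)" for w
  have spl: "ip ?I x y = ip {..<Suc m} x y + x (Suc m) * cnj (y (Suc m))" for x y
    by (simp add: ip_def)
  have A: "A = (cmod (T a (Suc m)))\<^sup>2"
  proof -
    have "ip {..<Suc m} (T a) (T a) = 0" using T(2) by (auto simp: ip_def intro!: sum.neutral)
    then have "ip ?I a a = T a (Suc m) * cnj (T a (Suc m))"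
      unfolding rot_ip[OF T(1) finite_lessThan, symmetric, of a a] spl[of "T a"] by simp
    then show ?thesis by (simp add: A_def complex_norm_square[symmetric] del: of_real_power)
  qed
  have XY: "X w \<ge> 0" "Y w \<ge> 0" for w by (auto simp: X_def Y_def Re_ip_self_nonneg)
  have VV: "ip ?I (V w) (V w) = of_real (X (T w) + Y (T w))" for w
  proof -
    have "ip {..<Suc m} (T (V w)) (T (V w)) = ip {..<Suc m} (T w) (T w)"
      using T(2) by (intro ip_cong) (auto simp: TV)
    moreover have "ip {..<Suc m} (T w) (T w) = of_real (Y (T w))"
      by (simp add: Y_def ip_self)
    moreover have "T (V w) (Suc m) * cnj (T (V w) (Suc m)) = of_real (X (T w))"
      by (simp only: X_def TV s_def complex_norm_square)
    ultimately show ?thesis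
      by (subst rot_ip[OF T(1), symmetric]) (simp_all add: spl)
  qed
  have aV: "ip ?I a (V w) * ip ?I (V w) a = of_real (A * X (T w))" for w
  proof -
    have "ip {..<Suc m} (T a) (T (V w)) = 0" using T(2) by (auto simp: ip_def intro!: sum.neutral)
    then have e: "ip ?I a (V w) = T a (Suc m) * cnj (T w (Suc m) + s)"
      unfolding rot_ip[OF T(1) finite_lessThan, symmetric, of a "V w"] spl[of "T a"] by (simp add: TV s_def)
    then have "ip ?I (V w) a = cnj (T a (Suc m)) * (T w (Suc m) + s)"
      by (simp only: ip_commute[of ?I "V w" a] e complex_cnj_mult complex_cnj_cnj)
    then show ?thesis
      unfolding e A X_def of_real_mult complex_norm_square by (simp add: algebra_simps)
  qed
  have R: "Re (ip ?I (reject ?n (V w) a) (reject ?n (V w) a)) = A * Y (T w) / (X (T w) + Y (T w))"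
    if "X (T w) + Y (T w) \<noteq> 0" for w
  proof -
    have nz: "ip ?I (V w) (V w) \<noteq> 0" unfolding VV using that by (simp del: of_real_add)
    have "Re (ip ?I a a - of_real (A * X (T w)) / of_real (X (T w) + Y (T w))) = A - A * X (T w) / (X (T w) + Y (T w))"
      unfolding of_real_divide[symmetric] by (simp add: A_def del: of_real_divide of_real_add of_real_mult)
    then show ?thesis
      unfolding ip_reject(1)[OF nz] aV unfolding VV using that by (simp add: field_simps)
  qed
  \<comment> \<open>The value at \<open>x + y = 0\<close> is the one chosen for a vanishing
    \<open>V w\<close>, so that the two integrands agree everywhere.\<close>
  define H where "H x y = (if x + y = 0 then 0 else ennreal ((A * y / (x + y)) ^ j))" for x y :: real
  have [measurable]: "case_prod H \<in> borel_measurable (borel \<Otimes>\<^sub>M borel)"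
    unfolding H_def by measurable
  have [measurable]: "(\<lambda>w. w i) \<in> borel_measurable (CG ?I)" if "i < ?n" for i using that by simp
  have mX: "X \<in> borel_measurable (CG ?I)" unfolding X_def by simp
  have mY: "Y \<in> borel_measurable (CG ?I)" unfolding Y_def
  proof -
    have "(\<lambda>w. ip {..<Suc m} w w) \<in> borel_measurable (CG ?I)" by (rule measurable_ip) auto
    then show "(\<lambda>w. Re (ip {..<Suc m} w w)) \<in> borel_measurable (CG ?I)" by simp
  qed
  have mH: "(\<lambda>w. H (X w) (Y w)) \<in> borel_measurable (CG ?I)"
    using mX mY by measurable
  have "(\<integral>\<^sup>+w. (if ip ?I (V w) (V w) = 0 then 0 else 
       ennreal (Re (ip ?I (reject ?n (V w) a) (reject ?n (V w) a)) ^ j)) \<partial>CG ?I) = (\<integral>\<^sup>+w. H (X (T w)) (Y (T w)) \<partial>CG ?I)"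
  proof (rule nn_integral_cong)
    fix w
    show "(if ip ?I (V w) (V w) = 0 then 0 else 
       ennreal (Re (ip ?I (reject ?n (V w) a) (reject ?n (V w) a)) ^ j)) = H (X (T w)) (Y (T w))"
      using R[of w] unfolding VV H_def by (simp del: of_real_add)
  qed
  also have "\<dots> = (\<integral>\<^sup>+w. H (X w) (Y w) \<partial>distr (CG ?I) (CG ?I) T)"
    using mH by (subst nn_integral_distr[OF measurable_rot[OF T(1)]]) simp_all
  also have "\<dots> = (\<integral>\<^sup>+w. H (X w) (Y w) \<partial>CG (insert (Suc m) {..<Suc m}))"
    unfolding distr_rot[OF T(1) finite_lessThan] by (simp add: lessThan_Suc)
  also have "\<dots> = (\<integral>\<^sup>+y. \<integral>\<^sup>+x. H (X (x(Suc m := y))) (Y (x(Suc m := y))) \<partial>CG {..<Suc m} \<partial>cgauss)"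
    using mH by (intro nn_integral_CG_insert) (simp_all add: lessThan_Suc)
  also have "\<dots> = (\<integral>\<^sup>+y. \<integral>\<^sup>+x. H ((cmod (y + s))\<^sup>2) (Re (ip {..<Suc m} (\<lambda>i. x i + 0) (\<lambda>i. x i + 0))) \<partial>CG {..<Suc m} \<partial>cgauss)"
  proof -
    have "Y (x(Suc m := y)) = Re (ip {..<Suc m} (\<lambda>i. x i + 0) (\<lambda>i. x i + 0))" for x y
      unfolding Y_def by (intro arg_cong[where f=Re] ip_cong) auto
    then show ?thesis by (simp add: X_def)
  qed
  also have "\<dots> = (\<integral>\<^sup>+y. \<integral>\<^sup>+t. H ((cmod (y + s))\<^sup>2) t * ennreal (erlang_density m 1 t) \<partial>lborel \<partial>cgauss)"
  proof (rule nn_integral_cong)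
    fix y :: complex
    have "(\<integral>\<^sup>+x. H ((cmod (y + s))\<^sup>2) (Re (ip {..<Suc m} (\<lambda>i. x i + 0) (\<lambda>i. x i + 0))) \<partial>CG {..<Suc m})
      = (\<Sum>i. ennreal (pois (Re (ip {..<Suc m} (\<lambda>_. 0) (\<lambda>_. 0))) i) * (\<integral>\<^sup>+t. H ((cmod (y + s))\<^sup>2) t * ennreal (erlang_density (m + i) 1 t) \<partial>lborel))"
      by (rule gauss_vec_norm) measurable
    also have "Re (ip {..<Suc m} (\<lambda>_. 0) (\<lambda>_. 0)) = 0" by (simp add: ip_def)
    finally show "(\<integral>\<^sup>+x. H ((cmod (y + s))\<^sup>2) (Re (ip {..<Suc m} (\<lambda>i. x i + 0) (\<lambda>i. x i + 0))) \<partial>CG {..<Suc m})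
      = (\<integral>\<^sup>+t. H ((cmod (y + s))\<^sup>2) t * ennreal (erlang_density m 1 t) \<partial>lborel)"
      by (simp add: suminf_pois_0)
  qed
  also have "\<dots> = (\<Sum>i. ennreal (pois ((cmod s)\<^sup>2) i) * 
      (\<integral>\<^sup>+x. (\<integral>\<^sup>+t. H x t * ennreal (erlang_density m 1 t) \<partial>lborel) * ennreal (erlang_density i 1 x) \<partial>lborel))"
    by (rule shifted_cgauss_norm) measurable
  also have "\<dots> = (\<Sum>i. ennreal (pois ((cmod s)\<^sup>2) i) * ennreal (A ^ j * pochhammer (real (Suc m)) j / pochhammer (real (Suc (Suc (m + i)))) j))"
    unfolding H_def by (subst beta_moment) (simp_all add: A)
  also have "(cmod s)\<^sup>2 = (cmod \<eta>)\<^sup>2 * A" by (simp add: s_def A norm_mult power_mult_distrib)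
  finally show ?thesis .
qed

lemma measurable_residual_add:
  "(\<lambda>z. residual n gs (\<lambda>i. z i + \<alpha> i)) \<in> borel_measurable (CG {..<n})"
proof -
  have "(\<lambda>z. residual n (map (\<lambda>g. g z) (map (\<lambda>g z. g) gs)) (\<lambda>i. z i + \<alpha> i)) \<in> borel_measurable (CG {..<n})"
    by (rule conjunct1[OF measurable_residual]) auto
  then show ?thesis by (simp add: comp_def)
qed

text \<open>Each member of \<open>gs\<close> costs one complex dimension: its coisometry maps the
  Gaussian vector to a Gaussian vector and carries the mean along. When \<open>gs\<close> is used
  up, dimension \<open>Suc m\<close> is left and \<open>gauss_vec_norm\<close> applies.\<close>

lemma gauss_residual_law:
  assumes "nondeg n gs" "n = length gs + Suc m" and F[measurable]: "F \<in> borel_measurable borel"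
  shows "(\<integral>\<^sup>+z. F (residual n gs (\<lambda>i. z i + \<alpha> i)) \<partial>CG {..<n})
    = (\<Sum>i. ennreal (pois (residual n gs \<alpha>) i) * (\<integral>\<^sup>+t. F t * ennreal (erlang_density (m + i) 1 t) \<partial>lborel))"
  using assms(1,2)
proof (induction "length gs" arbitrary: gs n \<alpha>)
  case 0
  then show ?case using gauss_vec_norm[OF F, of m \<alpha>] by simp
next
  case (Suc l)
  then obtain g hs where gs: "gs = g # hs" by (cases gs) auto
  define n' where "n' = l + Suc m"
  have n: "n = Suc n'" using Suc by (simp add: n'_def)
  have g: "ip {..<Suc n'} g g \<noteq> 0" using Suc gs n by simp
  obtain P where P: "clin P" "\<forall>i<n'. P g i = 0" 
     "\<And>x y. ip {..<n'} (P x) (P y) = ip {..<Suc n'} x y - ip {..<Suc n'} x g * ip {..<Suc n'} g y / ip {..<Suc n'} g g"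
     "(\<lambda>x. restrict (P x) {..<n'}) \<in> measurable (CG {..<Suc n'}) (CG {..<n'})"
     "distr (CG {..<Suc n'}) (CG {..<n'}) (\<lambda>x. restrict (P x) {..<n'}) = CG {..<n'}"
    using coisometry_exists[OF g] by blast
  note D = residual_coisometry[where m=n', OF P(1) g P(3)]
  have r: "residual n gs v = residual n' (map P hs) (P v)" for v
    unfolding gs n by (rule D) (use P(2) in auto)
  have nd: "nondeg n' (map P hs)"
    using Suc.prems(1) D(2)[of hs] P(2) unfolding gs n by auto
  have e: "residual n gs (\<lambda>i. z i + \<alpha> i) = residual n' (map P hs) (\<lambda>i. restrict (P z) {..<n'} i + P \<alpha> i)" for z
    unfolding r by (rule conjunct1[OF residual_cong]) (auto simp: clin_simps(2)[OF P(1)])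
  have m: "(\<lambda>w. F (residual n' (map P hs) (\<lambda>i. w i + P \<alpha> i))) \<in> borel_measurable (CG {..<n'})"
    using measurable_residual_add F by measurable
  have "(\<integral>\<^sup>+z. F (residual n gs (\<lambda>i. z i + \<alpha> i)) \<partial>CG {..<n}) = 
     (\<integral>\<^sup>+w. F (residual n' (map P hs) (\<lambda>i. w i + P \<alpha> i)) \<partial>distr (CG {..<Suc n'}) (CG {..<n'}) (\<lambda>x. restrict (P x) {..<n'}))"
    using m by (subst nn_integral_distr[OF P(4)]) (simp, simp only: e, simp only: n)
  also have "\<dots> = (\<Sum>i. ennreal (pois (residual n' (map P hs) (P \<alpha>)) i) * (\<integral>\<^sup>+t. F t * ennreal (erlang_density (m + i) 1 t) \<partial>lborel))"
    unfolding P(5) by (rule Suc.hyps(1)) (use nd Suc gs in \<open>auto simp: n'_def\<close>)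
  finally show ?case unfolding r .
qed

section \<open>Arrays of independent Gaussian columns\<close>

abbreviation CM :: "nat \<Rightarrow> nat \<Rightarrow> (nat \<Rightarrow> nat \<Rightarrow> complex) measure" where
  "CM n k \<equiv> PiM {..<k} (\<lambda>_. CG {..<n})"

lemma prob_space_CM: "prob_space (CM n k)"
  by (intro prob_space_PiM prob_space_CG)

lemma product_sigma_finite_CG: "product_sigma_finite (\<lambda>_::nat. CG {..<n})"
  by (simp add: product_sigma_finite_def prob_space_CG prob_space_imp_sigma_finite)

text \<open>The highest index comes first: a new column enters at the head, where
  \<open>residual\<close> starts, while \<open>CM n (Suc k)\<close> adds it as the last factor of
  the product.\<close>

definition col_list :: "nat \<Rightarrow> (nat \<Rightarrow> 'v) \<Rightarrow> 'v list" where
  "col_list k ws = map ws (rev [0..<k])"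

lemma length_col_list[simp]: "length (col_list k ws) = k"
  by (simp add: col_list_def)

lemma col_list_0[simp]: "col_list 0 ws = []"
  by (simp add: col_list_def)

lemma col_list_Suc: "col_list (Suc k) ws = ws k # col_list k ws"
  by (simp add: col_list_def)

lemma col_list_upd[simp]: "col_list k (ws(k := v)) = col_list k ws"
  by (simp add: col_list_def)

lemma nth_col_list: "i < k \<Longrightarrow> col_list k ws ! i = ws (k - Suc i)"
  by (simp add: col_list_def rev_nth)

lemma measurable_CM_component: "j < k \<Longrightarrow> i < n \<Longrightarrow> (\<lambda>ws. ws j i) \<in> borel_measurable (CM n k)"
  using measurable_compose[OF measurable_component_singleton[of j "{..<k}" "\<lambda>_. CG {..<n}"]
      measurable_CG_component[of i "{..<n}"]] by simp

lemma measurable_residual_col_list: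
  assumes "k \<le> l" "\<And>i. i < n \<Longrightarrow> (\<lambda>ws. g ws i) \<in> borel_measurable (CM n l)"
    "\<And>i. i < n \<Longrightarrow> (\<lambda>ws. v ws i) \<in> borel_measurable (CM n l)"
  shows "(\<lambda>ws. residual n (g ws # col_list k ws) (v ws)) \<in> borel_measurable (CM n l)"
    "Measurable.pred (CM n l) (\<lambda>ws. nondeg n (g ws # col_list k ws))"
    "(\<lambda>ws. residual n (col_list k ws) (v ws)) \<in> borel_measurable (CM n l)"
    "Measurable.pred (CM n l) (\<lambda>ws. nondeg n (col_list k ws))"
proof -
  let ?gs = "map (\<lambda>j ws. ws j) (rev [0..<k])"
  have 1: "(\<lambda>w. h w i) \<in> borel_measurable (CM n l)" if "h \<in> set ?gs" "i < n" for h i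
    using that assms(1) by (auto intro!: measurable_CM_component)
  have 2: "map (\<lambda>h. h w) ?gs = col_list k w" for w by (simp add: col_list_def)
  have 3: "(\<lambda>w. h w i) \<in> borel_measurable (CM n l)" if "h \<in> set (g # ?gs)" "i < n" for h i
    using that(1) 1[OF _ that(2)] assms(2)[OF that(2)] by (auto simp del: set_map set_rev)
  have 4: "(\<lambda>w. residual n (map (\<lambda>h. h w) (g # ?gs)) (v w)) \<in> borel_measurable (CM n l) \<and>
      Measurable.pred (CM n l) (\<lambda>w. nondeg n (map (\<lambda>h. h w) (g # ?gs)))"
    by (rule measurable_residual) (rule assms(3) 3, assumption+)+
  have 5: "(\<lambda>w. residual n (map (\<lambda>h. h w) ?gs) (v w)) \<in> borel_measurable (CM n l) \<and>
      Measurable.pred (CM n l) (\<lambda>w. nondeg n (map (\<lambda>h. h w) ?gs))"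
    by (rule measurable_residual) (rule assms(3) 1, assumption+)+
  show "(\<lambda>ws. residual n (g ws # col_list k ws) (v ws)) \<in> borel_measurable (CM n l)"
    "Measurable.pred (CM n l) (\<lambda>ws. nondeg n (g ws # col_list k ws))"
    using 4 unfolding list.map(2)[of _ g ?gs] 2 by (rule conjunct1, rule conjunct2)
  show "(\<lambda>ws. residual n (col_list k ws) (v ws)) \<in> borel_measurable (CM n l)"
    "Measurable.pred (CM n l) (\<lambda>ws. nondeg n (col_list k ws))"
    using 5 unfolding 2 by (rule conjunct1, rule conjunct2)
qed

text \<open>Fubini with the newest column outermost, as peeling it off requires.
  \<open>nn_integral_CM_insert\<close> has it innermost, for laws conditional on the other
  columns.\<close>

lemma nn_integral_CM_insert_rev:
  assumes "f \<in> borel_measurable (CM n (Suc k))"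
  shows "(\<integral>\<^sup>+x. f x \<partial>CM n (Suc k)) = (\<integral>\<^sup>+y. \<integral>\<^sup>+x. f (x(k := y)) \<partial>CM n k \<partial>CG {..<n})"
  using product_sigma_finite.product_nn_integral_insert_rev[OF product_sigma_finite_CG, of "{..<k}" k f n] assms
  by (simp add: lessThan_Suc)

lemma nn_integral_CM_insert:
  assumes "f \<in> borel_measurable (CM n (Suc k))"
  shows "(\<integral>\<^sup>+x. f x \<partial>CM n (Suc k)) = (\<integral>\<^sup>+x. \<integral>\<^sup>+y. f (x(k := y)) \<partial>CG {..<n} \<partial>CM n k)"
  using product_sigma_finite.product_nn_integral_insert[OF product_sigma_finite_CG, of "{..<k}" k f n] assms
  by (simp add: lessThan_Suc)

text \<open>Condition on the head column. Its coisometry sends the other columns to independent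
  Gaussian columns of dimension \<open>n\<close>. As the assumed moment depends on \<open>a\<close>
  through its squared norm only, what remains is a moment of the squared norm of the rejected
  \<open>a\<close>.\<close>

lemma nn_integral_residual_peel:
  assumes IH: "\<And>a. (\<integral>\<^sup>+ws. (if nondeg n (col_list k ws) then ennreal (residual n (col_list k ws) a ^ j) else 0) \<partial>CM n k)
      = ennreal (Re (ip {..<n} a a) ^ j) * c"
  shows "(\<integral>\<^sup>+ws. (if nondeg (Suc n) ((\<lambda>i. ws k i + \<beta> i) # col_list k ws) then ennreal (residual (Suc n) ((\<lambda>i. ws k i + \<beta> i) # col_list k ws) a ^ j) else 0) \<partial>CM (Suc n) (Suc k))
    = (\<integral>\<^sup>+w. (if ip {..<Suc n} (\<lambda>i. w i + \<beta> i) (\<lambda>i. w i + \<beta> i) = 0 then 0 else 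
       ennreal (Re (ip {..<Suc n} (reject (Suc n) (\<lambda>i. w i + \<beta> i) a) (reject (Suc n) (\<lambda>i. w i + \<beta> i) a)) ^ j)) \<partial>CG {..<Suc n}) * c"
proof -
  have m: "(\<lambda>ws. (if nondeg (Suc n) ((\<lambda>i. ws k i + \<beta> i) # col_list k ws) then ennreal (residual (Suc n) ((\<lambda>i. ws k i + \<beta> i) # col_list k ws) a ^ j) else 0))
     \<in> borel_measurable (CM (Suc n) (Suc k))"
  proof -
    have s: "(\<lambda>ws. ws k i + \<beta> i) \<in> borel_measurable (CM (Suc n) (Suc k))" if "i < Suc n" for i
      using that by (intro borel_measurable_add measurable_CM_component) auto
    have [measurable]: "(\<lambda>ws. residual (Suc n) ((\<lambda>i. ws k i + \<beta> i) # col_list k ws) a) \<in> borel_measurable (CM (Suc n) (Suc k))"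
      "Measurable.pred (CM (Suc n) (Suc k)) (\<lambda>ws. nondeg (Suc n) ((\<lambda>i. ws k i + \<beta> i) # col_list k ws))"
      by (rule measurable_residual_col_list[where v="\<lambda>_. a"]; use s in simp)+
    show ?thesis by measurable
  qed
  have m': "(\<lambda>ws. (if nondeg n (col_list k ws) then ennreal (residual n (col_list k ws) a ^ j) else 0)) \<in> borel_measurable (CM n k)" for a
  proof -
    have [measurable]: "(\<lambda>ws. residual n (col_list k ws) a) \<in> borel_measurable (CM n k)"
      "Measurable.pred (CM n k) (\<lambda>ws. nondeg n (col_list k ws))"
      by (rule measurable_residual_col_list[where v="\<lambda>_. a" and g="\<lambda>_. a"]; simp)+
    show ?thesis by measurable
  qed
  have "(\<integral>\<^sup>+ws. (if nondeg (Suc n) (g # col_list k ws) then ennreal (residual (Suc n) (g # col_list k ws) a ^ j) else 0) \<partial>CM (Suc n) k)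
     = (if ip {..<Suc n} g g = 0 then 0 else ennreal (Re (ip {..<Suc n} (reject (Suc n) g a) (reject (Suc n) g a)) ^ j)) * c" for g
  proof (cases "ip {..<Suc n} g g = 0")
    case True
    then show ?thesis by simp
  next
    case g: False
    obtain P where P: "clin P" "\<forall>i<n. P g i = 0" 
       "\<And>x y. ip {..<n} (P x) (P y) = ip {..<Suc n} x y - ip {..<Suc n} x g * ip {..<Suc n} g y / ip {..<Suc n} g g"
       "(\<lambda>x. restrict (P x) {..<n}) \<in> measurable (CG {..<Suc n}) (CG {..<n})"
       "distr (CG {..<Suc n}) (CG {..<n}) (\<lambda>x. restrict (P x) {..<n}) = CG {..<n}"
      using coisometry_exists[OF g] by blast
    let ?f = "\<lambda>x. restrict (P x) {..<n}"
    note D = residual_coisometry[where m=n, OF P(1) g P(3)]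
    have c: "residual n (map P (col_list k ws)) (P a) = residual n (col_list k (compose {..<k} ?f ws)) (P a) \<and>
       nondeg n (map P (col_list k ws)) = nondeg n (col_list k (compose {..<k} ?f ws))" for ws
      by (rule residual_cong) (auto simp: nth_col_list compose_def)
    have dist: "distr (CM (Suc n) k) (CM n k) (compose {..<k} ?f) = CM n k"
      using distr_PiM_finite_prob_space'[of "{..<k}" "\<lambda>_. CG {..<Suc n}" "\<lambda>_. CG {..<n}" ?f] P(4)
      by (simp add: prob_space_CG P(5))
    have mc: "compose {..<k} ?f \<in> measurable (CM (Suc n) k) (CM n k)"
      unfolding compose_def by (intro measurable_restrict measurable_compose[OF measurable_component_singleton[of _ "{..<k}" "\<lambda>_. CG {..<Suc n}"] P(4)]) auto
    have "(\<integral>\<^sup>+ws. (if nondeg (Suc n) (g # col_list k ws) then ennreal (residual (Suc n) (g # col_list k ws) a ^ j) else 0) \<partial>CM (Suc n) k)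
      = (\<integral>\<^sup>+ws. (\<lambda>ws. if nondeg n (col_list k ws) then ennreal (residual n (col_list k ws) (P a) ^ j) else 0) (compose {..<k} ?f ws) \<partial>CM (Suc n) k)"
    proof -
      have "residual (Suc n) (g # col_list k ws) a = residual n (map P (col_list k ws)) (P a)"
        "nondeg (Suc n) (g # col_list k ws) = nondeg n (map P (col_list k ws))" for ws
        using D P(2) by blast+
      then show ?thesis using c by (simp only:)
    qed
    also have "\<dots> = (\<integral>\<^sup>+ws. (if nondeg n (col_list k ws) then ennreal (residual n (col_list k ws) (P a) ^ j) else 0) \<partial>distr (CM (Suc n) k) (CM n k) (compose {..<k} ?f))"
      using m' by (subst nn_integral_distr[OF mc]) simp_all
    also have "\<dots> = ennreal (Re (ip {..<n} (P a) (P a)) ^ j) * c"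
      unfolding dist by (rule IH)
    also have "ip {..<n} (P a) (P a) = ip {..<Suc n} (reject (Suc n) g a) (reject (Suc n) g a)"
      unfolding P(3) ip_reject(1)[OF g] ..
    finally show ?thesis using g by simp
  qed
  then have "(\<integral>\<^sup>+ws. (if nondeg (Suc n) ((\<lambda>i. ws k i + \<beta> i) # col_list k ws) then ennreal (residual (Suc n) ((\<lambda>i. ws k i + \<beta> i) # col_list k ws) a ^ j) else 0) \<partial>CM (Suc n) (Suc k))
    = (\<integral>\<^sup>+w. (if ip {..<Suc n} (\<lambda>i. w i + \<beta> i) (\<lambda>i. w i + \<beta> i) = 0 then 0 else 
       ennreal (Re (ip {..<Suc n} (reject (Suc n) (\<lambda>i. w i + \<beta> i) a) (reject (Suc n) (\<lambda>i. w i + \<beta> i) a)) ^ j)) * c \<partial>CG {..<Suc n})"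
    by (subst nn_integral_CM_insert_rev[OF m]) (simp only: fun_upd_same col_list_upd)
  also have "\<dots> = (\<integral>\<^sup>+w. (if ip {..<Suc n} (\<lambda>i. w i + \<beta> i) (\<lambda>i. w i + \<beta> i) = 0 then 0 else 
       ennreal (Re (ip {..<Suc n} (reject (Suc n) (\<lambda>i. w i + \<beta> i) a) (reject (Suc n) (\<lambda>i. w i + \<beta> i) a)) ^ j)) \<partial>CG {..<Suc n}) * c"
  proof (rule nn_integral_multc)
    have v: "(\<lambda>w. w i + \<beta> i) \<in> borel_measurable (CG {..<Suc n})" if "i < Suc n" for i
      using that by (intro borel_measurable_add measurable_CG_component) auto
    have [measurable]: "(\<lambda>w. ip {..<Suc n} (\<lambda>i. w i + \<beta> i) (\<lambda>i. w i + \<beta> i)) \<in> borel_measurable (CG {..<Suc n})"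
      by (rule measurable_ip) (use v in auto)
    have "(\<lambda>w. residual (Suc n) (map (\<lambda>g. g w) [\<lambda>w i. w i + \<beta> i]) a) \<in> borel_measurable (CG {..<Suc n})"
      by (rule conjunct1[OF measurable_residual]) (use v in auto)
    then have [measurable]: "(\<lambda>w. Re (ip {..<Suc n} (reject (Suc n) (\<lambda>i. w i + \<beta> i) a) (reject (Suc n) (\<lambda>i. w i + \<beta> i) a))) \<in> borel_measurable (CG {..<Suc n})"
      by simp
    show "(\<lambda>w. (if ip {..<Suc n} (\<lambda>i. w i + \<beta> i) (\<lambda>i. w i + \<beta> i) = 0 then 0 else 
       ennreal (Re (ip {..<Suc n} (reject (Suc n) (\<lambda>i. w i + \<beta> i) a) (reject (Suc n) (\<lambda>i. w i + \<beta> i) a)) ^ j))) \<in> borel_measurable (CG {..<Suc n})"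
      by measurable
  qed
  finally show ?thesis .
qed

text \<open>One step is \<open>reject_moment\<close> with shift 0, where the Poisson sum has a
  single term. It contributes \<open>(n - 1)_j / (n)_j\<close>, and these factors telescope.\<close>

lemma central_residual_moment:
  assumes "k < n"
  shows "(\<integral>\<^sup>+ws. (if nondeg n (col_list k ws) then ennreal (residual n (col_list k ws) a ^ j) else 0) \<partial>CM n k)
      = ennreal (Re (ip {..<n} a a) ^ j) * ennreal (pochhammer (real (n - k)) j / pochhammer (real n) j)"
  using assms
proof (induction k arbitrary: n a)
  case 0
  have "emeasure (CM n 0) (space (CM n 0)) = 1" by (rule prob_space.emeasure_space_1[OF prob_space_CM])
  then have e: "emeasure (Pi\<^sub>M {} (\<lambda>_::nat. CG {..<n})) (space (Pi\<^sub>M {} (\<lambda>_::nat. CG {..<n}))) = 1"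
    by (simp only: lessThan_0)
  have "pochhammer (real n) j > 0" using 0 by (intro pochhammer_pos) auto
  then show ?case by (simp add: e)
next
  case (Suc k n a)
  define m where "m = n - 2"
  have n: "n = Suc (Suc m)" using Suc.prems by (simp add: m_def)
  have km: "k < Suc m" using Suc.prems n by simp
  have P0: "pochhammer (real (Suc b)) j > 0" for b by (intro pochhammer_pos) auto
  have P1: "pochhammer (real b) j \<ge> 0" if "b > 0" for b using that by (intro pochhammer_nonneg) auto
  have "(\<integral>\<^sup>+ws. (if nondeg n (col_list (Suc k) ws) then ennreal (residual n (col_list (Suc k) ws) a ^ j) else 0) \<partial>CM n (Suc k))
    = (\<integral>\<^sup>+ws. (if nondeg n ((\<lambda>i. ws k i + 0) # col_list k ws) then ennreal (residual n ((\<lambda>i. ws k i + 0) # col_list k ws) a ^ j) else 0) \<partial>CM n (Suc k))"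
    by (simp only: col_list_Suc add_0_right)
  also have "\<dots> = (\<integral>\<^sup>+w. (if ip {..<n} (\<lambda>i. w i + 0 * a i) (\<lambda>i. w i + 0 * a i) = 0 then 0 else 
       ennreal (Re (ip {..<n} (reject n (\<lambda>i. w i + 0 * a i) a) (reject n (\<lambda>i. w i + 0 * a i) a)) ^ j)) \<partial>CG {..<n}) 
       * ennreal (pochhammer (real (Suc m - k)) j / pochhammer (real (Suc m)) j)"
    unfolding n using nn_integral_residual_peel[where n="Suc m" and \<beta>="\<lambda>_. 0", OF Suc.IH[OF km]] by (simp only: mult_zero_left)
  also have "(\<integral>\<^sup>+w. (if ip {..<n} (\<lambda>i. w i + 0 * a i) (\<lambda>i. w i + 0 * a i) = 0 then 0 else 
       ennreal (Re (ip {..<n} (reject n (\<lambda>i. w i + 0 * a i) a) (reject n (\<lambda>i. w i + 0 * a i) a)) ^ j)) \<partial>CG {..<n})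
    = ennreal (Re (ip {..<n} a a) ^ j * pochhammer (real (Suc m)) j / pochhammer (real n) j)"
    unfolding n reject_moment by (simp add: suminf_pois_0)
  also have "\<dots> * ennreal (pochhammer (real (Suc m - k)) j / pochhammer (real (Suc m)) j)
    = ennreal (Re (ip {..<n} a a) ^ j) * ennreal (pochhammer (real (n - Suc k)) j / pochhammer (real n) j)"
    using P0[of m] P1[of n] P1[of "Suc m - k"] Re_ip_self_nonneg[of "{..<n}" a] km
    by (simp add: ennreal_mult[symmetric] n)
  finally show ?case .
qed

text \<open>The column with a mean is peeled first; the mean is parallel to \<open>a\<close>, as
  \<open>reject_moment\<close> requires. The columns left over are central, and the denominator
  \<open>(n - 1)_j\<close> of their moment cancels.\<close>

lemma shifted_residual_moment:
  assumes "Suc k < n"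
  shows "(\<integral>\<^sup>+ws. (if nondeg n ((\<lambda>i. ws k i + \<eta> * a i) # col_list k ws) then ennreal (residual n ((\<lambda>i. ws k i + \<eta> * a i) # col_list k ws) a ^ j) else 0) \<partial>CM n (Suc k))
    = (\<Sum>i. ennreal (pois ((cmod \<eta>)\<^sup>2 * Re (ip {..<n} a a)) i) * ennreal (Re (ip {..<n} a a) ^ j * pochhammer (real (n - Suc k)) j / pochhammer (real (n + i)) j))"
proof -
  define m where "m = n - 2"
  have n: "n = Suc (Suc m)" using assms by (simp add: m_def)
  have km: "k < Suc m" using assms n by simp
  have P0: "pochhammer (real (Suc b)) j > 0" for b by (intro pochhammer_pos) auto
  have P1: "pochhammer (real b) j \<ge> 0" if "b > 0" for b using that by (intro pochhammer_nonneg) auto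
  have "(\<integral>\<^sup>+ws. (if nondeg n ((\<lambda>i. ws k i + \<eta> * a i) # col_list k ws) then ennreal (residual n ((\<lambda>i. ws k i + \<eta> * a i) # col_list k ws) a ^ j) else 0) \<partial>CM n (Suc k))
   = (\<integral>\<^sup>+w. (if ip {..<n} (\<lambda>i. w i + \<eta> * a i) (\<lambda>i. w i + \<eta> * a i) = 0 then 0 else 
       ennreal (Re (ip {..<n} (reject n (\<lambda>i. w i + \<eta> * a i) a) (reject n (\<lambda>i. w i + \<eta> * a i) a)) ^ j)) \<partial>CG {..<n}) 
       * ennreal (pochhammer (real (Suc m - k)) j / pochhammer (real (Suc m)) j)"
    unfolding n by (rule nn_integral_residual_peel[where n="Suc m", OF central_residual_moment[OF km]])
  also have "\<dots> = (\<Sum>i. ennreal (pois ((cmod \<eta>)\<^sup>2 * Re (ip {..<n} a a)) i) * ennreal (Re (ip {..<n} a a) ^ j * pochhammer (real (Suc m)) j / pochhammer (real (n + i)) j)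
       * ennreal (pochhammer (real (Suc m - k)) j / pochhammer (real (Suc m)) j))"
    unfolding n reject_moment by simp
  also have "\<dots> = (\<Sum>i. ennreal (pois ((cmod \<eta>)\<^sup>2 * Re (ip {..<n} a a)) i) * ennreal (Re (ip {..<n} a a) ^ j * pochhammer (real (n - Suc k)) j / pochhammer (real (n + i)) j))"
  proof (rule suminf_cong)
    fix i
    have "ennreal (Re (ip {..<n} a a) ^ j * pochhammer (real (Suc m)) j / pochhammer (real (n + i)) j) * ennreal (pochhammer (real (Suc m - k)) j / pochhammer (real (Suc m)) j)
      = ennreal (Re (ip {..<n} a a) ^ j * pochhammer (real (n - Suc k)) j / pochhammer (real (n + i)) j)"
      using P0[of m] P1[of "n + i"] P1[of "Suc m - k"] Re_ip_self_nonneg[of "{..<n}" a] km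
      by (subst ennreal_mult[symmetric]) (auto simp: n)
    then show "ennreal (pois ((cmod \<eta>)\<^sup>2 * Re (ip {..<n} a a)) i) * ennreal (Re (ip {..<n} a a) ^ j * pochhammer (real (Suc m)) j / pochhammer (real (n + i)) j)
       * ennreal (pochhammer (real (Suc m - k)) j / pochhammer (real (Suc m)) j) = 
       ennreal (pois ((cmod \<eta>)\<^sup>2 * Re (ip {..<n} a a)) i) * ennreal (Re (ip {..<n} a a) ^ j * pochhammer (real (n - Suc k)) j / pochhammer (real (n + i)) j)"
      by (simp only: mult.assoc)
  qed
  finally show ?thesis .
qed

lemma pois_sums: "pois r sums 1"
proof -
  have "(\<lambda>i. exp (- r) * (r ^ i /\<^sub>R fact i)) sums (exp (- r) * exp r)"
    by (intro sums_mult exp_converges)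
  then show ?thesis by (simp add: pois_def[abs_def] divide_inverse exp_minus mult_ac)
qed

lemma suminf_pois: "r \<ge> 0 \<Longrightarrow> (\<Sum>i. ennreal (pois r i)) = 1"
  using suminf_ennreal2[OF pois_nonneg sums_summable[OF pois_sums], of r] sums_unique[OF pois_sums[of r]] by simp

text \<open>The array in its reduced form: columns below \<open>k\<close> are central, column
  \<open>k\<close> carries the mean \<open>\<eta> * a\<close> of the interfering columns, and column
  \<open>Suc k\<close> is the desired one with mean \<open>\<kappa> * a\<close>.
  \<open>Suc m\<close>, the \<open>N\<close> of the theorem, is the dimension that the
  \<open>Suc k\<close> interfering columns leave.\<close>

locale column_law =
  fixes n k m :: nat and a :: "nat \<Rightarrow> complex" and \<eta> \<kappa> :: complex
  assumes n: "n = Suc k + Suc m" and a: "ip {..<n} a a = 1"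
begin

definition noise_cols :: "(nat \<Rightarrow> nat \<Rightarrow> complex) \<Rightarrow> (nat \<Rightarrow> complex) list" where
  "noise_cols ws = (\<lambda>i. ws k i + \<eta> * a i) # col_list k ws"

definition \<beta> :: "(nat \<Rightarrow> nat \<Rightarrow> complex) \<Rightarrow> real" where
  "\<beta> ws = residual n (noise_cols ws) a"

definition first_col :: "(nat \<Rightarrow> nat \<Rightarrow> complex) \<Rightarrow> nat \<Rightarrow> complex" where
  "first_col ws = (\<lambda>i. ws (Suc k) i + \<kappa> * a i)"

lemma length_noise_cols[simp]: "length (noise_cols ws) = Suc k"
  by (simp add: noise_cols_def)

lemma noise_cols_upd[simp]: "noise_cols (ws(Suc k := v)) = noise_cols ws"
  by (simp add: noise_cols_def col_list_def)

lemma \<beta>_bounds: "0 \<le> \<beta> ws" "\<beta> ws \<le> 1"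
  unfolding \<beta>_def using residual_nonneg residual_le[of n "noise_cols ws" a] a by auto

lemma measurable_noise:
  assumes "Suc k \<le> l" "\<And>i. i < n \<Longrightarrow> (\<lambda>ws. v ws i) \<in> borel_measurable (CM n l)"
  shows "(\<lambda>ws. residual n (noise_cols ws) (v ws)) \<in> borel_measurable (CM n l)"
    "Measurable.pred (CM n l) (\<lambda>ws. nondeg n (noise_cols ws))"
proof -
  have s: "(\<lambda>ws. ws k i + \<eta> * a i) \<in> borel_measurable (CM n l)" if "i < n" for i
    using that assms(1) by (intro borel_measurable_add measurable_CM_component) auto
  show "(\<lambda>ws. residual n (noise_cols ws) (v ws)) \<in> borel_measurable (CM n l)"
    "Measurable.pred (CM n l) (\<lambda>ws. nondeg n (noise_cols ws))"
    unfolding noise_cols_def by (rule measurable_residual_col_list[where v=v]; use s assms in simp)+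
qed

lemma measurable_\<beta>: "Suc k \<le> l \<Longrightarrow> \<beta> \<in> borel_measurable (CM n l)"
  unfolding \<beta>_def[abs_def] by (rule measurable_noise) auto

lemma measurable_first: "(\<lambda>ws. residual n (noise_cols ws) (first_col ws)) \<in> borel_measurable (CM n (Suc (Suc k)))"
  unfolding first_col_def by (intro measurable_noise borel_measurable_add measurable_CM_component) auto

lemma nondeg_moment:
  "(\<integral>\<^sup>+ws. (if nondeg n (noise_cols ws) then ennreal (\<beta> ws ^ j) else 0) \<partial>CM n (Suc k))
    = (\<Sum>i. ennreal (pois ((cmod \<eta>)\<^sup>2) i * (pochhammer (real (Suc m)) j / pochhammer (real (n + i)) j)))"
proof -
  have P1: "pochhammer (real (Suc b)) j \<ge> 0" for b by (intro pochhammer_nonneg) auto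
  have "(\<integral>\<^sup>+ws. (if nondeg n (noise_cols ws) then ennreal (\<beta> ws ^ j) else 0) \<partial>CM n (Suc k))
   = (\<Sum>i. ennreal (pois ((cmod \<eta>)\<^sup>2) i) * ennreal (pochhammer (real (Suc m)) j / pochhammer (real (n + i)) j))"
  proof -
    have nk: "n - Suc k = Suc m" "Suc k < n" using n by simp_all
    show ?thesis
      unfolding \<beta>_def noise_cols_def shifted_residual_moment[OF nk(2)] a nk(1) by simp
  qed
  also have "\<dots> = (\<Sum>i. ennreal (pois ((cmod \<eta>)\<^sup>2) i * (pochhammer (real (Suc m)) j / pochhammer (real (n + i)) j)))"
    using P1[of m] P1[of "k + Suc m + i" for i] pois_nonneg[of "(cmod \<eta>)\<^sup>2"]
    by (intro suminf_cong ennreal_mult[symmetric] divide_nonneg_nonneg) (auto simp: n)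
  finally show ?thesis .
qed

text \<open>The case \<open>j = 0\<close> of \<open>nondeg_moment\<close>, whose integrand is the
  indicator of nondegeneracy and whose right side is a full Poisson sum.\<close>

lemma AE_nondeg: "AE ws in CM n (Suc k). nondeg n (noise_cols ws)"
proof -
  interpret prob_space "CM n (Suc k)" by (rule prob_space_CM)
  have [measurable]: "Measurable.pred (CM n (Suc k)) (\<lambda>ws. nondeg n (noise_cols ws))"
    by (rule measurable_noise[where v="\<lambda>_. a"]) auto
  have "emeasure (CM n (Suc k)) {ws \<in> space (CM n (Suc k)). nondeg n (noise_cols ws)} = (\<integral>\<^sup>+ws. indicator {ws \<in> space (CM n (Suc k)). nondeg n (noise_cols ws)} ws \<partial>CM n (Suc k))"
    by (rule nn_integral_indicator[symmetric]) measurable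
  also have "\<dots> = (\<integral>\<^sup>+ws. (if nondeg n (noise_cols ws) then ennreal (\<beta> ws ^ 0) else 0) \<partial>CM n (Suc k))"
    by (rule nn_integral_cong) (simp add: indicator_def)
  also have "\<dots> = 1" unfolding nondeg_moment by (simp add: suminf_pois)
  finally have "emeasure (CM n (Suc k)) {ws \<in> space (CM n (Suc k)). nondeg n (noise_cols ws)} = 1" .
  then have "prob {ws \<in> space (CM n (Suc k)). nondeg n (noise_cols ws)} = 1"
    by (simp add: emeasure_eq_measure)
  then show ?thesis by (rule AE_prob_1[THEN AE_mp]) simp
qed

lemma \<beta>_moment:
  "(\<integral>\<^sup>+ws. ennreal (\<beta> ws ^ j) \<partial>CM n (Suc k))
    = (\<Sum>i. ennreal (pois ((cmod \<eta>)\<^sup>2) i * (pochhammer (real (Suc m)) j / pochhammer (real (n + i)) j)))"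
proof -
  have "(\<integral>\<^sup>+ws. ennreal (\<beta> ws ^ j) \<partial>CM n (Suc k)) = (\<integral>\<^sup>+ws. (if nondeg n (noise_cols ws) then ennreal (\<beta> ws ^ j) else 0) \<partial>CM n (Suc k))"
    by (rule nn_integral_cong_AE) (use AE_nondeg in eventually_elim, simp)
  then show ?thesis unfolding nondeg_moment .
qed

lemma first_conditional:
  assumes "nondeg n (noise_cols ws)" "F \<in> borel_measurable borel"
  shows "(\<integral>\<^sup>+z. F (residual n (noise_cols ws) (\<lambda>i. z i + \<kappa> * a i)) \<partial>CG {..<n})
    = (\<Sum>i. ennreal (pois ((cmod \<kappa>)\<^sup>2 * \<beta> ws) i) * (\<integral>\<^sup>+t. F t * ennreal (erlang_density (m + i) 1 t) \<partial>lborel))"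
proof -
  have "n = length (noise_cols ws) + Suc m" using n by simp
  from gauss_residual_law[OF assms(1) this assms(2), of "\<lambda>i. \<kappa> * a i"] show ?thesis
    unfolding residual_scale \<beta>_def .
qed

lemma first_law:
  assumes F[measurable]: "F \<in> borel_measurable borel"
  shows "(\<integral>\<^sup>+ws. F (residual n (noise_cols ws) (first_col ws)) \<partial>CM n (Suc (Suc k)))
    = (\<Sum>i. (\<integral>\<^sup>+ws. ennreal (pois ((cmod \<kappa>)\<^sup>2 * \<beta> ws) i) \<partial>CM n (Suc k)) * (\<integral>\<^sup>+t. F t * ennreal (erlang_density (m + i) 1 t) \<partial>lborel))"
proof -
  note [measurable] = measurable_first measurable_\<beta>[OF order_refl]
  have "(\<integral>\<^sup>+ws. F (residual n (noise_cols ws) (first_col ws)) \<partial>CM n (Suc (Suc k)))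
    = (\<integral>\<^sup>+ws. \<integral>\<^sup>+z. F (residual n (noise_cols ws) (\<lambda>i. z i + \<kappa> * a i)) \<partial>CG {..<n} \<partial>CM n (Suc k))"
    by (subst nn_integral_CM_insert) (measurable, simp add: first_col_def)
  also have "\<dots> = (\<integral>\<^sup>+ws. (\<Sum>i. ennreal (pois ((cmod \<kappa>)\<^sup>2 * \<beta> ws) i) * (\<integral>\<^sup>+t. F t * ennreal (erlang_density (m + i) 1 t) \<partial>lborel)) \<partial>CM n (Suc k))"
    by (rule nn_integral_cong_AE) (use AE_nondeg in eventually_elim, simp add: first_conditional[OF _ F])
  also have "\<dots> = (\<Sum>i. \<integral>\<^sup>+ws. ennreal (pois ((cmod \<kappa>)\<^sup>2 * \<beta> ws) i) * (\<integral>\<^sup>+t. F t * ennreal (erlang_density (m + i) 1 t) \<partial>lborel) \<partial>CM n (Suc k))"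
    by (rule nn_integral_suminf) (unfold pois_def, measurable)
  also have "\<dots> = (\<Sum>i. (\<integral>\<^sup>+ws. ennreal (pois ((cmod \<kappa>)\<^sup>2 * \<beta> ws) i) \<partial>CM n (Suc k)) * (\<integral>\<^sup>+t. F t * ennreal (erlang_density (m + i) 1 t) \<partial>lborel))"
    by (intro suminf_cong nn_integral_multc) (unfold pois_def, measurable)
  finally show ?thesis .
qed

text \<open>By \<open>nondeg_snoc\<close> only a vanishing residual of the first column remains to
  be excluded. Given the other columns, this residual is a mixture of laws with densities.\<close>

lemma AE_nondeg_first: "AE ws in CM n (Suc (Suc k)). nondeg n (noise_cols ws @ [first_col ws])"
proof -
  note [measurable] = measurable_first
  have [measurable]: "Measurable.pred (CM n (Suc (Suc k))) (\<lambda>ws. nondeg n (noise_cols ws))"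
    by (rule measurable_noise[where v="\<lambda>_. a"]) auto
  have e0: "(\<integral>\<^sup>+t. indicator {0::real} t * ennreal (erlang_density i 1 t) \<partial>lborel) = 0" for i
  proof -
    have "AE t in lborel. t \<noteq> (0::real)" by (rule AE_lborel_singleton)
    then have "AE t in lborel. indicator {0::real} t * ennreal (erlang_density i 1 t) = 0"
      by eventually_elim simp
    then show ?thesis by (subst nn_integral_0_iff_AE) auto
  qed
  have "(\<integral>\<^sup>+ws. (if nondeg n (noise_cols ws) \<and> residual n (noise_cols ws) (first_col ws) \<noteq> 0 then 0 else 1) \<partial>CM n (Suc (Suc k)))
    = (\<integral>\<^sup>+ws. \<integral>\<^sup>+z. (if nondeg n (noise_cols ws) \<and> residual n (noise_cols ws) (\<lambda>i. z i + \<kappa> * a i) \<noteq> 0 then 0 else 1) \<partial>CG {..<n} \<partial>CM n (Suc k))"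
    by (subst nn_integral_CM_insert) (measurable, simp add: first_col_def)
  also have "\<dots> = (\<integral>\<^sup>+ws. 0 \<partial>CM n (Suc k))"
  proof (rule nn_integral_cong_AE)
    show "AE ws in CM n (Suc k). (\<integral>\<^sup>+z. (if nondeg n (noise_cols ws) \<and> residual n (noise_cols ws) (\<lambda>i. z i + \<kappa> * a i) \<noteq> 0 then 0 else 1) \<partial>CG {..<n}) = 0"
      using AE_nondeg
    proof eventually_elim
      case (elim ws)
      have "(\<integral>\<^sup>+z. (if nondeg n (noise_cols ws) \<and> residual n (noise_cols ws) (\<lambda>i. z i + \<kappa> * a i) \<noteq> 0 then 0 else 1) \<partial>CG {..<n})
        = (\<integral>\<^sup>+z. indicator {0} (residual n (noise_cols ws) (\<lambda>i. z i + \<kappa> * a i)) \<partial>CG {..<n})"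
        using elim by (intro nn_integral_cong) (simp add: indicator_def)
      also have "\<dots> = 0"
      proof -
        have "(indicator {0::real} :: real \<Rightarrow> ennreal) \<in> borel_measurable borel"
          by measurable
        from first_conditional[OF elim this] show ?thesis by (simp add: e0)
      qed
      finally show ?case .
    qed
  qed
  also have "\<dots> = 0" by simp
  finally have i0: "(\<integral>\<^sup>+ws. (if nondeg n (noise_cols ws) \<and> residual n (noise_cols ws) (first_col ws) \<noteq> 0 then 0 else 1) \<partial>CM n (Suc (Suc k))) = 0" .
  have "(\<lambda>ws. (if nondeg n (noise_cols ws) \<and> residual n (noise_cols ws) (first_col ws) \<noteq> 0 then 0 else 1) :: ennreal) \<in> borel_measurable (CM n (Suc (Suc k)))"
    by measurable
  from i0[unfolded nn_integral_0_iff_AE[OF this]]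
  have "AE ws in CM n (Suc (Suc k)). (if nondeg n (noise_cols ws) \<and> residual n (noise_cols ws) (first_col ws) \<noteq> 0 then 0 else 1) = (0 :: ennreal)"
    .
  then show ?thesis
    by eventually_elim (auto simp: nondeg_snoc split: if_splits)
qed

end

subsection \<open>The double series\<close>

text \<open>By the binomial theorem the growth rate \<open>r\<close> becomes \<open>1 + r\<close>.
  It stays geometric, hence harmless against \<open>1 / fact n\<close>.\<close>

lemma alt_binom_sum_bound:
  fixes X :: "nat \<Rightarrow> 'c :: {real_normed_field, banach}"
  assumes bound: "\<And>i. norm (X i) \<le> C * r ^ i" and X: "\<And>n m. m \<le> n \<Longrightarrow> Xnm n m = X (n - m)"
  shows "norm (alt_binom_sum Xnm n) \<le> C * (1 + r) ^ n"
proof -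
  have "norm (alt_binom_sum Xnm n) \<le> (\<Sum>m=0..n. norm (of_nat (n choose m) * (-1) ^ m * Xnm n m))"
    unfolding alt_binom_sum_def by (rule norm_sum)
  also have "\<dots> \<le> (\<Sum>m=0..n. real (n choose m) * (C * r ^ (n - m)))"
    by (intro sum_mono) (auto simp: norm_mult norm_power X intro!: mult_left_mono bound)
  also have "\<dots> = C * (\<Sum>m\<le>n. of_nat (n choose m) * 1 ^ m * r ^ (n - m))"
    by (simp add: sum_distrib_left atLeast0AtMost mult_ac)
  also have "\<dots> = C * (1 + r) ^ n" by (simp only: binomial_ring)
  finally show ?thesis .
qed

lemma summable_bound_exp:
  fixes y :: real and X :: "nat \<Rightarrow> 'c :: real_normed_vector"
  assumes bound: "\<And>i. norm (X i) \<le> C * r ^ i" and c: "\<And>i. \<bar>c i\<bar> \<le> y ^ i / fact i"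
  shows "summable (\<lambda>i. norm (c i *\<^sub>R X i))"
proof (rule summable_comparison_test')
  show "summable (\<lambda>i. C * ((y * r) ^ i /\<^sub>R fact i))"
    by (intro summable_mult summable_exp_generic)
  fix i
  have "0 \<le> y ^ i / fact i" using c[of i] abs_ge_zero order_trans by blast
  then have "\<bar>c i\<bar> * norm (X i) \<le> (y ^ i / fact i) * (C * r ^ i)"
    by (intro mult_mono c bound) auto
  then show "norm (norm (c i *\<^sub>R X i)) \<le> C * ((y * r) ^ i /\<^sub>R fact i)"
    by (simp add: power_mult_distrib field_simps)
qed

text \<open>The Cauchy product of the series for \<open>exp (- y)\<close> with the exponential generating series
  of \<open>X\<close>.\<close>

lemma alt_binom_sum_sums:
  fixes X :: "nat \<Rightarrow> 'c :: {real_normed_field, banach}" and y :: real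
  assumes bound: "\<And>i. norm (X i) \<le> C * r ^ i" and X: "\<And>n m. m \<le> n \<Longrightarrow> Xnm n m = X (n - m)"
  shows "(\<lambda>n. (y ^ n / fact n) *\<^sub>R alt_binom_sum Xnm n) sums (\<Sum>i. pois y i *\<^sub>R X i)"
proof -
  define a where "a i = (of_real ((-y) ^ i / fact i) :: 'c)" for i
  define b where "b i = (y ^ i / fact i) *\<^sub>R X i" for i
  have "summable (\<lambda>i. norm (((-y) ^ i / fact i) *\<^sub>R (1 :: 'c)))"
    by (rule summable_bound_exp[where C=1 and r=1 and y="\<bar>y\<bar>"]) (auto simp: power_abs)
  then have sa: "summable (\<lambda>i. norm (a i))" by (simp add: a_def scaleR_conv_of_real)
  have sb: "summable (\<lambda>i. norm (b i))" unfolding b_def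
    by (rule summable_bound_exp[OF bound, where y="\<bar>y\<bar>"]) (auto simp: power_abs)
  have "(\<lambda>i. of_real ((-y) ^ i /\<^sub>R fact i) :: 'c) sums of_real (exp (- y))"
    by (intro sums_of_real exp_converges)
  then have "a sums of_real (exp (- y))" by (simp add: a_def[abs_def] divide_inverse mult.commute)
  then have A: "suminf a = of_real (exp (- y))" by (simp add: sums_iff)
  have "(\<lambda>k. \<Sum>i\<le>k. a i * b (k - i)) sums (suminf a * suminf b)"
    by (rule Cauchy_product_sums[OF sa sb])
  moreover have "(\<Sum>i\<le>k. a i * b (k - i)) = (y ^ k / fact k) *\<^sub>R alt_binom_sum Xnm k" for k
  proof -
    have "a i * b (k - i) = (y ^ k / fact k) *\<^sub>R (of_nat (k choose i) * (-1) ^ i * Xnm k i)" if "i \<le> k" for i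
    proof -
      have "(-y) ^ i * y ^ (k - i) = (-1) ^ i * y ^ k"
        using that by (simp add: power_minus[of y] power_add[symmetric])
      then have "((-y) ^ i / fact i) * (y ^ (k - i) / fact (k - i)) = (y ^ k / fact k) * (real (k choose i) * (-1) ^ i)"
        by (simp add: binomial_fact[OF that] field_simps)
      then have "a i * b (k - i) = of_real ((y ^ k / fact k) * (real (k choose i) * (-1) ^ i)) * X (k - i)"
        by (simp only: a_def b_def scaleR_conv_of_real mult.assoc[symmetric] of_real_mult[symmetric])
      then show ?thesis by (simp add: X[OF that] scaleR_conv_of_real)
    qed
    then show ?thesis unfolding alt_binom_sum_def by (simp add: scaleR_sum_right atLeast0AtMost)
  qed
  moreover have "suminf a * suminf b = (\<Sum>i. pois y i *\<^sub>R X i)"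
  proof -
    have "of_real (exp (- y)) * b i = pois y i *\<^sub>R X i" for i
      by (simp add: b_def pois_def scaleR_conv_of_real mult.assoc)
    then show ?thesis
      unfolding A using suminf_mult[OF summable_norm_cancel[OF sb], of "of_real (exp (- y))"] by simp
  qed
  ultimately show ?thesis by simp
qed

lemma pois_le: "y \<ge> 0 \<Longrightarrow> pois y i \<le> y ^ i / fact i"
  by (simp add: pois_def divide_right_mono mult_left_le_one_le)

text \<open>Separates the analysis from the channel: \<open>\<beta>\<close> enters through its range
  and its moments alone.\<close>

locale noncentral_mixture = prob_space Q for Q :: "'q measure" +
  fixes \<beta> :: "'q \<Rightarrow> real" and N NR :: nat and x1 x2 G :: real
  assumes \<beta>_meas[measurable]: "\<beta> \<in> borel_measurable Q"
    and \<beta>_range: "\<And>\<omega>. 0 \<le> \<beta> \<omega>" "\<And>\<omega>. \<beta> \<omega> \<le> 1"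
    and x1: "x1 \<ge> 0" and x2: "x2 \<ge> 0" and G: "G > 0" and N: "N > 0" and NR: "N \<le> NR"
    and \<beta>_moment: "\<And>j. (\<integral>\<^sup>+\<omega>. ennreal (\<beta> \<omega> ^ j) \<partial>Q)
      = (\<Sum>i. ennreal (pois x2 i * (pochhammer (real N) j / pochhammer (real (NR + i)) j)))"
begin

lemma poch_ratio: "0 \<le> pochhammer (real N) j / pochhammer (real (NR + i)) j" 
  "pochhammer (real N) j / pochhammer (real (NR + i)) j \<le> 1"
proof -
  have "pochhammer (real N) j > 0" "pochhammer (real (NR + i)) j > 0"
    using N NR by (auto intro!: pochhammer_pos)
  moreover have "pochhammer (real N) j \<le> pochhammer (real (NR + i)) j"
    unfolding pochhammer_prod using NR by (intro prod_mono) auto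
  ultimately show "0 \<le> pochhammer (real N) j / pochhammer (real (NR + i)) j" 
    "pochhammer (real N) j / pochhammer (real (NR + i)) j \<le> 1" by simp_all
qed

lemma expectation_\<beta>_sums:
  "(\<lambda>i. pois x2 i * (pochhammer (real N) j / pochhammer (real (NR + i)) j)) sums expectation (\<lambda>\<omega>. \<beta> \<omega> ^ j)"
proof -
  let ?f = "\<lambda>i. pois x2 i * (pochhammer (real N) j / pochhammer (real (NR + i)) j)"
  have f0: "0 \<le> ?f i" for i using poch_ratio pois_nonneg[OF x2] by (intro mult_nonneg_nonneg) auto
  have sf: "summable ?f"
  proof (rule summable_comparison_test')
    show "summable (pois x2)" using pois_sums sums_summable by blast
    fix i show "norm (?f i) \<le> pois x2 i"
      unfolding real_norm_def abs_of_nonneg[OF f0] by (intro mult_left_le poch_ratio pois_nonneg x2)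
  qed
  have int: "integrable Q (\<lambda>\<omega>. \<beta> \<omega> ^ j)"
    by (rule integrable_const_bound[where B=1]) (auto simp: \<beta>_range power_le_one)
  have "ennreal (expectation (\<lambda>\<omega>. \<beta> \<omega> ^ j)) = (\<integral>\<^sup>+\<omega>. ennreal (\<beta> \<omega> ^ j) \<partial>Q)"
    using int by (intro nn_integral_eq_integral[symmetric]) (auto simp: \<beta>_range)
  also have "\<dots> = ennreal (suminf ?f)" unfolding \<beta>_moment using f0 sf by (rule suminf_ennreal2)
  finally have "expectation (\<lambda>\<omega>. \<beta> \<omega> ^ j) = suminf ?f"
    using suminf_nonneg[OF sf f0] by (subst (asm) ennreal_inj) (auto intro!: Bochner_Integration.integral_nonneg simp: \<beta>_range)
  then show ?thesis using sf by (simp add: summable_sums)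
qed

definition wt :: "nat \<Rightarrow> real" where
  "wt i = expectation (\<lambda>\<omega>. pois (x1 * \<beta> \<omega>) i)"

lemma noncentrality_bounds: "0 \<le> x1 * \<beta> \<omega>" "x1 * \<beta> \<omega> \<le> x1"
  using x1 \<beta>_range[of \<omega>] by (auto simp: mult_left_le)

lemma pois_noncentrality_bounds: "0 \<le> pois (x1 * \<beta> \<omega>) i" "pois (x1 * \<beta> \<omega>) i \<le> x1 ^ i / fact i"
proof -
  have "(x1 * \<beta> \<omega>) ^ i / fact i \<le> x1 ^ i / fact i"
    by (intro divide_right_mono power_mono noncentrality_bounds) auto
  then show "pois (x1 * \<beta> \<omega>) i \<le> x1 ^ i / fact i" using pois_le[OF noncentrality_bounds(1)] order_trans by blast
qed (simp add: pois_nonneg noncentrality_bounds)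

lemma measurable_pois[measurable]: "(\<lambda>\<omega>. pois (x1 * \<beta> \<omega>) i) \<in> borel_measurable Q"
  unfolding pois_def by measurable

lemma integrable_pois: "integrable Q (\<lambda>\<omega>. pois (x1 * \<beta> \<omega>) i)"
  by (rule integrable_const_bound[where B="x1 ^ i / fact i"]) (auto simp: pois_noncentrality_bounds)

lemma wt_bounds: "0 \<le> wt i" "wt i \<le> x1 ^ i / fact i"
proof -
  show "0 \<le> wt i" unfolding wt_def by (intro Bochner_Integration.integral_nonneg) (simp add: pois_noncentrality_bounds)
  have "wt i \<le> expectation (\<lambda>_. x1 ^ i / fact i)"
    unfolding wt_def by (intro integral_mono integrable_pois) (auto simp: pois_noncentrality_bounds)
  then show "wt i \<le> x1 ^ i / fact i" by (simp add: prob_space)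
qed

lemma ennreal_wt: "(\<integral>\<^sup>+\<omega>. ennreal (pois (x1 * \<beta> \<omega>) i) \<partial>Q) = ennreal (wt i)"
  unfolding wt_def using integrable_pois by (intro nn_integral_eq_integral) (auto simp: pois_noncentrality_bounds)

text \<open>The expectation of \<open>\<Sum>i. pois (x1 * \<beta> \<omega>) i *\<^sub>R X i\<close>
  is computed twice. Termwise integration yields the weights \<open>wt i\<close>. Rewritten by
  \<open>alt_binom_sum_sums\<close> the sum is a power series in \<open>\<beta>\<close>, so that
  termwise integration brings in the moments of \<open>\<beta>\<close>, whose own series become the
  inner sum over \<open>n2\<close>. Both exchanges are dominated uniformly in
  \<open>\<omega>\<close> because \<open>\<beta>\<close> is at most 1.\<close>

lemma S_series:
  fixes X :: "nat \<Rightarrow> 'c :: {real_normed_field, banach, second_countable_topology}"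
  assumes bound: "\<And>i. norm (X i) \<le> C * r ^ i" and X: "\<And>n m. m \<le> n \<Longrightarrow> Xnm n m = X (n - m)"
  shows "(\<lambda>i. wt i *\<^sub>R X i) sums S_sum N NR x1 x2 (alt_binom_sum Xnm)" (is ?A)
    "S_convergent N NR x1 x2 (alt_binom_sum Xnm)" (is ?B)
proof -
  define D where "D n = alt_binom_sum Xnm n" for n
  have Db: "norm (D n) \<le> C * (1 + r) ^ n" for n
    unfolding D_def by (rule alt_binom_sum_bound[OF bound X])
  define c where "c n = x1 ^ n / fact n * expectation (\<lambda>\<omega>. \<beta> \<omega> ^ n)" for n
  have f_bound: "norm (pois (x1 * \<beta> \<omega>) i *\<^sub>R X i) \<le> norm ((x1 ^ i / fact i) *\<^sub>R X i)" for \<omega> i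
    unfolding norm_scaleR using pois_noncentrality_bounds[of \<omega> i] x1 by (intro mult_right_mono) auto
  have g_bound: "norm (((x1 * \<beta> \<omega>) ^ n / fact n) *\<^sub>R D n) \<le> norm ((x1 ^ n / fact n) *\<^sub>R D n)" for \<omega> n
    using noncentrality_bounds[of \<omega>] x1 by (simp add: mult_right_mono divide_right_mono power_mono)
  have sf: "summable (\<lambda>i. norm ((x1 ^ i / fact i) *\<^sub>R X i))"
    by (rule summable_bound_exp[OF bound, where y=x1]) (use x1 in simp)
  have sg: "summable (\<lambda>n. norm ((x1 ^ n / fact n) *\<^sub>R D n))"
    by (rule summable_bound_exp[OF Db, where y=x1]) (use x1 in simp)
  have fi: "integrable Q (\<lambda>\<omega>. pois (x1 * \<beta> \<omega>) i *\<^sub>R X i)" for i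
    by (intro integrable_scaleR_left integrable_pois)
  have gi: "integrable Q (\<lambda>\<omega>. ((x1 * \<beta> \<omega>) ^ n / fact n) *\<^sub>R D n)" for n
    by (rule integrable_const_bound[where B="norm ((x1 ^ n / fact n) *\<^sub>R D n)"]) (use g_bound in auto)
  have "(\<lambda>i. \<integral>\<omega>. pois (x1 * \<beta> \<omega>) i *\<^sub>R X i \<partial>Q) sums (\<integral>\<omega>. (\<Sum>i. pois (x1 * \<beta> \<omega>) i *\<^sub>R X i) \<partial>Q)"
  proof (rule sums_integral[OF fi])
    show "AE \<omega> in Q. summable (\<lambda>i. norm (pois (x1 * \<beta> \<omega>) i *\<^sub>R X i))"
      by (intro AE_I2 summable_comparison_test'[OF sf]) (use f_bound in simp)
    show "summable (\<lambda>i. \<integral>\<omega>. norm (pois (x1 * \<beta> \<omega>) i *\<^sub>R X i) \<partial>Q)"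
    proof (rule summable_comparison_test'[OF sf])
      fix i
      have "(\<integral>\<omega>. norm (pois (x1 * \<beta> \<omega>) i *\<^sub>R X i) \<partial>Q) \<le> (\<integral>\<omega>. norm ((x1 ^ i / fact i) *\<^sub>R X i) \<partial>Q)"
        by (intro integral_mono integrable_norm fi f_bound) simp
      then show "norm (\<integral>\<omega>. norm (pois (x1 * \<beta> \<omega>) i *\<^sub>R X i) \<partial>Q) \<le> norm ((x1 ^ i / fact i) *\<^sub>R X i)"
        by (simp add: prob_space)
    qed
  qed
  moreover have "(\<integral>\<omega>. pois (x1 * \<beta> \<omega>) i *\<^sub>R X i \<partial>Q) = wt i *\<^sub>R X i" for i
    unfolding wt_def by (rule integral_scaleR_left) (rule integrable_pois)
  ultimately have 1: "(\<lambda>i. wt i *\<^sub>R X i) sums (\<integral>\<omega>. (\<Sum>i. pois (x1 * \<beta> \<omega>) i *\<^sub>R X i) \<partial>Q)" by simp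
  have "(\<lambda>n. \<integral>\<omega>. ((x1 * \<beta> \<omega>) ^ n / fact n) *\<^sub>R D n \<partial>Q) sums (\<integral>\<omega>. (\<Sum>n. ((x1 * \<beta> \<omega>) ^ n / fact n) *\<^sub>R D n) \<partial>Q)"
  proof (rule sums_integral[OF gi])
    show "AE \<omega> in Q. summable (\<lambda>n. norm (((x1 * \<beta> \<omega>) ^ n / fact n) *\<^sub>R D n))"
      by (intro AE_I2 summable_comparison_test'[OF sg]) (use g_bound in simp)
    show "summable (\<lambda>n. \<integral>\<omega>. norm (((x1 * \<beta> \<omega>) ^ n / fact n) *\<^sub>R D n) \<partial>Q)"
    proof (rule summable_comparison_test'[OF sg])
      fix n
      have "(\<integral>\<omega>. norm (((x1 * \<beta> \<omega>) ^ n / fact n) *\<^sub>R D n) \<partial>Q) \<le> (\<integral>\<omega>. norm ((x1 ^ n / fact n) *\<^sub>R D n) \<partial>Q)"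
        by (intro integral_mono integrable_norm gi g_bound) simp
      then show "norm (\<integral>\<omega>. norm (((x1 * \<beta> \<omega>) ^ n / fact n) *\<^sub>R D n) \<partial>Q) \<le> norm ((x1 ^ n / fact n) *\<^sub>R D n)"
        by (simp add: prob_space)
    qed
  qed
  moreover have "(\<integral>\<omega>. ((x1 * \<beta> \<omega>) ^ n / fact n) *\<^sub>R D n \<partial>Q) = c n *\<^sub>R D n" for n
  proof -
    have i: "integrable Q (\<lambda>\<omega>. \<beta> \<omega> ^ n)"
      by (rule integrable_const_bound[where B=1]) (auto simp: \<beta>_range power_le_one)
    have "(\<integral>\<omega>. ((x1 * \<beta> \<omega>) ^ n / fact n) *\<^sub>R D n \<partial>Q) = (\<integral>\<omega>. (x1 ^ n / fact n * \<beta> \<omega> ^ n) *\<^sub>R D n \<partial>Q)"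
      by (simp add: power_mult_distrib)
    also have "\<dots> = (\<integral>\<omega>. x1 ^ n / fact n * \<beta> \<omega> ^ n \<partial>Q) *\<^sub>R D n"
      using i by (intro integral_scaleR_left) simp
    finally show ?thesis by (simp add: c_def)
  qed
  moreover have "(\<Sum>n. ((x1 * \<beta> \<omega>) ^ n / fact n) *\<^sub>R D n) = (\<Sum>i. pois (x1 * \<beta> \<omega>) i *\<^sub>R X i)" for \<omega>
    using alt_binom_sum_sums[where Xnm=Xnm, OF bound X, of "x1 * \<beta> \<omega>"] unfolding D_def by (simp add: sums_iff)
  ultimately have 2: "(\<lambda>n. c n *\<^sub>R D n) sums (\<integral>\<omega>. (\<Sum>i. pois (x1 * \<beta> \<omega>) i *\<^sub>R X i) \<partial>Q)" by simp
  \<comment> \<open>\<open>exp x2\<close> undoes the Poisson normalisation in the series for the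
    moment; the prefactor in \<open>S_sum\<close> restores it.\<close>
  have 3: "S_term N NR x1 x2 D n sums (exp x2 *\<^sub>R (c n *\<^sub>R D n))" for n
  proof -
    have "(\<lambda>i. (exp x2 * (x1 ^ n / fact n) * (pois x2 i * (pochhammer (real N) n / pochhammer (real (NR + i)) n))) *\<^sub>R D n)
       sums ((exp x2 * (x1 ^ n / fact n) * expectation (\<lambda>\<omega>. \<beta> \<omega> ^ n)) *\<^sub>R D n)"
      by (intro sums_scaleR_left sums_mult expectation_\<beta>_sums)
    moreover have "exp x2 * (x1 ^ n / fact n) * (pois x2 i * (pochhammer (real N) n / pochhammer (real (NR + i)) n))
      = pochhammer (real N) n / pochhammer (real (i + NR)) n * (x1 ^ n / fact n) * (x2 ^ i / fact i)" for i
    proof -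
      have "exp x2 * pois x2 i = x2 ^ i / fact i" by (simp add: pois_def exp_minus)
      moreover have "exp x2 * (x1 ^ n / fact n) * (pois x2 i * (pochhammer (real N) n / pochhammer (real (NR + i)) n))
        = pochhammer (real N) n / pochhammer (real (i + NR)) n * (x1 ^ n / fact n) * (exp x2 * pois x2 i)"
        by (simp add: add.commute mult_ac)
      ultimately show ?thesis by simp
    qed
    ultimately show ?thesis by (simp add: S_term_def[abs_def] c_def mult.assoc)
  qed
  then have 4: "(\<Sum>i. S_term N NR x1 x2 D n i) = exp x2 *\<^sub>R (c n *\<^sub>R D n)" for n by (simp add: sums_iff)
  have 5: "(\<lambda>n. exp x2 *\<^sub>R (c n *\<^sub>R D n)) sums (exp x2 *\<^sub>R (\<integral>\<omega>. (\<Sum>i. pois (x1 * \<beta> \<omega>) i *\<^sub>R X i) \<partial>Q))"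
    by (intro sums_scaleR_right 2)
  have DD: "alt_binom_sum Xnm = D" by (simp add: D_def fun_eq_iff)
  have "S_sum N NR x1 x2 D = (\<integral>\<omega>. (\<Sum>i. pois (x1 * \<beta> \<omega>) i *\<^sub>R X i) \<partial>Q)"
    unfolding S_sum_def 4 using 5 by (simp add: sums_iff exp_minus)
  then show ?A using 1 unfolding DD by simp
  show ?B unfolding DD S_convergent_def 4 using 3 5 sums_summable by blast
qed

end

text \<open>For nonnegative \<open>t\<close> the density is \<open>l\<close> times a Poisson weight
  of parameter \<open>l * t\<close>.\<close>

lemma erlang_density_le:
  assumes "l > 0"
  shows "erlang_density k l t \<le> l"
proof (cases "t < 0")
  case True
  then show ?thesis using assms by (simp add: erlang_density_def)
next
  case False
  have "pois (l * t) k \<le> (\<Sum>i. pois (l * t) i)"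
    using sum_le_suminf[OF sums_summable[OF pois_sums], of "{k}" "l * t"] assms False by (simp add: pois_nonneg)
  then have "pois (l * t) k \<le> 1" using pois_sums[of "l * t"] by (simp add: sums_iff)
  then have "l * pois (l * t) k \<le> l" using assms by simp
  moreover have "erlang_density k l t = l * pois (l * t) k"
    using False by (simp add: erlang_density_def pois_def power_mult_distrib)
  ultimately show ?thesis by simp
qed

text \<open>Exponential tilting keeps the shape and moves the rate from \<open>l\<close> to
  \<open>l - \<rho>\<close>. It evaluates the absolute integrals behind the moment generating
  function.\<close>

lemma erlang_density_tilt:
  assumes "l > 0" and that: "\<rho> < l"
  shows "erlang_density k l t * exp (\<rho> * t) = (l / (l - \<rho>)) ^ Suc k * erlang_density k (l - \<rho>) t"
proof -
  have "exp (- l * t) * exp (\<rho> * t) = exp (- (l - \<rho>) * t)"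
    by (simp add: exp_add[symmetric] algebra_simps)
  then have "l ^ Suc k * t ^ k * (exp (- l * t) * exp (\<rho> * t)) / fact k = (l / (l - \<rho>)) ^ Suc k * ((l - \<rho>) ^ Suc k * t ^ k * exp (- (l - \<rho>) * t) / fact k)"
    using that by (simp only: power_divide) (simp del: power_Suc)
  then show ?thesis by (auto simp: erlang_density_def simp del: power_Suc)
qed

lemma integrable_erlang: "l > 0 \<Longrightarrow> integrable lborel (erlang_density k l)"
  and integral_erlang: "l > 0 \<Longrightarrow> (\<integral>t. erlang_density k l t \<partial>lborel) = 1"
proof -
  assume l: "l > 0"
  have "has_bochner_integral lborel (erlang_density k l) 1"
    by (rule has_bochner_integral_nn_integral) (use l nn_integral_erlang_total[OF l] in auto)
  then show "integrable lborel (erlang_density k l)" "(\<integral>t. erlang_density k l t \<partial>lborel) = 1"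
    by (auto simp: has_bochner_integral_iff)
qed

lemma power_exp_tendsto_0:
  assumes "c > (0::real)"
  shows "((\<lambda>t. t ^ k * exp (- c * t)) \<longlongrightarrow> 0) at_top"
proof -
  have "((\<lambda>t. (c * t) ^ k / exp (c * t)) \<longlongrightarrow> 0) at_top"
    by (rule filterlim_compose[OF tendsto_power_div_exp_0])
       (rule filterlim_tendsto_pos_mult_at_top[OF tendsto_const assms filterlim_ident])
  then have "((\<lambda>t. inverse (c ^ k) * ((c * t) ^ k / exp (c * t))) \<longlongrightarrow> inverse (c ^ k) * 0) at_top"
    by (rule tendsto_mult_left)
  then show ?thesis using assms by (simp add: power_mult_distrib exp_minus field_simps)
qed

text \<open>Integration by parts for complex \<open>z\<close>: \<open>f k - z * f (Suc k)\<close> is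
  the derivative of \<open>f (Suc k)\<close>, which vanishes at 0 and at infinity, so each step
  divides the integral by \<open>z\<close>. The recursion starts from \<open>f 0\<close>, whose
  boundary value at 0 is 1.\<close>

lemma laplace_power:
  fixes z :: complex
  assumes z: "Re z > 0"
  shows "set_integrable lborel {0<..} (\<lambda>t. of_real (t ^ k / fact k) * exp (- z * of_real t))"
    "(CLBINT t:{0<..}. of_real (t ^ k / fact k) * exp (- z * of_real t)) = 1 / z ^ Suc k"
proof -
  have z0: "z \<noteq> 0" using z by auto
  define f where "f k t = of_real (t ^ k / fact k) * exp (- z * of_real t)" for k and t :: real
  have nf: "norm (f k t) = t ^ k / fact k * exp (- Re z * t)" if "t \<ge> 0" for k t
    using that by (simp add: f_def norm_mult norm_divide norm_power)
  have [measurable]: "f k \<in> borel_measurable borel" for k unfolding f_def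
    by (intro borel_measurable_continuous_onI continuous_intros) auto
  have int: "set_integrable lborel {0<..} (f k)" for k
  proof -
    have i: "integrable lborel (\<lambda>t. (1 / Re z ^ Suc k) * erlang_density k (Re z) t)"
      using integrable_erlang[OF z] by simp
    show ?thesis unfolding set_integrable_def
      by (rule Bochner_Integration.integrable_bound[OF i])
        (use z in \<open>auto simp: indicator_def nf erlang_density_def simp del: power_Suc\<close>)
  qed
  have f_0: "f 0 = (\<lambda>t. exp (- z * of_real t))" by (simp add: f_def fun_eq_iff)
  have der0: "((\<lambda>t. exp (- z * of_real t)) has_vector_derivative - z * f 0 t) (at t)" for t
    unfolding f_0 by (auto intro!: derivative_eq_intros has_vector_derivative_real_field)
  have der: "(f (Suc k) has_vector_derivative f k t - z * f (Suc k) t) (at t)" for k t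
  proof -
    have d: "((\<lambda>w. w ^ Suc k / fact (Suc k)) has_field_derivative w ^ k / fact k) (at w)" for w :: complex
    proof -
      have "((\<lambda>w. w ^ Suc k / fact (Suc k)) has_field_derivative of_nat (Suc k) * w ^ k / fact (Suc k)) (at w)"
        by (intro DERIV_cdivide DERIV_pow[of "Suc k", simplified] DERIV_power_Suc[where f="\<lambda>w. w" and D=1, simplified] derivative_eq_intros) (auto simp del: power_Suc fact_Suc)
      then show ?thesis by (simp del: power_Suc of_nat_Suc)
    qed
    have "((\<lambda>w. w ^ Suc k / fact (Suc k) * exp (- z * w)) has_field_derivative
       (w ^ k / fact k) * exp (- z * w) + w ^ Suc k / fact (Suc k) * (- z * exp (- z * w))) (at w)" for w
      by (rule derivative_eq_intros d refl | simp del: power_Suc fact_Suc)+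
    from has_vector_derivative_real_field[OF this[of "of_real t"]]
    show ?thesis unfolding f_def by (simp add: algebra_simps del: power_Suc fact_Suc)
  qed
  have lim0: "((f k) \<longlongrightarrow> 0) at_top" for k
  proof (rule Lim_null_comparison)
    show "\<forall>\<^sub>F t in at_top. norm (f k t) \<le> t ^ k * exp (- Re z * t)"
      using eventually_ge_at_top[of 0]
    proof eventually_elim
      case (elim t)
      have "t ^ k / fact k \<le> t ^ k / 1" using elim by (intro divide_left_mono) (auto simp: fact_ge_1)
      then show ?case unfolding nf[OF elim] by (intro mult_right_mono) auto
    qed
  qed (rule power_exp_tendsto_0[OF z])
  have e: "einterval 0 \<infinity> = {0<..}" by (auto simp: einterval_def)
  have cont: "isCont (f k) t" for k t unfolding f_def by (intro continuous_intros) auto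
  have lim_at_0: "((f k \<circ> real_of_ereal) \<longlongrightarrow> f k 0) (at_right 0)" for k
    by (simp add: ereal_tendsto_simps zero_ereal_def) (use cont in \<open>simp add: isCont_def filterlim_at_split\<close>)
  have "(CLBINT t:{0<..}. f k t) = 1 / z ^ Suc k"
  proof (induction k)
    case 0
    have "(CLBINT t=0..\<infinity>. - z * f 0 t) = 0 - f 0 0"
    proof (rule interval_integral_FTC_integrable)
      show "(f 0 has_vector_derivative - z * f 0 t) (at t)" for t
        using der0[of t] unfolding f_0 .
      show "isCont (\<lambda>t. - z * f 0 t) t" for t by (intro continuous_intros cont)
      show "set_integrable lborel (einterval 0 \<infinity>) (\<lambda>t. - z * f 0 t)"
        unfolding e by (intro set_integrable_mult_right int)
      show "((f 0 \<circ> real_of_ereal) \<longlongrightarrow> 0) (at_left \<infinity>)"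
        using lim0 by (simp add: ereal_tendsto_simps)
    qed (auto intro: lim_at_0)
    then have "(CLBINT t:{0<..}. - z * f 0 t) = 0 - f 0 0"
      unfolding interval_lebesgue_integral_def e by simp
    moreover have "f 0 0 = 1" by (simp add: f_def)
    ultimately have "- z * (CLBINT t:{0<..}. f 0 t) = 0 - 1"
      by (simp only: set_integral_mult_right)
    then show ?case using z0 by (simp add: field_simps)
  next
    case (Suc k)
    have "(CLBINT t=0..\<infinity>. f k t - z * f (Suc k) t) = 0 - f (Suc k) 0"
    proof (rule interval_integral_FTC_integrable)
      show "(f (Suc k) has_vector_derivative f k t - z * f (Suc k) t) (at t)" for t by (rule der)
      show "isCont (\<lambda>t. f k t - z * f (Suc k) t) t" for t by (intro continuous_intros cont)
      show "set_integrable lborel (einterval 0 \<infinity>) (\<lambda>t. f k t - z * f (Suc k) t)"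
        unfolding e by (intro set_integral_diff set_integrable_mult_right int)
      show "((f (Suc k) \<circ> real_of_ereal) \<longlongrightarrow> 0) (at_left \<infinity>)"
        using lim0 by (simp add: ereal_tendsto_simps)
    qed (auto intro: lim_at_0)
    then have "(CLBINT t:{0<..}. f k t - z * f (Suc k) t) = 0"
      by (simp add: interval_lebesgue_integral_def e f_def)
    then have "(CLBINT t:{0<..}. f k t) - z * (CLBINT t:{0<..}. f (Suc k) t) = 0"
      by (subst (asm) set_integral_diff) (auto intro: int)
    then show ?case using Suc z0 by (simp add: field_simps)
  qed
  then show "(CLBINT t:{0<..}. of_real (t ^ k / fact k) * exp (- z * of_real t)) = 1 / z ^ Suc k"
    by (simp add: f_def)
  show "set_integrable lborel {0<..} (\<lambda>t. of_real (t ^ k / fact k) * exp (- z * of_real t))"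
    using int[of k] unfolding f_def[abs_def] .
qed

lemma erlang_mgf:
  fixes s :: complex
  assumes "G > 0" "Re s < 1 / G"
  shows "(\<integral>t. erlang_density k (1 / G) t *\<^sub>R exp (s * of_real t) \<partial>lborel) = 1 / (1 - s * of_real G) ^ Suc k"
proof -
  define l where "l = 1 / G"
  have l: "l > 0" using assms by (simp add: l_def)
  define z where "z = of_real l - s"
  have z: "Re z > 0" using assms by (simp add: z_def l_def)
  have "(\<integral>t. erlang_density k l t *\<^sub>R exp (s * of_real t) \<partial>lborel) = (\<integral>t. indicator {0<..} t *\<^sub>R (of_real (l ^ Suc k) * (of_real (t ^ k / fact k) * exp (- z * of_real t))) \<partial>lborel)"
  proof (rule integral_cong_AE)
    show "(\<lambda>t. erlang_density k l t *\<^sub>R exp (s * of_real t)) \<in> borel_measurable lborel" 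
      by measurable
    show "(\<lambda>t. indicator {0<..} t *\<^sub>R (of_real (l ^ Suc k) * (of_real (t ^ k / fact k) * exp (- z * of_real t)))) \<in> borel_measurable lborel" 
      by measurable
    \<comment> \<open>At \<open>t = 0\<close> the two integrands differ when \<open>k = 0\<close>:
      the Erlang density is positive there.\<close>
    have "AE t in lborel. t \<noteq> (0::real)" by (rule AE_lborel_singleton)
    then show "AE t in lborel. erlang_density k l t *\<^sub>R exp (s * of_real t) = indicator {0<..} t *\<^sub>R (of_real (l ^ Suc k) * (of_real (t ^ k / fact k) * exp (- z * of_real t)))"
    proof eventually_elim
      case (elim t)
      have "exp (- z * of_real t) = of_real (exp (- l * t)) * exp (s * of_real t)"
        by (simp add: z_def exp_of_real[symmetric] exp_add[symmetric] algebra_simps)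
      then show ?case using elim
        by (simp add: erlang_density_def indicator_def scaleR_conv_of_real del: power_Suc)
    qed
  qed
  also have "\<dots> = of_real (l ^ Suc k) * (1 / z ^ Suc k)"
    unfolding set_lebesgue_integral_def[symmetric]
    by (subst set_integral_mult_right) (simp only: laplace_power(2)[OF z])
  also have "\<dots> = (of_real l / z) ^ Suc k" by (simp add: power_divide del: power_Suc)
  also have "of_real l / z = 1 / (1 - s * of_real G)"
  proof -
    have "z = of_real l * (1 - s * of_real G)" using assms by (simp add: z_def l_def field_simps)
    then show ?thesis using l by simp
  qed
  finally show ?thesis by (simp add: l_def power_divide del: power_Suc)
qed

subsection \<open>The mixture density and its functionals\<close>

text \<open>\<open>erlang_density\<close> is indexed by the shape minus 1, hence
  \<open>N - 1\<close>. It is cut off at 0, whereas \<open>p_nm\<close> is not; this is why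
  \<open>t\<close> is nonnegative.\<close>

lemma p_nm_eq_erlang:
  assumes "G > 0" "N > 0" "m \<le> n" "t \<ge> 0"
  shows "p_nm N G t n m = erlang_density (N - 1 + (n - m)) (1 / G) t"
proof -
  define k where "k = N - 1 + (n - m)"
  have k: "N + n - m - 1 = k" "N + n - m = Suc k"
    using assms by (auto simp: k_def)
  show ?thesis
    unfolding p_nm_def k k_def[symmetric] using assms(4)
    by (simp add: erlang_density_def power_divide mult.commute del: power_Suc)
qed

context noncentral_mixture
begin

text \<open>The density of the gamma law of shape \<open>N + i\<close> and scale \<open>G\<close>,
  component \<open>i\<close> of the mixture.\<close>

definition erl :: "nat \<Rightarrow> real \<Rightarrow> real" where
  "erl i = erlang_density (N - 1 + i) (1 / G)"

lemma measurable_erl[measurable]: "erl i \<in> borel_measurable borel"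
  unfolding erl_def by measurable

definition dens :: "real \<Rightarrow> real" where
  "dens t = (\<Sum>i. wt i * erl i t)"

lemma erl_bounds: "0 \<le> erl i t" "erl i t \<le> 1 / G"
  using G unfolding erl_def by (auto intro: erlang_density_le)

lemma summable_wt: "summable wt"
proof (rule summable_comparison_test')
  show "summable (\<lambda>i. x1 ^ i /\<^sub>R fact i)" by (rule summable_exp_generic)
  show "norm (wt i) \<le> x1 ^ i /\<^sub>R fact i" for i
    using wt_bounds[of i] by (simp add: divide_inverse mult.commute)
qed

lemma summable_dens: "summable (\<lambda>i. wt i * erl i t)"
proof (rule summable_comparison_test')
  show "summable (\<lambda>i. wt i * (1 / G))" by (intro summable_mult2 summable_wt)
  show "norm (wt i * erl i t) \<le> wt i * (1 / G)" for i
    unfolding real_norm_def abs_of_nonneg[OF mult_nonneg_nonneg[OF wt_bounds(1) erl_bounds(1)]]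
    by (intro mult_left_mono erl_bounds wt_bounds)
qed

lemma dens_nonneg: "0 \<le> dens t"
  unfolding dens_def by (intro suminf_nonneg summable_dens mult_nonneg_nonneg wt_bounds erl_bounds)

lemma measurable_dens[measurable]: "dens \<in> borel_measurable borel"
  unfolding dens_def[abs_def] by measurable

lemma ennreal_dens: "ennreal (dens t) = (\<Sum>i. ennreal (wt i) * ennreal (erl i t))"
  unfolding dens_def
  using suminf_ennreal2[OF mult_nonneg_nonneg[OF wt_bounds(1) erl_bounds(1)] summable_dens, of t]
  by (simp add: ennreal_mult wt_bounds erl_bounds)

text \<open>Outage probability, capacity and moment generating function differ in \<open>f\<close>
  only. The geometric bound on the absolute integrals, set against weights of at most
  \<open>x1 ^ i / fact i\<close>, justifies both the termwise integration of \<open>dens\<close> and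
  the use of \<open>S_series\<close>.\<close>

lemma dens_integral:
  fixes f :: "real \<Rightarrow> 'c :: {real_normed_field, banach, second_countable_topology}"
  assumes f[measurable]: "f \<in> borel_measurable borel"
    and int: "\<And>i. integrable lborel (\<lambda>t. erl i t *\<^sub>R f t)"
    and bound: "\<And>i. (\<integral>t. erl i t * norm (f t) \<partial>lborel) \<le> C * r ^ i"
    and X: "\<And>n m. m \<le> n \<Longrightarrow> Xnm n m = (\<integral>t. erl (n - m) t *\<^sub>R f t \<partial>lborel)"
  shows "integrable lborel (\<lambda>t. dens t *\<^sub>R f t)"
    "(\<integral>t. dens t *\<^sub>R f t \<partial>lborel) = S_sum N NR x1 x2 (alt_binom_sum Xnm)"
    "S_convergent N NR x1 x2 (alt_binom_sum Xnm)"
proof -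
  have n: "norm (\<integral>t. erl i t *\<^sub>R f t \<partial>lborel) \<le> C * r ^ i" for i
  proof -
    have "norm (\<integral>t. erl i t *\<^sub>R f t \<partial>lborel) \<le> (\<integral>t. norm (erl i t *\<^sub>R f t) \<partial>lborel)"
      by (rule integral_norm_bound)
    also have "\<dots> = (\<integral>t. erl i t * norm (f t) \<partial>lborel)" by (simp add: erl_bounds)
    finally show ?thesis using bound order_trans by blast
  qed
  note S = S_series[where Xnm=Xnm, OF n X]
  show "S_convergent N NR x1 x2 (alt_binom_sum Xnm)" by (rule S(2))
  have i2: "integrable lborel (\<lambda>t. wt i *\<^sub>R (erl i t *\<^sub>R f t))" for i
    by (intro integrable_scaleR_right int)
  have ae: "AE t in lborel. summable (\<lambda>i. norm (wt i *\<^sub>R (erl i t *\<^sub>R f t)))"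
  proof (rule AE_I2)
    fix t
    have "summable (\<lambda>i. wt i * erl i t * norm (f t))" by (intro summable_mult2 summable_dens)
    then show "summable (\<lambda>i. norm (wt i *\<^sub>R (erl i t *\<^sub>R f t)))"
      by (simp add: wt_bounds erl_bounds mult.assoc)
  qed
  have sm: "summable (\<lambda>i. \<integral>t. norm (wt i *\<^sub>R (erl i t *\<^sub>R f t)) \<partial>lborel)"
  proof (rule summable_comparison_test')
    show "summable (\<lambda>i. norm (wt i *\<^sub>R (C * r ^ i)))"
      by (rule summable_bound_exp[where C="\<bar>C\<bar>" and r="\<bar>r\<bar>" and y=x1]) (auto simp: wt_bounds abs_mult power_abs)
    fix i
    have "(\<integral>t. norm (wt i *\<^sub>R (erl i t *\<^sub>R f t)) \<partial>lborel) = wt i * (\<integral>t. erl i t * norm (f t) \<partial>lborel)"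
      by (simp add: wt_bounds erl_bounds mult.assoc)
    also have "\<dots> \<le> wt i * (C * r ^ i)" by (intro mult_left_mono bound wt_bounds)
    finally show "norm (\<integral>t. norm (wt i *\<^sub>R (erl i t *\<^sub>R f t)) \<partial>lborel) \<le> norm (wt i *\<^sub>R (C * r ^ i))"
      by (smt (verit) Bochner_Integration.integral_nonneg norm_ge_zero real_norm_def real_scaleR_def)
  qed
  have e: "(\<Sum>i. wt i *\<^sub>R (erl i t *\<^sub>R f t)) = dens t *\<^sub>R f t" for t
    unfolding dens_def using sums_scaleR_left[OF summable_sums[OF summable_dens[of t]], of "f t"]
    by (simp add: sums_iff)
  show "integrable lborel (\<lambda>t. dens t *\<^sub>R f t)"
    using integrable_suminf[OF i2 ae sm] by (simp only: e)
  have "(\<lambda>i. \<integral>t. wt i *\<^sub>R (erl i t *\<^sub>R f t) \<partial>lborel) sums (\<integral>t. dens t *\<^sub>R f t \<partial>lborel)"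
    using sums_integral[OF i2 ae sm] by (simp only: e)
  then have "(\<lambda>i. wt i *\<^sub>R (\<integral>t. erl i t *\<^sub>R f t \<partial>lborel)) sums (\<integral>t. dens t *\<^sub>R f t \<partial>lborel)"
    by (simp only: Bochner_Integration.integral_scaleR_right)
  then show "(\<integral>t. dens t *\<^sub>R f t \<partial>lborel) = S_sum N NR x1 x2 (alt_binom_sum Xnm)"
    using S(1) sums_unique2 by blast
qed

lemma integrable_erl: "integrable lborel (erl i)"
  using G unfolding erl_def by (intro integrable_erlang) auto

lemma dens_pointwise:
  assumes "t > 0"
  shows "S_convergent N NR x1 x2 (alt_binom_sum (p_nm N G t))" "dens t = S_sum N NR x1 x2 (alt_binom_sum (p_nm N G t))"
proof -
  have X: "p_nm N G t n m = erl (n - m) t" if "m \<le> n" for n m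
    using p_nm_eq_erlang[OF G N that] assms unfolding erl_def by simp
  have b: "norm (erl i t) \<le> 1 / G * 1 ^ i" for i using erl_bounds[of i t] by simp
  note S = S_series[where Xnm="p_nm N G t" and X="\<lambda>i. erl i t", OF b X]
  show "S_convergent N NR x1 x2 (alt_binom_sum (p_nm N G t))" by (rule S(2))
  show "dens t = S_sum N NR x1 x2 (alt_binom_sum (p_nm N G t))"
    unfolding dens_def using S(1) by (simp add: sums_iff)
qed

lemma dens_outage:
  shows "S_convergent N NR x1 x2 (alt_binom_sum (Po_nm N G \<tau>))" 
    "(LBINT t:{0..\<tau>}. dens t) = S_sum N NR x1 x2 (alt_binom_sum (Po_nm N G \<tau>))"
proof -
  define f where "f t = (indicator {0..\<tau>} t :: real)" for t
  have f[measurable]: "f \<in> borel_measurable borel" unfolding f_def by measurable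
  have int: "integrable lborel (\<lambda>t. erl i t *\<^sub>R f t)" for i
    by (rule Bochner_Integration.integrable_bound[OF integrable_erl[of i]]) (auto simp: f_def indicator_def)
  have b: "(\<integral>t. erl i t * norm (f t) \<partial>lborel) \<le> 1 * 1 ^ i" for i
  proof -
    have "(\<integral>t. erl i t * norm (f t) \<partial>lborel) \<le> (\<integral>t. erl i t \<partial>lborel)"
      using int[of i] by (intro integral_mono integrable_erl) (auto simp: f_def indicator_def erl_bounds)
    also have "\<dots> = 1" using G unfolding erl_def by (intro integral_erlang) simp
    finally show ?thesis by simp
  qed
  have X: "Po_nm N G \<tau> n m = (\<integral>t. erl (n - m) t *\<^sub>R f t \<partial>lborel)" if "m \<le> n" for n m
    unfolding Po_nm_def set_lebesgue_integral_def
    by (intro Bochner_Integration.integral_cong) (auto simp: f_def indicator_def erl_def p_nm_eq_erlang[OF G N that])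
  note D = dens_integral[where Xnm="Po_nm N G \<tau>", OF f int b X]
  show "S_convergent N NR x1 x2 (alt_binom_sum (Po_nm N G \<tau>))" by (rule D(3))
  have "(LBINT t:{0..\<tau>}. dens t) = (\<integral>t. dens t *\<^sub>R f t \<partial>lborel)"
    unfolding set_lebesgue_integral_def by (simp add: f_def mult.commute)
  then show "(LBINT t:{0..\<tau>}. dens t) = S_sum N NR x1 x2 (alt_binom_sum (Po_nm N G \<tau>))"
    using D(2) by simp
qed

text \<open>The mean of a gamma law, which dominates the capacity integral because
  \<open>ln (1 + t)\<close> is at most \<open>t\<close>.\<close>

lemma integral_erl_id: "integrable lborel (\<lambda>t. erl i t * t)" "(\<integral>t. erl i t * t \<partial>lborel) = (real N + real i) * G"
proof -
  have "(\<integral>\<^sup>+t. ennreal (erl i t * t ^ 1) \<partial>lborel) = ennreal (fact (N - 1 + i + 1) / (fact (N - 1 + i) * (1 / G) ^ 1))"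
    using nn_integral_erlang_ith_moment[of "1 / G" "N - 1 + i" 1] G unfolding erl_def by simp
  moreover have "fact (N - 1 + i + 1) / (fact (N - 1 + i) * (1 / G) ^ 1) = (real N + real i) * G"
    using N G by (cases N) (auto simp: field_simps)
  ultimately have e: "(\<integral>\<^sup>+t. ennreal (erl i t * t) \<partial>lborel) = ennreal ((real N + real i) * G)"
    by (simp only: power_one_right)
  have "0 \<le> erl i t * t" for t
    using G by (cases "t < 0") (auto simp: erl_def erlang_density_def)
  then have "has_bochner_integral lborel (\<lambda>t. erl i t * t) ((real N + real i) * G)"
    using G e by (intro has_bochner_integral_nn_integral) auto
  then show "integrable lborel (\<lambda>t. erl i t * t)" "(\<integral>t. erl i t * t \<partial>lborel) = (real N + real i) * G"
    by (auto simp: has_bochner_integral_iff)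
qed

lemma dens_capacity:
  shows "S_convergent N NR x1 x2 (alt_binom_sum (C_nm N G))" 
    "1 / ln 2 * (LBINT t:{0..}. ln (1 + t) * dens t) = S_sum N NR x1 x2 (alt_binom_sum (C_nm N G))"
    "set_integrable lborel {0..} (\<lambda>t. ln (1 + t) * dens t)"
proof -
  define f where "f t = 1 / ln 2 * (indicator {0..} t * ln (1 + t))" for t :: real
  have f[measurable]: "f \<in> borel_measurable borel" unfolding f_def by measurable
  have f0: "0 \<le> f t" "f t \<le> 1 / ln 2 * \<bar>t\<bar>" for t
    unfolding f_def by (auto simp: indicator_def ln_add_one_self_le_self divide_right_mono)
  have cf: "\<bar>erl i t * f t\<bar> \<le> 1 / ln 2 * (erl i t * t)" for i t
  proof (cases "t < 0")
    case False
    then have "erl i t * f t \<le> erl i t * (1 / ln 2 * t)"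
      using f0(2)[of t] by (intro mult_left_mono erl_bounds) auto
    then show ?thesis using f0[of t] erl_bounds[of i t] by (simp add: abs_mult mult_ac)
  qed (simp add: erl_def erlang_density_def)
  have int: "integrable lborel (\<lambda>t. erl i t *\<^sub>R f t)" for i
  proof (rule Bochner_Integration.integrable_bound)
    show "integrable lborel (\<lambda>t. 1 / ln 2 * (erl i t * t))" by (intro integrable_mult_right integral_erl_id)
    show "AE t in lborel. norm (erl i t *\<^sub>R f t) \<le> norm (1 / ln 2 * (erl i t * t))"
    proof (rule AE_I2)
      fix t
      show "norm (erl i t *\<^sub>R f t) \<le> norm (1 / ln 2 * (erl i t * t))"
        using cf[of i t] unfolding real_norm_def real_scaleR_def by linarith
    qed
  qed measurable
  have b: "(\<integral>t. erl i t * norm (f t) \<partial>lborel) \<le> real N * G / ln 2 * 2 ^ i" for i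
  proof -
    have "(\<integral>t. erl i t * norm (f t) \<partial>lborel) \<le> (\<integral>t. 1 / ln 2 * (erl i t * t) \<partial>lborel)"
    proof (rule integral_mono)
      show "integrable lborel (\<lambda>t. erl i t * norm (f t))" using int[of i] f0 by simp
      show "integrable lborel (\<lambda>t. 1 / ln 2 * (erl i t * t))" by (intro integrable_mult_right integral_erl_id)
      show "erl i t * norm (f t) \<le> 1 / ln 2 * (erl i t * t)" for t
        using cf[of i t] f0[of t] by simp
    qed
    also have "\<dots> = 1 / ln 2 * ((real N + real i) * G)" by (subst integral_mult_right_zero) (simp only: integral_erl_id)
    \<comment> \<open>The mean grows linearly in \<open>i\<close>; this puts it into the geometric
      form that \<open>dens_integral\<close> asks for.\<close>
    also have "\<dots> \<le> 1 / ln 2 * ((real N * 2 ^ i) * G)"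
    proof -
      have "Suc i \<le> 2 ^ i" by (induction i) auto
      then have "N * Suc i \<le> N * 2 ^ i" by (rule mult_le_mono2)
      moreover have "N + i \<le> N * Suc i" using N by (cases N) auto
      ultimately have "real (N + i) \<le> real (N * 2 ^ i)" unfolding of_nat_le_iff by linarith
      then show ?thesis using G by (intro mult_left_mono mult_right_mono) auto
    qed
    finally show ?thesis by (simp add: mult_ac)
  qed
  have X: "C_nm N G n m = (\<integral>t. erl (n - m) t *\<^sub>R f t \<partial>lborel)" if "m \<le> n" for n m
    unfolding C_nm_def set_lebesgue_integral_def integral_mult_right_zero[symmetric]
    by (intro Bochner_Integration.integral_cong) (auto simp: f_def indicator_def erl_def p_nm_eq_erlang[OF G N that])
  note D = dens_integral[where Xnm="C_nm N G", OF f int b X]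
  show "S_convergent N NR x1 x2 (alt_binom_sum (C_nm N G))" by (rule D(3))
  have "1 / ln 2 * (LBINT t:{0..}. ln (1 + t) * dens t) = (\<integral>t. dens t *\<^sub>R f t \<partial>lborel)"
    unfolding set_lebesgue_integral_def integral_mult_right_zero[symmetric]
    by (intro Bochner_Integration.integral_cong) (auto simp: f_def mult_ac)
  then show "1 / ln 2 * (LBINT t:{0..}. ln (1 + t) * dens t) = S_sum N NR x1 x2 (alt_binom_sum (C_nm N G))"
    using D(2) by simp
  have "integrable lborel (\<lambda>t. ln 2 * (dens t *\<^sub>R f t))" by (intro integrable_mult_right D(1))
  moreover have "ln 2 * (dens t *\<^sub>R f t) = indicator {0..} t *\<^sub>R (ln (1 + t) * dens t)" for t
    by (simp add: f_def)
  ultimately show "set_integrable lborel {0..} (\<lambda>t. ln (1 + t) * dens t)"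
    unfolding set_integrable_def by (simp only:)
qed

lemma dens_mgf:
  fixes s :: complex
  assumes s: "Re s < 1 / G"
  shows "S_convergent N NR x1 x2 (alt_binom_sum (M_nm N G s))" 
    "(\<integral>t. dens t *\<^sub>R exp (s * of_real t) \<partial>lborel) = S_sum N NR x1 x2 (alt_binom_sum (M_nm N G s))"
    "integrable lborel (\<lambda>t. dens t *\<^sub>R exp (s * of_real t))"
proof -
  define \<rho> where "\<rho> = Re s"
  \<comment> \<open>The moment generating function of the exponential law of rate
    \<open>1 / G\<close>, taken at \<open>Re s\<close>. It exceeds 1 for \<open>Re s > 0\<close>, so
    here the bounds in \<open>dens_integral\<close> genuinely grow with \<open>i\<close>.\<close>
  define u where "u = (1 / G) / (1 / G - \<rho>)"
  have l: "1 / G > 0" "1 / G - \<rho> > 0" using G s by (auto simp: \<rho>_def)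
  have e: "erl i t * norm (exp (s * of_real t)) = u ^ Suc (N - 1 + i) * erlang_density (N - 1 + i) (1 / G - \<rho>) t" for i t
    using erlang_density_tilt[of "1 / G" \<rho> "N - 1 + i" t] l by (simp add: erl_def \<rho>_def u_def)
  have f: "(\<lambda>t. exp (s * complex_of_real t)) \<in> borel_measurable borel" by measurable
  have i0: "integrable lborel (\<lambda>t. erl i t * norm (exp (s * of_real t)))" for i
    unfolding e using integrable_erlang[OF l(2)] by (intro integrable_mult_right)
  have int: "integrable lborel (\<lambda>t. erl i t *\<^sub>R exp (s * of_real t))" for i
    by (rule Bochner_Integration.integrable_bound[OF i0[of i]]) (auto simp: erl_bounds)
  have b: "(\<integral>t. erl i t * norm (exp (s * of_real t)) \<partial>lborel) \<le> u ^ N * u ^ i" for i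
  proof -
    have "Suc (N - 1 + i) = N + i" using N by simp
    then show ?thesis unfolding e using integral_erlang[OF l(2)] by (simp add: power_add)
  qed
  have X: "M_nm N G s n m = (\<integral>t. erl (n - m) t *\<^sub>R exp (s * of_real t) \<partial>lborel)" if "m \<le> n" for n m
  proof -
    have "N + n - m = Suc (N - 1 + (n - m))" using N that by simp
    then show ?thesis unfolding M_nm_def erl_def erlang_mgf[OF G s] by simp
  qed
  note D = dens_integral[where Xnm="M_nm N G s", OF f int b X]
  show "S_convergent N NR x1 x2 (alt_binom_sum (M_nm N G s))" by (rule D(3))
  show "(\<integral>t. dens t *\<^sub>R exp (s * of_real t) \<partial>lborel) = S_sum N NR x1 x2 (alt_binom_sum (M_nm N G s))"
    by (rule D(2))
  show "integrable lborel (\<lambda>t. dens t *\<^sub>R exp (s * of_real t))"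
    by (rule D(1))
qed

text \<open>\<open>law\<close> describes the unscaled residual with rate 1; the substitution
  \<open>G * t\<close> changes the rate to \<open>1 / G\<close>.\<close>

lemma distributed_dens:
  assumes \<gamma>[measurable]: "\<gamma> \<in> borel_measurable M"
    and law: "\<And>F. F \<in> borel_measurable borel \<Longrightarrow> (\<integral>\<^sup>+\<omega>. F (\<gamma> \<omega>) \<partial>M)
      = (\<Sum>i. (\<integral>\<^sup>+\<omega>. ennreal (pois (x1 * \<beta> \<omega>) i) \<partial>Q) * (\<integral>\<^sup>+t. F (G * t) * ennreal (erlang_density (N - 1 + i) 1 t) \<partial>lborel))"
  shows "distributed M lborel \<gamma> (\<lambda>t. ennreal (dens t))"
  unfolding distributed_def
proof (intro conjI)
  have sc: "(\<integral>\<^sup>+t. F (G * t) * ennreal (erlang_density k 1 t) \<partial>lborel) = (\<integral>\<^sup>+t. F t * ennreal (erlang_density k (1 / G) t) \<partial>lborel)"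
    if [measurable]: "F \<in> borel_measurable borel" for F k
  proof -
    have e: "ennreal \<bar>G\<bar> * (F (0 + G * t) * ennreal (erlang_density k (1 / G) (0 + G * t))) = F (G * t) * ennreal (erlang_density k 1 t)" for t
    proof -
      have "G * erlang_density k (1 / G) (G * t) = erlang_density k 1 t"
        using G by (simp add: erlang_density_def mult_less_0_iff power_divide power_mult_distrib field_simps)
      then have "ennreal G * ennreal (erlang_density k (1 / G) (G * t)) = ennreal (erlang_density k 1 t)"
        using G by (simp add: ennreal_mult[symmetric])
      then show ?thesis using G by (simp add: mult.left_commute[of "ennreal G"])
    qed
    have "(\<integral>\<^sup>+t. F t * ennreal (erlang_density k (1 / G) t) \<partial>lborel)
      = ennreal \<bar>G\<bar> * (\<integral>\<^sup>+t. F (0 + G * t) * ennreal (erlang_density k (1 / G) (0 + G * t)) \<partial>lborel)"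
      using G by (intro nn_integral_real_affine) auto
    also have "\<dots> = (\<integral>\<^sup>+t. F (G * t) * ennreal (erlang_density k 1 t) \<partial>lborel)"
      unfolding e[symmetric] by (rule nn_integral_cmult[symmetric]) measurable
    finally show ?thesis by simp
  qed
  show "distr M lborel \<gamma> = density lborel (\<lambda>t. ennreal (dens t))"
  proof (rule measure_eqI)
    fix A assume "A \<in> sets (distr M lborel \<gamma>)"
    then have A[measurable]: "A \<in> sets borel" by simp
    have "emeasure (distr M lborel \<gamma>) A = (\<integral>\<^sup>+\<omega>. indicator A (\<gamma> \<omega>) \<partial>M)"
      by (simp add: nn_integral_distr flip: nn_integral_indicator)
    also have "\<dots> = (\<Sum>i. ennreal (wt i) * (\<integral>\<^sup>+t. indicator A t * ennreal (erl i t) \<partial>lborel))"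
      by (subst law) (simp_all add: sc ennreal_wt erl_def)
    also have "\<dots> = (\<Sum>i. \<integral>\<^sup>+t. ennreal (wt i) * (indicator A t * ennreal (erl i t)) \<partial>lborel)"
      by (intro suminf_cong nn_integral_cmult[symmetric]) measurable
    also have "\<dots> = (\<integral>\<^sup>+t. (\<Sum>i. ennreal (wt i) * (indicator A t * ennreal (erl i t))) \<partial>lborel)"
      by (rule nn_integral_suminf[symmetric]) measurable
    also have "\<dots> = (\<integral>\<^sup>+t. ennreal (dens t) * indicator A t \<partial>lborel)"
      unfolding ennreal_dens ennreal_suminf_multc[symmetric] by (simp add: mult_ac)
    also have "\<dots> = emeasure (density lborel (\<lambda>t. ennreal (dens t))) A"
      by (simp add: emeasure_density)
    finally show "emeasure (distr M lborel \<gamma>) A = emeasure (density lborel (\<lambda>t. ennreal (dens t))) A" .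
  qed simp
qed simp_all

lemma distributed_mgf:
  fixes s :: complex
  assumes d: "distributed M lborel \<gamma> (\<lambda>t. ennreal (dens t))" and s: "Re s < 1 / G"
  shows "integrable M (\<lambda>\<omega>. exp (s * complex_of_real (\<gamma> \<omega>)))"
    "(\<integral>\<omega>. exp (s * complex_of_real (\<gamma> \<omega>)) \<partial>M) = S_sum N NR x1 x2 (alt_binom_sum (M_nm N G s))"
proof -
  have dist: "distr M lborel \<gamma> = density lborel (\<lambda>t. ennreal (dens t))" and [measurable]: "\<gamma> \<in> borel_measurable M"
    using d by (auto simp: distributed_def)
  have m: "(\<lambda>t. exp (s * complex_of_real t)) \<in> borel_measurable lborel" by measurable
  have i: "integrable (distr M lborel \<gamma>) (\<lambda>t. exp (s * complex_of_real t))"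
    unfolding dist using dens_mgf(3)[OF s] m by (subst integrable_density) (auto simp: dens_nonneg)
  show "integrable M (\<lambda>\<omega>. exp (s * complex_of_real (\<gamma> \<omega>)))"
    using i m by (subst (asm) integrable_distr_eq) auto
  have "(\<integral>\<omega>. exp (s * complex_of_real (\<gamma> \<omega>)) \<partial>M) = (\<integral>t. exp (s * complex_of_real t) \<partial>distr M lborel \<gamma>)"
    using m by (subst integral_distr) auto
  also have "\<dots> = (\<integral>t. dens t *\<^sub>R exp (s * of_real t) \<partial>lborel)"
    unfolding dist using m by (subst integral_density) (auto simp: dens_nonneg)
  finally show "(\<integral>\<omega>. exp (s * complex_of_real (\<gamma> \<omega>)) \<partial>M) = S_sum N NR x1 x2 (alt_binom_sum (M_nm N G s))"
    unfolding dens_mgf(2)[OF s] .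
qed

end

subsection \<open>Rotating the rows of a Gaussian matrix\<close>

lemma rot_local:
  assumes "rot I T" "\<forall>i\<in>I. x i = y i"
  shows "\<forall>i\<in>I. T x i = T y i"
  using assms by (induction rule: rot.induct) (auto simp: givens_def)

text \<open>Rotating two columns of a matrix means rotating the entries \<open>(r, p)\<close> and
  \<open>(r, q)\<close> in each row \<open>r\<close>; the induction treats one more row at a
  time.\<close>

lemma rot_rows_givens:
  fixes n k p q R :: nat
  assumes "p < k" "q < k" "p \<noteq> q" "(cmod c)\<^sup>2 + (cmod s)\<^sup>2 = 1" "R \<le> n"
  shows "\<exists>U. rot ({..<n} \<times> {..<k}) U \<and>
    (\<forall>x r j. U x (r, j) = (if r < R then givens p q c s (\<lambda>j. x (r, j)) j else x (r, j)))"
  using assms(5)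
proof (induction R)
  case 0
  then show ?case using rot_id by auto
next
  case (Suc R)
  then obtain U where U: "rot ({..<n} \<times> {..<k}) U"
    "\<And>x r j. U x (r, j) = (if r < R then givens p q c s (\<lambda>j. x (r, j)) j else x (r, j))"
    by auto
  have "rot ({..<n} \<times> {..<k}) (\<lambda>x. givens (R, p) (R, q) c s (U x))"
    using assms Suc.prems by (intro rot_givens U) auto
  moreover have "givens (R, p) (R, q) c s (U x) (r, j) = (if r < Suc R then givens p q c s (\<lambda>j. x (r, j)) j else x (r, j))" for x r j
    using assms(3) by (auto simp: givens_def U(2) less_Suc_eq)
  ultimately show ?case by blast
qed

lemma rot_rows:
  fixes n k :: nat
  assumes "rot {..<k} T"
  shows "\<exists>U. rot ({..<n} \<times> {..<k}) U \<and> (\<forall>x r j. r < n \<longrightarrow> U x (r, j) = T (\<lambda>j. x (r, j)) j)"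
  using assms
proof (induction rule: rot.induct)
  case rot_id
  then show ?case using rot.rot_id by auto
next
  case (rot_givens T p q c s)
  then obtain U where U: "rot ({..<n} \<times> {..<k}) U" "\<And>x r j. r < n \<Longrightarrow> U x (r, j) = T (\<lambda>j. x (r, j)) j" by blast
  obtain V where V: "rot ({..<n} \<times> {..<k}) V"
    "\<And>x r j. V x (r, j) = (if r < n then givens p q c s (\<lambda>j. x (r, j)) j else x (r, j))"
    using rot_rows_givens[of p k q c s n n] rot_givens by auto
  have "V (U x) (r, j) = givens p q c s (T (\<lambda>j. x (r, j))) j" if "r < n" for x r j
  proof -
    have "(\<lambda>j. U x (r, j)) = T (\<lambda>j. x (r, j))" using U(2)[OF that] by (simp add: fun_eq_iff)
    then show ?thesis using that by (simp add: V(2))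
  qed
  then show ?case using rot_comp[OF V(1) U(1)] by blast
qed

text \<open>Different columns depend on disjoint blocks of independent entries, hence are
  independent, and each is a Gaussian vector by reindexing.\<close>

lemma distr_CG_columns:
  assumes k: "k > 0" "n > 0"
  shows "distr (CG ({..<n} \<times> {..<k})) (CM n k) (\<lambda>x. \<lambda>j\<in>{..<k}. \<lambda>i\<in>{..<n}. x (i, j)) = CM n k"
proof -
  let ?I = "{..<n} \<times> {..<k}"
  let ?Q = "CG ?I"
  interpret prob_space ?Q by (rule prob_space_CG)
  have d1: "distr ?Q cgauss (\<lambda>x. x p) = cgauss" if "p \<in> ?I" for p
    by (rule distr_PiM_component) (use that prob_space_cgauss in auto)
  have ind: "indep_vars (\<lambda>_. cgauss) (\<lambda>p x. x p) ?I"
  proof -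
    have "distr ?Q ?Q (\<lambda>x. \<lambda>i\<in>?I. x i) = distr ?Q ?Q (\<lambda>x. x)"
      by (rule distr_cong) (auto simp: space_PiM PiE_def extensional_restrict)
    also have "\<dots> = ?Q" by simp
    also have "\<dots> = PiM ?I (\<lambda>p. distr ?Q cgauss (\<lambda>x. x p))"
      by (intro PiM_cong) (simp_all add: d1)
    finally show ?thesis
      using k by (subst indep_vars_iff_distr_eq_PiM') auto
  qed
  define K where "K j = {..<n} \<times> {j}" for j :: nat
  have ind1: "indep_vars (\<lambda>j. PiM (K j) (\<lambda>_. cgauss)) (\<lambda>j x. restrict (\<lambda>p. x p) (K j)) {..<k}"
    by (rule indep_vars_restrict[OF ind]) (auto simp: K_def disjoint_family_on_def)
  have m: "(\<lambda>y. \<lambda>i\<in>{..<n}. y (i, j)) \<in> measurable (PiM (K j) (\<lambda>_. cgauss)) (CG {..<n})" for j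
    by (intro measurable_restrict measurable_component_singleton) (auto simp: K_def)
  have "indep_vars (\<lambda>j. CG {..<n}) (\<lambda>j x. (\<lambda>i\<in>{..<n}. (restrict (\<lambda>p. x p) (K j)) (i, j))) {..<k}"
    by (rule indep_vars_compose2[OF ind1]) (rule m)
  moreover have "(\<lambda>i\<in>{..<n}. (restrict (\<lambda>p. x p) (K j)) (i, j)) = (\<lambda>i\<in>{..<n}. x (i, j))" for x :: "nat \<times> nat \<Rightarrow> complex" and j
    by (auto simp: K_def restrict_def)
  ultimately have ind2: "indep_vars (\<lambda>j. CG {..<n}) (\<lambda>j x. (\<lambda>i\<in>{..<n}. x (i, j))) {..<k}" by simp
  have d2: "distr ?Q (CG {..<n}) (\<lambda>x. \<lambda>i\<in>{..<n}. x (i, j)) = CG {..<n}" if "j < k" for j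
    using distr_PiM_reindex[of ?I "\<lambda>_. cgauss" "\<lambda>i. (i, j)" "{..<n}"] that
    by (auto simp: prob_space_cgauss inj_on_def)
  have "distr ?Q (PiM {..<k} (\<lambda>j. CG {..<n})) (\<lambda>x. \<lambda>j\<in>{..<k}. \<lambda>i\<in>{..<n}. x (i, j))
      = PiM {..<k} (\<lambda>j. distr ?Q (CG {..<n}) (\<lambda>x. \<lambda>i\<in>{..<n}. x (i, j)))"
    using ind2 k by (subst (asm) indep_vars_iff_distr_eq_PiM') (auto simp: indep_vars_def)
  also have "\<dots> = CM n k" by (intro PiM_cong) (simp_all add: d2)
  finally show ?thesis .
qed

lemma measurable_CG_columns:
  "(\<lambda>x. \<lambda>j\<in>{..<k}. \<lambda>i\<in>{..<n}. x (i, j)) \<in> measurable (CG ({..<n} \<times> {..<k})) (CM n k)"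
  by (intro measurable_restrict measurable_component_singleton) auto

text \<open>For a rotation \<open>T\<close> these are the columns of \<open>W\<close> multiplied by
  a unitary matrix on the right; the index order, column before row, is that of
  \<open>CM\<close>.\<close>

definition rotated_cols :: "nat \<Rightarrow> nat \<Rightarrow> ((nat \<Rightarrow> complex) \<Rightarrow> nat \<Rightarrow> complex) \<Rightarrow> complex mat \<Rightarrow> nat \<Rightarrow> nat \<Rightarrow> complex" where
  "rotated_cols n k T W = (\<lambda>j\<in>{..<k}. \<lambda>i\<in>{..<n}. T (\<lambda>j. W $$ (i, j)) j)"

text \<open>Applying \<open>T\<close> to every row is a single rotation of the array of all entries,
  under which the Gaussian measure is invariant.\<close>

lemma distr_rotated_cols:
  assumes M: "prob_space M" and W: "iid_std_complex_normal_mat M n k W" and k: "k > 0" "n > 0" and T: "rot {..<k} T"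
  shows "(\<lambda>\<omega>. rotated_cols n k T (W \<omega>)) \<in> measurable M (CM n k)"
    "distr M (CM n k) (\<lambda>\<omega>. rotated_cols n k T (W \<omega>)) = CM n k"
proof -
  interpret prob_space M by fact
  let ?I = "{..<n} \<times> {..<k}"
  define X where "X p \<omega> = W \<omega> $$ p" for p \<omega>
  have ind: "indep_vars (\<lambda>_. borel) X ?I"
  proof -
    have "(\<lambda>(i,j) \<omega>. W \<omega> $$ (i,j)) = X" by (auto simp: X_def fun_eq_iff)
    then show ?thesis using W by (simp add: iid_std_complex_normal_mat_def)
  qed
  have dX: "distr M borel (X p) = cgauss" and mX: "X p \<in> borel_measurable M" if p: "p \<in> ?I" for p
  proof -
    obtain i j where "p = (i, j)" "i < n" "j < k" using p by auto
    then have "distributed M lborel (X p) (\<lambda>z. ennreal (exp (- (cmod z)\<^sup>2) / pi))"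
      using W by (simp add: iid_std_complex_normal_mat_def std_complex_normal_def X_def[abs_def])
    then show "distr M borel (X p) = cgauss" "X p \<in> borel_measurable M"
      unfolding cgauss_def distributed_def by (auto cong: distr_cong)
  qed
  have mR: "(\<lambda>\<omega>. \<lambda>p\<in>?I. X p \<omega>) \<in> measurable M (CG ?I)"
    using mX by (intro measurable_restrict) (simp add: measurable_cong_sets[OF refl sets_cgauss])
  have dR: "distr M (CG ?I) (\<lambda>\<omega>. \<lambda>p\<in>?I. X p \<omega>) = CG ?I"
  proof -
    have "distr M (CG ?I) (\<lambda>\<omega>. \<lambda>p\<in>?I. X p \<omega>) = distr M (PiM ?I (\<lambda>_. borel)) (\<lambda>\<omega>. \<lambda>p\<in>?I. X p \<omega>)"
      by (rule distr_cong) (auto intro!: sets_PiM_cong)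
    also have "\<dots> = PiM ?I (\<lambda>p. distr M borel (X p))"
      using ind mX k by (subst (asm) indep_vars_iff_distr_eq_PiM') auto
    also have "\<dots> = CG ?I" by (intro PiM_cong) (simp_all add: dX)
    finally show ?thesis .
  qed
  obtain U where U: "rot ?I U" "\<And>x r j. r < n \<Longrightarrow> U x (r, j) = T (\<lambda>j. x (r, j)) j"
    using rot_rows[OF T] by blast
  let ?C = "\<lambda>x. \<lambda>j\<in>{..<k}. \<lambda>i\<in>{..<n}. x (i, j)"
  have e: "rotated_cols n k T (W \<omega>) = ?C (U (\<lambda>p\<in>?I. X p \<omega>))" for \<omega>
  proof -
    have "T (\<lambda>j. W \<omega> $$ (i, j)) j = T (\<lambda>j. (\<lambda>p\<in>?I. X p \<omega>) (i, j)) j" if "i < n" "j < k" for i j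
      using rot_local[OF T, of "\<lambda>j. W \<omega> $$ (i, j)" "\<lambda>j. (\<lambda>p\<in>?I. X p \<omega>) (i, j)"] that by (auto simp: X_def)
    then show ?thesis by (auto simp: rotated_cols_def U(2) fun_eq_iff restrict_def)
  qed
  have mU: "(\<lambda>\<omega>. U (\<lambda>p\<in>?I. X p \<omega>)) \<in> measurable M (CG ?I)"
    by (rule measurable_compose[OF mR measurable_rot[OF U(1)]])
  show "(\<lambda>\<omega>. rotated_cols n k T (W \<omega>)) \<in> measurable M (CM n k)"
    unfolding e by (rule measurable_compose[OF mU measurable_CG_columns])
  have "distr M (CM n k) (\<lambda>\<omega>. rotated_cols n k T (W \<omega>)) = distr (distr (distr M (CG ?I) (\<lambda>\<omega>. \<lambda>p\<in>?I. X p \<omega>)) (CG ?I) U) (CM n k) ?C"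
    unfolding e using mR measurable_rot[OF U(1)] measurable_CG_columns
    by (subst distr_distr, simp, simp, subst distr_distr, simp, simp, simp add: comp_def)
  also have "\<dots> = CM n k"
    unfolding dR by (subst distr_rot[OF U(1)]) (simp_all add: distr_CG_columns k)
  finally show "distr M (CM n k) (\<lambda>\<omega>. rotated_cols n k T (W \<omega>)) = CM n k" .
qed

subsection \<open>Hermitian matrices\<close>

no_notation Finite_Cartesian_Product.vec_nth (infixl "$" 90)
no_notation inner (infix "\<bullet>" 70)

lemma mat_adjoint_carrier[simp]: "A \<in> carrier_mat n m \<Longrightarrow> mat_adjoint A \<in> carrier_mat m n"
  by (auto simp: mat_adjoint_def)

lemma dim_mat_adjoint[simp]: "dim_row (mat_adjoint A) = dim_col A" "dim_col (mat_adjoint A) = dim_row A"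
  by (auto simp: mat_adjoint_def)

lemma mat_adjoint_index[simp]:
  "i < dim_col A \<Longrightarrow> j < dim_row A \<Longrightarrow> mat_adjoint A $$ (i, j) = cnj (A $$ (j, i))"
  by (simp add: mat_adjoint_def mat_of_rows_index conjugate_complex_def)

lemma mat_adjoint_adjoint[simp]: "mat_adjoint (mat_adjoint (A :: complex mat)) = A"
  by (rule eq_matI) auto

lemma mat_mult_index: "i < dim_row A \<Longrightarrow> j < dim_col B \<Longrightarrow> dim_row B = dim_col A \<Longrightarrow>
   (A * B) $$ (i, j) = (\<Sum>l<dim_col A. A $$ (i, l) * B $$ (l, j))"
  by (simp add: scalar_prod_def atLeast0LessThan)

lemma mat_adjoint_mult:
  fixes A B :: "complex mat"
  assumes "A \<in> carrier_mat n m" "B \<in> carrier_mat m k"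
  shows "mat_adjoint (A * B) = mat_adjoint B * mat_adjoint A"
proof (rule eq_matI)
  fix i j assume "i < dim_row (mat_adjoint B * mat_adjoint A)" "j < dim_col (mat_adjoint B * mat_adjoint A)"
  then have ij: "i < k" "j < n" using assms by auto
  show "mat_adjoint (A * B) $$ (i, j) = (mat_adjoint B * mat_adjoint A) $$ (i, j)"
    using assms ij by (simp add: scalar_prod_def mult.commute)
qed (use assms in auto)

lemma cscalar_ip: "dim_vec v = n \<Longrightarrow> dim_vec w = n \<Longrightarrow> v \<bullet>c w = ip {..<n} (($) v) (($) w)"
  by (simp add: scalar_prod_def ip_def atLeast0LessThan conjugate_complex_def)

lemma adjoint_cscalar:
  fixes A :: "complex mat"
  assumes A: "A \<in> carrier_mat n m" and v: "v \<in> carrier_vec m" and w: "w \<in> carrier_vec n"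
  shows "(A *\<^sub>v v) \<bullet>c w = v \<bullet>c (mat_adjoint A *\<^sub>v w)"
proof -
  have "(A *\<^sub>v v) \<bullet>c w = (\<Sum>i<n. \<Sum>j<m. A $$ (i, j) * v $ j * cnj (w $ i))"
    using assms by (simp add: scalar_prod_def atLeast0LessThan sum_distrib_right conjugate_complex_def)
  also have "\<dots> = (\<Sum>j<m. \<Sum>i<n. A $$ (i, j) * v $ j * cnj (w $ i))" by (rule sum.swap)
  also have "\<dots> = v \<bullet>c (mat_adjoint A *\<^sub>v w)"
    using assms by (simp add: scalar_prod_def atLeast0LessThan sum_distrib_left conjugate_complex_def mult_ac)
  finally show ?thesis .
qed

lemma cscalar_self: "dim_vec v = n \<Longrightarrow> v \<bullet>c v = complex_of_real (\<Sum>i<n. (cmod (v $ i))\<^sup>2)"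
  by (simp only: cscalar_ip ip_self)

lemma cscalar_self_eq_0: "v \<in> carrier_vec n \<Longrightarrow> v \<bullet>c v = 0 \<longleftrightarrow> v = (0\<^sub>v n :: complex vec)"
  by (auto simp: cscalar_ip[of v n v] ip_self_eq_0_iff)

lemma trace_comm:
  fixes A B :: "complex mat"
  assumes "A \<in> carrier_mat n m" "B \<in> carrier_mat m n"
  shows "(\<Sum>i<n. (A * B) $$ (i, i)) = (\<Sum>i<m. (B * A) $$ (i, i))"
proof -
  have "(\<Sum>i<n. (A * B) $$ (i, i)) = (\<Sum>i<n. \<Sum>l<m. A $$ (i, l) * B $$ (l, i))"
    using assms by (simp add: scalar_prod_def atLeast0LessThan)
  also have "\<dots> = (\<Sum>l<m. \<Sum>i<n. B $$ (l, i) * A $$ (i, l))" by (subst sum.swap) (simp add: mult.commute)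
  also have "\<dots> = (\<Sum>i<m. (B * A) $$ (i, i))"
    using assms by (simp add: scalar_prod_def atLeast0LessThan)
  finally show ?thesis .
qed

text \<open>The form of \<open>S\<close> at \<open>w - t * S w\<close> equals
  \<open>- 2 * t * r + t^2 * c\<close> with \<open>r = |S w|^2\<close>. For small positive
  \<open>t\<close> this would be negative if \<open>r\<close> were positive.\<close>

lemma psd_kernel:
  assumes S: "hermitian_pos_semidef n S" and w: "w \<in> carrier_vec n" and z: "Re ((S *\<^sub>v w) \<bullet>c w) = 0"
  shows "S *\<^sub>v w = 0\<^sub>v n"
proof -
  have Sc: "S \<in> carrier_mat n n" and Sh: "mat_adjoint S = S" using S by (auto simp: hermitian_pos_semidef_def hermitian_mat_def)
  define v where "v = S *\<^sub>v w"
  have v: "v \<in> carrier_vec n" using Sc w by (simp add: v_def)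
  define r where "r = (\<Sum>i<n. (cmod (v $ i))\<^sup>2)"
  define c where "c = Re ((S *\<^sub>v v) \<bullet>c v)"
  have vv: "v \<bullet>c v = of_real r" using v by (simp only: r_def cscalar_self carrier_vecD)
  have wSv: "(S *\<^sub>v v) \<bullet>c w = of_real r"
    unfolding adjoint_cscalar[OF Sc v w] Sh v_def[symmetric] vv ..
  have q: "0 \<le> - 2 * t * r + t\<^sup>2 * c" for t :: real
  proof -
    define x where "x = w + (- of_real t) \<cdot>\<^sub>v v"
    have x: "x \<in> carrier_vec n" using w v by (simp add: x_def)
    have "S *\<^sub>v x = v + (- of_real t) \<cdot>\<^sub>v (S *\<^sub>v v)"
      unfolding x_def v_def using Sc w v
      by (simp add: mult_add_distrib_mat_vec[of _ n n] mult_mat_vec[of _ n n])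
    then have Sx: "(S *\<^sub>v x) $ i = v $ i - of_real t * (S *\<^sub>v v) $ i" if "i < n" for i
      using that v Sc by simp
    have xi: "x $ i = w $ i - of_real t * v $ i" if "i < n" for i using that w v by (simp add: x_def)
    have "(S *\<^sub>v x) \<bullet>c x = ip {..<n} (\<lambda>i. v $ i - of_real t * (S *\<^sub>v v) $ i) (\<lambda>i. w $ i - of_real t * v $ i)"
      using Sc x Sx xi by (subst cscalar_ip[of _ n]) (auto intro!: ip_cong)
    also have "\<dots> = (v \<bullet>c w - of_real t * (v \<bullet>c v)) - of_real t * ((S *\<^sub>v v) \<bullet>c w - of_real t * ((S *\<^sub>v v) \<bullet>c v))"
      using Sc v w by (simp add: cscalar_ip[of _ n] ip_diff_left ip_diff_right algebra_simps)
    finally have e: "(S *\<^sub>v x) \<bullet>c x = (v \<bullet>c w - of_real t * (v \<bullet>c v)) - of_real t * ((S *\<^sub>v v) \<bullet>c w - of_real t * ((S *\<^sub>v v) \<bullet>c v))" .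
    have "0 \<le> Re ((S *\<^sub>v x) \<bullet>c x)" using S x by (auto simp: hermitian_pos_semidef_def)
    also have "Re ((S *\<^sub>v x) \<bullet>c x) = - 2 * t * r + t\<^sup>2 * c"
      unfolding e wSv vv using z by (simp add: v_def[symmetric] c_def power2_eq_square algebra_simps)
    finally show ?thesis .
  qed
  have r0: "r \<ge> 0" by (simp add: r_def sum_nonneg)
  have "r = 0"
  proof (rule ccontr)
    assume "r \<noteq> 0"
    then have r: "r > 0" using r0 by simp
    \<comment> \<open>Small enough for \<open>t * c \<le> r\<close>, so that the form is at most
      \<open>- t * r\<close>; the 1 covers \<open>c = 0\<close>.\<close>
    define t where "t = r / (\<bar>c\<bar> + 1)"
    have t: "t > 0" using r by (simp add: t_def)
    have "t * c \<le> t * \<bar>c\<bar>" using t by (intro mult_left_mono) auto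
    also have "t * \<bar>c\<bar> \<le> r" using r by (simp add: t_def field_simps)
    finally have "t * (t * c) \<le> t * r" using t by (intro mult_left_mono) auto
    then have "- 2 * t * r + t\<^sup>2 * c \<le> - (t * r)" by (simp add: power2_eq_square algebra_simps)
    then show False using q[of t] mult_pos_pos[OF t r] by linarith
  qed
  then have "v \<bullet>c v = 0" using vv by simp
  then show ?thesis using cscalar_self_eq_0[OF v] by (simp add: v_def)
qed

text \<open>For two square roots, \<open>D = S - T\<close> and \<open>X = S + T\<close> satisfy \<open>D X = - X D\<close>, so the positive
  semidefinite matrix \<open>D X D\<close> has trace zero.\<close>

lemma hermitian_sqrt_unique:
  assumes A: "hermitian_pos_def n A" and S: "hermitian_pos_semidef n S" "S * S = A"
    and T: "hermitian_pos_semidef n T" "T * T = A"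
  shows "S = T"
proof -
  have Sc: "S \<in> carrier_mat n n" and Sh: "mat_adjoint S = S" using S by (auto simp: hermitian_pos_semidef_def hermitian_mat_def)
  have Tc: "T \<in> carrier_mat n n" and Th: "mat_adjoint T = T" using T by (auto simp: hermitian_pos_semidef_def hermitian_mat_def)
  define D where "D = S - T"
  define X where "X = S + T"
  have Dc: "D \<in> carrier_mat n n" and Xc: "X \<in> carrier_mat n n" using Sc Tc by (auto simp: D_def X_def)
  have Dh: "mat_adjoint D = D"
  proof (rule eq_matI)
    fix i j assume "i < dim_row D" "j < dim_col D"
    then have ij: "i < n" "j < n" using Dc by auto
    have "cnj (S $$ (j, i)) = S $$ (i, j)" "cnj (T $$ (j, i)) = T $$ (i, j)"
      using ij Sc Tc mat_adjoint_index[of i S j] mat_adjoint_index[of i T j] Sh Th by auto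
    then show "mat_adjoint D $$ (i, j) = D $$ (i, j)" using ij Sc Tc by (simp add: D_def)
  qed (use Dc in auto)
  have ST: "S + T \<in> carrier_mat n n" "S - T \<in> carrier_mat n n" using Sc Tc by auto
  have DX: "D * X = S * S + S * T - (T * S + T * T)" "X * D = S * S + T * S - (S * T + T * T)"
    unfolding D_def X_def minus_mult_distrib_mat[OF Sc Tc ST(1)] mult_add_distrib_mat[OF Sc Sc Tc] mult_add_distrib_mat[OF Tc Sc Tc]
      mult_minus_distrib_mat[OF ST(1) Sc Tc] add_mult_distrib_mat[OF Sc Tc Sc] add_mult_distrib_mat[OF Sc Tc Tc]
    by (rule refl)+
  have anti: "D * X + X * D = 0\<^sub>m n n"
    unfolding DX S(2) T(2) using Sc Tc A
    by (intro eq_matI) (auto simp: hermitian_pos_def_def hermitian_mat_def)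
  have anti2: "(D * (X * D)) $$ (i, i) + (X * (D * D)) $$ (i, i) = 0" if "i < n" for i
  proof -
    have "D * (X * D) + X * (D * D) = (D * X + X * D) * D"
      using Dc Xc by (simp add: add_mult_distrib_mat[of _ n n] assoc_mult_mat[of _ n n _ n _ n])
    also have "\<dots> = 0\<^sub>m n n" unfolding anti using Dc by simp
    finally have "(D * (X * D) + X * (D * D)) $$ (i, i) = 0" using that by simp
    then show ?thesis using that Dc Xc by (simp del: index_mult_mat(1))
  qed
  \<comment> \<open>Cyclicity turns the trace of \<open>D * (X * D)\<close> into that of
    \<open>X * (D * D)\<close>, which by \<open>anti2\<close> is its negative.\<close>
  have "(\<Sum>i<n. (D * (X * D)) $$ (i, i)) = (\<Sum>i<n. ((X * D) * D) $$ (i, i))"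
    using Dc Xc by (intro trace_comm[of _ n n]) auto
  also have "(X * D) * D = X * (D * D)" using Dc Xc by (simp add: assoc_mult_mat[of _ n n _ n _ n])
  finally have tr: "(\<Sum>i<n. (D * (X * D)) $$ (i, i)) = 0"
    using anti2 by (simp add: eq_neg_iff_add_eq_0[symmetric] sum_negf del: index_mult_mat(1))
  have q: "(D * (X * D)) $$ (i, i) = (S *\<^sub>v col D i) \<bullet>c col D i + (T *\<^sub>v col D i) \<bullet>c col D i" if i: "i < n" for i
  proof -
    have c: "col D i \<in> carrier_vec n" using Dc i by auto
    have "(D * (X * D)) $$ (i, i) = row D i \<bullet> col (X * D) i" using Dc Xc i by simp
    also have "col (X * D) i = X *\<^sub>v col D i" using Dc Xc i by (intro col_mult2[of _ n n _ n]) auto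
    also have "X *\<^sub>v col D i = S *\<^sub>v col D i + T *\<^sub>v col D i"
      unfolding X_def using Sc Tc c by (intro add_mult_distrib_mat_vec[of _ n n]) auto
    also have "row D i = conjugate (col D i)"
    proof (rule eq_vecI)
      fix j assume "j < dim_vec (conjugate (col D i))"
      then have j: "j < n" using Dc by simp
      have "D $$ (i, j) = cnj (D $$ (j, i))" using mat_adjoint_index[of i D j] Dc i j Dh by simp
      then show "row D i $ j = conjugate (col D i) $ j" using Dc i j by (simp add: conjugate_complex_def)
    qed (use Dc in auto)
    also have "conjugate (col D i) \<bullet> (S *\<^sub>v col D i + T *\<^sub>v col D i) = (S *\<^sub>v col D i + T *\<^sub>v col D i) \<bullet>c col D i"
      using c Sc Tc by (intro comm_scalar_prod[of _ n]) auto
    also have "\<dots> = (S *\<^sub>v col D i) \<bullet>c col D i + (T *\<^sub>v col D i) \<bullet>c col D i"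
      using c Sc Tc by (intro add_scalar_prod_distrib[of _ n]) auto
    finally show ?thesis .
  qed
  have pos: "0 \<le> Re ((S *\<^sub>v col D i) \<bullet>c col D i)" "0 \<le> Re ((T *\<^sub>v col D i) \<bullet>c col D i)" if "i < n" for i
    using S T Dc that by (auto simp: hermitian_pos_semidef_def)
  have "(\<Sum>i<n. Re ((S *\<^sub>v col D i) \<bullet>c col D i) + Re ((T *\<^sub>v col D i) \<bullet>c col D i)) = 0"
    using arg_cong[OF tr, of Re] by (simp add: q del: index_mult_mat(1))
  then have z: "Re ((S *\<^sub>v col D i) \<bullet>c col D i) = 0" if "i < n" for i
    using that pos by (subst (asm) sum_nonneg_eq_0_iff) (auto simp: add_nonneg_eq_0_iff)
  \<comment> \<open>By \<open>psd_kernel\<close> a column of \<open>D\<close> lies in the kernel of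
    \<open>S\<close>, hence in that of \<open>A = S * S\<close>, which is definite.\<close>
  have "col D i = 0\<^sub>v n" if i: "i < n" for i
  proof (rule ccontr)
    assume nz: "col D i \<noteq> 0\<^sub>v n"
    have c: "col D i \<in> carrier_vec n" using Dc i by auto
    have "A *\<^sub>v col D i = S *\<^sub>v (S *\<^sub>v col D i)"
      unfolding S(2)[symmetric] using Sc c by (intro assoc_mult_mat_vec[of _ n n _ n]) auto
    also have "\<dots> = 0\<^sub>v n" unfolding psd_kernel[OF S(1) c z[OF i]] using Sc by (intro eq_vecI) auto
    finally have "(A *\<^sub>v col D i) \<bullet>c col D i = 0" using c by simp
    then show False using A c nz by (auto simp: hermitian_pos_def_def)
  qed
  then have "D $$ (j, i) = 0" if "i < n" "j < n" for i j
    using that Dc by (metis carrier_matD(1) carrier_matD(2) col_def index_vec index_zero_vec(1))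
  then have D0: "D $$ (i, j) = 0" if "i < n" "j < n" for i j using that by simp
  show ?thesis
  proof (rule eq_matI)
    fix i j assume "i < dim_row T" "j < dim_col T"
    then show "S $$ (i, j) = T $$ (i, j)" using D0[of i j] Sc Tc by (simp add: D_def)
  qed (use Sc Tc in auto)
qed


section \<open>Unitary matrices and existence of the square root\<close>

definition rot_mat :: "nat \<Rightarrow> ((nat \<Rightarrow> complex) \<Rightarrow> nat \<Rightarrow> complex) \<Rightarrow> complex mat" where
  "rot_mat n T = mat n n (\<lambda>(i, j). T (\<lambda>l. if l = j then 1 else 0) i)"

lemma rot_mat_carrier[simp]: "rot_mat n T \<in> carrier_mat n n"
  by (simp add: rot_mat_def)

lemma rot_mat_adjoint:
  assumes T: "rot {..<n} T"
  shows "mat_adjoint (rot_mat n T) * rot_mat n T = 1\<^sub>m n" "rot_mat n T * mat_adjoint (rot_mat n T) = 1\<^sub>m n"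
proof -
  let ?e = "\<lambda>j l. if l = (j::nat) then 1 else (0::complex)"
  show 1: "mat_adjoint (rot_mat n T) * rot_mat n T = 1\<^sub>m n"
  proof (rule eq_matI)
    fix i j assume "i < dim_row (1\<^sub>m n :: complex mat)" "j < dim_col (1\<^sub>m n :: complex mat)"
    then have ij: "i < n" "j < n" by auto
    have "(mat_adjoint (rot_mat n T) * rot_mat n T) $$ (i, j) = ip {..<n} (T (?e j)) (T (?e i))"
      using ij by (subst mat_mult_index) (auto simp: rot_mat_def ip_def mult.commute)
    also have "\<dots> = ip {..<n} (?e j) (?e i)" by (rule rot_ip[OF T]) simp
    also have "\<dots> = (\<Sum>l<n. if l = i then ?e j l else 0)" unfolding ip_def by (intro sum.cong) auto
    also have "\<dots> = (1\<^sub>m n :: complex mat) $$ (i, j)" using ij by simp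
    finally show "(mat_adjoint (rot_mat n T) * rot_mat n T) $$ (i, j) = (1\<^sub>m n :: complex mat) $$ (i, j)" .
  qed (auto simp: rot_mat_def)
  show "rot_mat n T * mat_adjoint (rot_mat n T) = 1\<^sub>m n"
    by (rule mat_mult_left_right_inverse[OF _ _ 1]) auto
qed

lemma clin_sum:
  assumes T: "clin T" and "finite J"
  shows "T (\<lambda>l. \<Sum>j\<in>J. c j * f j l) i = (\<Sum>j\<in>J. c j * T (f j) i)"
  using assms(2)
proof (induction J rule: finite_induct)
  case empty
  then show ?case using clin_simps(1)[OF T, of 0 "\<lambda>_. 0" i] by simp
next
  case (insert j J)
  have "T (\<lambda>l. \<Sum>j\<in>insert j J. c j * f j l) i = T (\<lambda>l. c j * f j l + (\<Sum>j\<in>J. c j * f j l)) i"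
    using insert by simp
  also have "\<dots> = c j * T (f j) i + T (\<lambda>l. \<Sum>j\<in>J. c j * f j l) i"
    by (rule clinD[OF T])
  finally show ?case using insert by simp
qed

lemma rot_mat_vec:
  assumes T: "rot {..<n} T" and v: "v \<in> carrier_vec n" and i: "i < n"
  shows "(rot_mat n T *\<^sub>v v) $ i = T (($) v) i"
proof -
  let ?e = "\<lambda>j l. if l = (j::nat) then 1 else (0::complex)"
  have "T (($) v) i = T (\<lambda>l. \<Sum>j<n. v $ j * ?e j l) i"
  proof -
    have "(\<Sum>j<n. v $ j * ?e j l) = v $ l" if "l < n" for l
    proof -
      have "(\<Sum>j<n. v $ j * ?e j l) = (\<Sum>j<n. if l = j then v $ j else 0)" by (intro sum.cong) auto
      then show ?thesis using that by simp
    qed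
    then show ?thesis using rot_local[OF T, of "($) v" "\<lambda>l. \<Sum>j<n. v $ j * ?e j l"] i by auto
  qed
  also have "\<dots> = (\<Sum>j<n. v $ j * T (?e j) i)" by (rule clin_sum[OF rot_clin[OF T]]) simp
  also have "\<dots> = (rot_mat n T *\<^sub>v v) $ i"
    using v i by (simp add: rot_mat_def scalar_prod_def atLeast0LessThan mult.commute)
  finally show ?thesis ..
qed

lemma hermitian_congruence:
  assumes A: "hermitian_pos_semidef n A" and U: "U \<in> carrier_mat n n"
  shows "hermitian_pos_semidef n (mat_adjoint U * A * U)"
proof -
  have Ac: "A \<in> carrier_mat n n" and Ah: "mat_adjoint A = A" using A by (auto simp: hermitian_pos_semidef_def hermitian_mat_def)
  have Uc: "mat_adjoint U \<in> carrier_mat n n" using U by simp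
  have UA: "mat_adjoint U * A \<in> carrier_mat n n" using Uc Ac by simp
  have c: "mat_adjoint U * A * U \<in> carrier_mat n n" using UA U by simp
  have h: "mat_adjoint (mat_adjoint U * A * U) = mat_adjoint U * A * U"
    unfolding mat_adjoint_mult[OF UA U] mat_adjoint_mult[OF Uc Ac] Ah mat_adjoint_adjoint
    by (rule assoc_mult_mat[OF Uc Ac U, symmetric])
  have "0 \<le> Re ((mat_adjoint U * A * U *\<^sub>v v) \<bullet>c v)" if v: "v \<in> carrier_vec n" for v
  proof -
    have Uv: "U *\<^sub>v v \<in> carrier_vec n" using U v by simp
    have AUv: "A *\<^sub>v (U *\<^sub>v v) \<in> carrier_vec n" using Ac Uv by simp
    have "mat_adjoint U * A * U *\<^sub>v v = mat_adjoint U *\<^sub>v (A *\<^sub>v (U *\<^sub>v v))"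
      using assoc_mult_mat_vec[OF UA U v] assoc_mult_mat_vec[OF Uc Ac Uv] by simp
    then have "(mat_adjoint U * A * U *\<^sub>v v) \<bullet>c v = (A *\<^sub>v (U *\<^sub>v v)) \<bullet>c (U *\<^sub>v v)"
      using adjoint_cscalar[OF Uc AUv v] by simp
    then show ?thesis using A Uv by (simp add: hermitian_pos_semidef_def)
  qed
  then show ?thesis using c h by (simp add: hermitian_pos_semidef_def hermitian_mat_def)
qed

text \<open>Rotating an eigenvector to the last coordinate splits off a one-dimensional block.\<close>

lemma hermitian_sqrt_exists:
  assumes "hermitian_pos_semidef n A"
  shows "\<exists>S. hermitian_pos_semidef n S \<and> S * S = A"
  using assms
proof (induction n arbitrary: A)
  case 0
  then have A: "A \<in> carrier_mat 0 0" by (auto simp: hermitian_pos_semidef_def hermitian_mat_def)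
  then have "A * A = A" by (intro eq_matI) auto
  then show ?case using 0 by blast
next
  case (Suc n A)
  let ?N = "Suc n"
  have Ac: "A \<in> carrier_mat ?N ?N" using Suc by (auto simp: hermitian_pos_semidef_def hermitian_mat_def)
  obtain g \<mu> where g: "g \<in> carrier_vec ?N" "g \<noteq> 0\<^sub>v ?N" "A *\<^sub>v g = \<mu> \<cdot>\<^sub>v g"
    using spectrum_non_empty[OF Ac] Ac by (auto simp: spectrum_def eigenvalue_def eigenvector_def)
  obtain T where T: "rot {..<?N} T" "\<forall>i\<in>{..<?N} - {n}. T (($) g) i = 0"
    using rot_annihilate_exists[of "{..<?N}" n "($) g"] by auto
  define U where "U = rot_mat ?N T"
  define Ua where "Ua = mat_adjoint U"
  have U: "U \<in> carrier_mat ?N ?N" "Ua \<in> carrier_mat ?N ?N" by (auto simp: U_def Ua_def)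
  have UU: "Ua * U = 1\<^sub>m ?N" "U * Ua = 1\<^sub>m ?N" using rot_mat_adjoint[OF T(1)] by (auto simp: U_def Ua_def)
  define B where "B = U * A * Ua"
  have B: "hermitian_pos_semidef ?N B"
    using hermitian_congruence[OF Suc.prems U(2)] by (simp add: B_def Ua_def)
  have Bc: "B \<in> carrier_mat ?N ?N" and Bh: "mat_adjoint B = B" using B by (auto simp: hermitian_pos_semidef_def hermitian_mat_def)
  define h where "h = U *\<^sub>v g"
  have h: "h \<in> carrier_vec ?N" using U g by (simp add: h_def)
  have hi: "h $ i = 0" if "i < n" for i
    using rot_mat_vec[OF T(1) g(1), of i] T(2) that by (simp add: h_def U_def)
  have gh: "g = Ua *\<^sub>v h"
    unfolding h_def using assoc_mult_mat_vec[OF U(2,1) g(1)] UU(1) g(1) by simp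
  have hn: "h $ n \<noteq> 0"
  proof
    assume "h $ n = 0"
    then have "h $ i = 0" if "i < Suc n" for i using hi that by (cases "i = n") auto
    then have h0: "h = 0\<^sub>v ?N" using h by (intro eq_vecI) auto
    have "g = 0\<^sub>v ?N" unfolding gh h0 using U by (intro eq_vecI) auto
    then show False using g(2) by simp
  qed
  have Bh': "B *\<^sub>v h = \<mu> \<cdot>\<^sub>v h"
  proof -
    have UA: "U * A \<in> carrier_mat ?N ?N" using U Ac by simp
    have "B *\<^sub>v h = (U * A) *\<^sub>v g"
      unfolding B_def using assoc_mult_mat_vec[OF UA U(2) h] gh by simp
    also have "\<dots> = U *\<^sub>v (\<mu> \<cdot>\<^sub>v g)" using assoc_mult_mat_vec[OF U(1) Ac g(1)] g(3) by simp
    also have "\<dots> = \<mu> \<cdot>\<^sub>v h" unfolding h_def by (rule mult_mat_vec[OF U(1) g(1)])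
    finally show ?thesis .
  qed
  \<comment> \<open>\<open>h\<close> is a nonzero multiple of the last basis vector and an
    eigenvector of \<open>B\<close>; this fixes the last column, and symmetry then the last
    row.\<close>
  have col: "B $$ (i, n) = (if i = n then \<mu> else 0)" if i: "i < ?N" for i
  proof -
    have "(B *\<^sub>v h) $ i = B $$ (i, n) * h $ n"
      using Bc h i hi by (simp add: scalar_prod_def)
    then have "B $$ (i, n) * h $ n = \<mu> * h $ i" using Bh' h i by simp
    then show ?thesis using hn hi i by (cases "i = n") auto
  qed
  have row: "B $$ (n, i) = (if i = n then \<mu> else 0)" if i: "i < ?N" for i
  proof (cases "i = n")
    case False
    have "B $$ (n, i) = cnj (B $$ (i, n))" using mat_adjoint_index[of n B i] Bc Bh i by simp
    then show ?thesis using col[OF i] False by simp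
  qed (simp add: col)
  define C where "C = mat n n (\<lambda>(i, j). B $$ (i, j))"
  have quad: "(B *\<^sub>v v) \<bullet>c v = (\<Sum>i<n. \<Sum>j<n. B $$ (i, j) * v $ j * cnj (v $ i)) + \<mu> * v $ n * cnj (v $ n)"
    if v: "v \<in> carrier_vec ?N" for v
  proof -
    have "(B *\<^sub>v v) \<bullet>c v = (\<Sum>i<?N. (\<Sum>j<?N. B $$ (i, j) * v $ j) * cnj (v $ i))"
      using Bc v by (simp add: scalar_prod_def atLeast0LessThan conjugate_complex_def del: sum.lessThan_Suc)
    also have "\<dots> = (\<Sum>i<n. (\<Sum>j<n. B $$ (i, j) * v $ j) * cnj (v $ i)) + \<mu> * v $ n * cnj (v $ n)"
      by (simp add: col row)
    finally show ?thesis by (simp add: sum_distrib_right)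
  qed
  have Cp: "hermitian_pos_semidef n C"
    unfolding hermitian_pos_semidef_def hermitian_mat_def
  proof (intro conjI ballI)
    show "C \<in> carrier_mat n n" by (simp add: C_def)
    show "mat_adjoint C = C"
    proof (rule eq_matI)
      fix i j assume "i < dim_row C" "j < dim_col C"
      then have ij: "i < n" "j < n" by (auto simp: C_def)
      then show "mat_adjoint C $$ (i, j) = C $$ (i, j)"
        using mat_adjoint_index[of i B j] Bc Bh by (simp add: C_def)
    qed (auto simp: C_def)
    fix v :: "complex vec" assume v: "v \<in> carrier_vec n"
    define w where "w = vec ?N (\<lambda>i. if i < n then v $ i else 0)"
    have w: "w \<in> carrier_vec ?N" by (simp add: w_def)
    have "(B *\<^sub>v w) \<bullet>c w = (\<Sum>i<n. \<Sum>j<n. B $$ (i, j) * v $ j * cnj (v $ i))"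
      unfolding quad[OF w] by (simp add: w_def)
    also have "\<dots> = (C *\<^sub>v v) \<bullet>c v"
      using v by (simp add: C_def scalar_prod_def atLeast0LessThan conjugate_complex_def sum_distrib_right)
    finally show "0 \<le> Re ((C *\<^sub>v v) \<bullet>c v)" using B w by (auto simp: hermitian_pos_semidef_def)
  qed
  have mu: "\<mu> = of_real (Re \<mu>)" "Re \<mu> \<ge> 0"
  proof -
    have "cnj \<mu> = \<mu>" using mat_adjoint_index[of n B n] Bc Bh col[of n] by simp
    then show "\<mu> = of_real (Re \<mu>)" by (simp add: complex_eq_iff)
    define w where "w = vec ?N (\<lambda>i. if i < n then 0 else (1::complex))"
    have w: "w \<in> carrier_vec ?N" by (simp add: w_def)
    have "(B *\<^sub>v w) \<bullet>c w = \<mu>" unfolding quad[OF w] by (simp add: w_def)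
    then show "Re \<mu> \<ge> 0" using B w by (auto simp: hermitian_pos_semidef_def)
  qed
  obtain S where S: "hermitian_pos_semidef n S" "S * S = C" using Suc.IH[OF Cp] by blast
  have Sc: "S \<in> carrier_mat n n" and Sh: "mat_adjoint S = S" using S by (auto simp: hermitian_pos_semidef_def hermitian_mat_def)
  define r where "r = complex_of_real (sqrt (Re \<mu>))"
  have rr: "r * r = \<mu>" using mu by (simp add: r_def flip: of_real_mult)
  define R where "R = mat ?N ?N (\<lambda>(i, j). if i < n \<and> j < n then S $$ (i, j) else if i = j then r else 0)"
  have Rc: "R \<in> carrier_mat ?N ?N" by (simp add: R_def)
  have Rp: "hermitian_pos_semidef ?N R"
    unfolding hermitian_pos_semidef_def hermitian_mat_def
  proof (intro conjI ballI)
    show "R \<in> carrier_mat ?N ?N" by fact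
    show "mat_adjoint R = R"
    proof (rule eq_matI)
      fix i j assume "i < dim_row R" "j < dim_col R"
      then have ij: "i < ?N" "j < ?N" using Rc by auto
      have "cnj (S $$ (j, i)) = S $$ (i, j)" if "i < n" "j < n"
        using mat_adjoint_index[of i S j] Sc Sh that by simp
      then show "mat_adjoint R $$ (i, j) = R $$ (i, j)"
        using ij Rc by (auto simp: R_def r_def)
    qed (use Rc in auto)
    fix v :: "complex vec" assume v: "v \<in> carrier_vec ?N"
    define w where "w = vec n (\<lambda>i. v $ i)"
    have w: "w \<in> carrier_vec n" by (simp add: w_def)
    have "(R *\<^sub>v v) \<bullet>c v = (\<Sum>i<?N. (\<Sum>j<?N. R $$ (i, j) * v $ j) * cnj (v $ i))"
      using Rc v by (simp add: scalar_prod_def atLeast0LessThan conjugate_complex_def del: sum.lessThan_Suc)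
    also have "\<dots> = (\<Sum>i<n. (\<Sum>j<n. S $$ (i, j) * v $ j) * cnj (v $ i)) + r * (v $ n * cnj (v $ n))"
      by (simp add: R_def)
    also have "(\<Sum>i<n. (\<Sum>j<n. S $$ (i, j) * v $ j) * cnj (v $ i)) = (S *\<^sub>v w) \<bullet>c w"
      using Sc by (simp add: w_def scalar_prod_def atLeast0LessThan conjugate_complex_def)
    also have "r * (v $ n * cnj (v $ n)) = of_real (sqrt (Re \<mu>) * (cmod (v $ n))\<^sup>2)"
      by (simp only: r_def of_real_mult complex_norm_square)
    finally have "Re ((R *\<^sub>v v) \<bullet>c v) = Re ((S *\<^sub>v w) \<bullet>c w) + sqrt (Re \<mu>) * (cmod (v $ n))\<^sup>2"
      by (simp del: of_real_mult)
    moreover have "0 \<le> Re ((S *\<^sub>v w) \<bullet>c w)" using S w by (auto simp: hermitian_pos_semidef_def)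
    ultimately show "0 \<le> Re ((R *\<^sub>v v) \<bullet>c v)" using mu by simp
  qed
  have RR: "R * R = B"
  proof (rule eq_matI)
    fix i j assume "i < dim_row B" "j < dim_col B"
    then have ij: "i < ?N" "j < ?N" using Bc by auto
    have e: "(R * R) $$ (i, j) = (\<Sum>l<n. R $$ (i, l) * R $$ (l, j)) + R $$ (i, n) * R $$ (n, j)"
      using ij Rc by (subst mat_mult_index) auto
    consider "i < n" "j < n" | "i = n" "j < n" | "i < n" "j = n" | "i = n" "j = n" using ij by linarith
    then show "(R * R) $$ (i, j) = B $$ (i, j)"
    proof cases
      case 1
      have "(S * S) $$ (i, j) = (\<Sum>l<n. S $$ (i, l) * S $$ (l, j))" using 1 Sc by (subst mat_mult_index) auto
      then show ?thesis unfolding e S(2) using 1 by (simp add: R_def C_def)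
    next
      case 2
      then show ?thesis unfolding e by (simp add: R_def row)
    next
      case 3
      then show ?thesis unfolding e by (simp add: R_def col)
    next
      case 4
      then show ?thesis unfolding e by (simp add: R_def col rr)
    qed
  qed (use Bc Rc in auto)
  define Q where "Q = Ua * R * U"
  have Qp: "hermitian_pos_semidef ?N Q" using hermitian_congruence[OF Rp U(1)] by (simp add: Q_def Ua_def)
  have "Q * Q = A"
  proof -
    note as = assoc_mult_mat[of _ ?N ?N _ ?N _ ?N]
    have "Q * Q = Ua * R * (U * Ua) * R * U"
      unfolding Q_def using U Rc by (simp add: as)
    also have "\<dots> = Ua * (R * R) * U" unfolding UU(2) using U Rc by (simp add: as)
    also have "\<dots> = (Ua * U) * A * (Ua * U)" unfolding RR B_def using U Ac by (simp add: as)
    also have "\<dots> = A" unfolding UU(1) using Ac by simp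
    finally show ?thesis .
  qed
  then show ?case using Qp by blast
qed

lemma hermitian_sqrt_props:
  assumes "hermitian_pos_def n A"
  shows "hermitian_sqrt A \<in> carrier_mat n n" "mat_adjoint (hermitian_sqrt A) = hermitian_sqrt A" "hermitian_sqrt A * hermitian_sqrt A = A"
proof -
  have n: "dim_row A = n" using assms by (auto simp: hermitian_pos_def_def hermitian_mat_def)
  have psd: "hermitian_pos_semidef n A"
    unfolding hermitian_pos_semidef_def
  proof (intro conjI ballI)
    show "hermitian_mat n A" using assms by (simp add: hermitian_pos_def_def)
    fix v :: "complex vec" assume v: "v \<in> carrier_vec n"
    show "0 \<le> Re ((A *\<^sub>v v) \<bullet>c v)"
    proof (cases "v = 0\<^sub>v n")
      case True
      then show ?thesis using assms by (auto simp: hermitian_pos_def_def hermitian_mat_def)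
    next
      case False
      then show ?thesis using assms v by (auto simp: hermitian_pos_def_def intro: less_imp_le)
    qed
  qed
  have "\<exists>!S. hermitian_pos_semidef n S \<and> S * S = A"
    using hermitian_sqrt_exists[OF psd] hermitian_sqrt_unique[OF assms] by blast
  then have "hermitian_pos_semidef n (hermitian_sqrt A) \<and> hermitian_sqrt A * hermitian_sqrt A = A"
    unfolding hermitian_sqrt_def n by (rule theI')
  then show "hermitian_sqrt A \<in> carrier_mat n n" "mat_adjoint (hermitian_sqrt A) = hermitian_sqrt A" "hermitian_sqrt A * hermitian_sqrt A = A"
    by (auto simp: hermitian_pos_semidef_def hermitian_mat_def)
qed

subsection \<open>Reduction of the channel\<close>

lemma mat_inv_props:
  assumes A: "(A :: complex mat) \<in> carrier_mat n n" and d: "det A \<noteq> 0"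
  shows "mat_inv A \<in> carrier_mat n n" "A * mat_inv A = 1\<^sub>m n" "mat_inv A * A = 1\<^sub>m n"
proof -
  have "mat_inverse A \<noteq> None"
    using mat_inverse(1)[OF A, of "()"] det_non_zero_imp_unit[OF A d, of "()"] by blast
  then obtain B where "mat_inverse A = Some B" by auto
  then show "mat_inv A \<in> carrier_mat n n" "A * mat_inv A = 1\<^sub>m n" "mat_inv A * A = 1\<^sub>m n"
    using mat_inverse(2)[OF A] by (auto simp: mat_inv_def)
qed

lemma det_pos_def:
  assumes "hermitian_pos_def n A"
  shows "det A \<noteq> 0"
proof
  have A: "A \<in> carrier_mat n n" using assms by (auto simp: hermitian_pos_def_def hermitian_mat_def)
  assume "det A = 0"
  then obtain v where v: "v \<in> carrier_vec n" "v \<noteq> 0\<^sub>v n" "A *\<^sub>v v = 0\<^sub>v n"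
    using det_0_iff_vec_prod_zero_field[OF A] by auto
  have "(A *\<^sub>v v) \<bullet>c v = 0" unfolding v(3) using v(1) by simp
  then show False using assms v by (auto simp: hermitian_pos_def_def)
qed

lemma hermitian_entry:
  assumes "A \<in> carrier_mat n n" "mat_adjoint A = (A :: complex mat)" "i < n" "j < n"
  shows "cnj (A $$ (i, j)) = A $$ (j, i)"
  using mat_adjoint_index[of j A i] assms by simp

lemma quad_form_sum:
  assumes "A \<in> carrier_mat n n" "v \<in> carrier_vec n"
  shows "(A *\<^sub>v v) \<bullet>c v = (\<Sum>i<n. \<Sum>j<n. A $$ (i, j) * v $ j * cnj (v $ i))"
  using assms by (simp add: scalar_prod_def atLeast0LessThan sum_distrib_right conjugate_complex_def)

text \<open>The form of the block at \<open>v\<close> is the form of \<open>R\<close> at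
  \<open>v\<close> preceded by a zero.\<close>

lemma cov_R22_pos_def:
  assumes R: "hermitian_pos_def (Suc n) R"
  shows "hermitian_pos_def n (cov_R22 R)"
proof -
  have Rc: "R \<in> carrier_mat (Suc n) (Suc n)" and Rh: "mat_adjoint R = R"
    using R by (auto simp: hermitian_pos_def_def hermitian_mat_def)
  have C: "cov_R22 R \<in> carrier_mat n n" using Rc by (simp add: cov_R22_def mat_delete_def)
  have Ci: "cov_R22 R $$ (i, j) = R $$ (Suc i, Suc j)" if "i < n" "j < n" for i j
    using that Rc by (simp add: cov_R22_def mat_delete_def)
  have "mat_adjoint (cov_R22 R) = cov_R22 R"
    by (rule eq_matI) (use C Ci hermitian_entry[OF Rc Rh] in auto)
  moreover have "0 < Re ((cov_R22 R *\<^sub>v v) \<bullet>c v)" if v: "v \<in> carrier_vec n" "v \<noteq> 0\<^sub>v n" for v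
  proof -
    define w where "w = vec (Suc n) (\<lambda>i. if i = 0 then 0 else v $ (i - 1))"
    have w: "w \<in> carrier_vec (Suc n)" by (simp add: w_def)
    have "w \<noteq> 0\<^sub>v (Suc n)"
    proof
      assume w0: "w = 0\<^sub>v (Suc n)"
      have "v $ i = 0" if "i < n" for i
        using arg_cong[OF w0, of "\<lambda>w. w $ Suc i"] that by (simp add: w_def)
      then have "v = 0\<^sub>v n" using v by (intro eq_vecI) auto
      then show False using v by simp
    qed
    then have "0 < Re ((R *\<^sub>v w) \<bullet>c w)" using R w by (auto simp: hermitian_pos_def_def)
    also have "(R *\<^sub>v w) \<bullet>c w = (cov_R22 R *\<^sub>v v) \<bullet>c v"
      unfolding quad_form_sum[OF Rc w] quad_form_sum[OF C v(1)]
      by (simp add: sum.lessThan_Suc_shift w_def Ci del: sum.lessThan_Suc)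
    finally show ?thesis .
  qed
  ultimately show ?thesis using C by (simp add: hermitian_pos_def_def hermitian_mat_def)
qed

text \<open>The first rotation brings \<open>v\<close> to the last axis. Orthogonality then keeps
  \<open>y\<close> out of the last coordinate, and a second rotation among the first
  \<open>Suc k\<close> coordinates brings \<open>y\<close> to axis \<open>k\<close> without
  disturbing \<open>v\<close>, which is zero there.\<close>

lemma rot_two_vectors:
  assumes "ip {..<Suc (Suc k)} y v = 0" "ip {..<Suc (Suc k)} v v \<noteq> 0"
  shows "\<exists>T. rot {..<Suc (Suc k)} T \<and> (\<forall>i<Suc k. T v i = 0) \<and> (\<forall>i<Suc (Suc k). i \<noteq> k \<longrightarrow> T y i = 0)"
proof -
  let ?I = "{..<Suc (Suc k)}"
  obtain T1 where T1: "rot ?I T1" "\<forall>i\<in>?I - {Suc k}. T1 v i = 0"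
    using rot_annihilate_exists[of ?I "Suc k" v] by auto
  obtain T2 where T2: "rot {..<Suc k} T2" "\<forall>i\<in>{..<Suc k} - {k}. T2 (T1 y) i = 0"
    using rot_annihilate_exists[of "{..<Suc k}" k "T1 y"] by auto
  have spl: "ip ?I x z = ip {..<Suc k} x z + x (Suc k) * cnj (z (Suc k))" for x z
    by (simp add: ip_def)
  have z1: "ip {..<Suc k} x (T1 v) = 0" for x using T1(2) by (auto simp: ip_def)
  have e: "ip ?I x v = T1 x (Suc k) * cnj (T1 v (Suc k))" for x
    using rot_ip[OF T1(1), of x v] by (simp only: spl z1 finite_lessThan add_0)
  have y0: "T1 y (Suc k) = 0" using e[of y] e[of v] assms by auto
  have "ip {..<Suc k} (T2 (T1 v)) (T2 (T1 v)) = 0"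
    using rot_ip[OF T2(1), of "T1 v" "T1 v"] z1 by simp
  then have "\<forall>i<Suc k. T2 (T1 v) i = 0" by (simp add: ip_self_eq_0_iff)
  moreover have "\<forall>i<Suc (Suc k). i \<noteq> k \<longrightarrow> T2 (T1 y) i = 0"
    using T2(2) y0 rot_outside[OF T2(1), of "Suc k" "T1 y"] by (auto simp: less_Suc_eq)
  moreover have "rot ?I (\<lambda>x. T2 (T1 x))" by (intro rot_comp[OF rot_mono[OF T2(1)] T1(1)]) auto
  ultimately show ?thesis by blast
qed

text \<open>The rotation is chosen so that the last coordinate of a row of \<open>H\<^sub>w\<close> is the part of the first
  column that is independent of the others, and the coordinate before it carries the mean \<open>b\<close> of the
  others.\<close>

lemma channel_reduction:
  fixes k nr :: nat and a b :: "complex vec" and R :: "complex mat"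
  defines "n \<equiv> Suc (Suc k)" and "S \<equiv> hermitian_sqrt R" and "\<rho> \<equiv> Re (mat_inv R $$ (0,0))"
  assumes R: "hermitian_pos_def n R" and a: "a \<in> carrier_vec nr" and b: "b \<in> carrier_vec n"
  shows "\<exists>T \<tau> \<eta>. rot {..<n} T \<and> \<rho> > 0 \<and> (cmod \<tau>)\<^sup>2 = \<rho> \<and> (cmod \<eta>)\<^sup>2 = par_x2 R b \<and>
    (\<forall>W\<in>carrier_mat nr n. let ws = rotated_cols nr n T W; 
        first = (\<lambda>i. ws (Suc k) i + (\<tau> * mu1 R b) * a $ i);
        gs = (\<lambda>i. ws k i + \<eta> * a $ i) # col_list k ws;
        H = outer_prod a b + W * S
      in nondeg nr (gs @ [first]) \<longrightarrow> Re (mat_inv (mat_adjoint H * H) $$ (0,0)) = \<rho> / residual nr gs first)"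
proof -
  have Rc: "R \<in> carrier_mat n n" and Rh: "mat_adjoint R = R"
    using R by (auto simp: hermitian_pos_def_def hermitian_mat_def)
  have Sc: "S \<in> carrier_mat n n" and Sh: "mat_adjoint S = S" and SS: "S * S = R"
    using hermitian_sqrt_props[OF R] by (auto simp: S_def)
  note dR = det_pos_def[OF R]
  define Ri where "Ri = mat_inv R"
  have Ri: "Ri \<in> carrier_mat n n" "R * Ri = 1\<^sub>m n" "Ri * R = 1\<^sub>m n"
    using mat_inv_props[OF Rc dR] by (auto simp: Ri_def)
  \<comment> \<open>The inverse of \<open>S\<close>, because \<open>S * S = R\<close>.\<close>
  define Sinv where "Sinv = S * Ri"
  have Sic: "Sinv \<in> carrier_mat n n" using Sc Ri by (simp add: Sinv_def)
  have SSi: "S * Sinv = 1\<^sub>m n"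
    unfolding Sinv_def using assoc_mult_mat[OF Sc Sc Ri(1)] SS Ri by simp
  have n0: "0 < n" by (simp add: n_def)
  have nk: "Suc j < n" if "j < Suc k" for j using that by (simp add: n_def)
  \<comment> \<open>Conjugated columns, so that a row of \<open>W\<close> times column
    \<open>j\<close> of \<open>S\<close> is the inner product of that row with \<open>sb j\<close>.
    The vector \<open>v\<close> is dual to \<open>sb 0\<close>: it is orthogonal to every other
    \<open>sb j\<close>.\<close>
  define sb where "sb j l = cnj (S $$ (l, j))" for j l
  define v where "v l = cnj (Sinv $$ (l, 0))" for l
  have ip_sb: "ip {..<n} (sb j) (sb i) = R $$ (j, i)" if "i < n" "j < n" for i j
  proof -
    have "R $$ (j, i) = (mat_adjoint S * S) $$ (j, i)" by (simp only: Sh SS)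
    also have "\<dots> = (\<Sum>l<n. cnj (S $$ (l, j)) * S $$ (l, i))"
      using that Sc by (subst mat_mult_index) auto
    finally show ?thesis by (simp add: ip_def sb_def)
  qed
  have sb_v: "ip {..<n} (sb j) v = (if j = 0 then 1 else 0)" if "j < n" for j
  proof -
    have "(1\<^sub>m n :: complex mat) $$ (j, 0) = (mat_adjoint S * Sinv) $$ (j, 0)" by (simp only: Sh SSi)
    also have "\<dots> = (\<Sum>l<n. cnj (S $$ (l, j)) * Sinv $$ (l, 0))"
      using that Sc Sic n0 by (subst mat_mult_index) auto
    finally show ?thesis using that n0 by (simp add: ip_def sb_def v_def)
  qed
  have vv: "ip {..<n} v v = cnj (Ri $$ (0, 0))"
  proof -
    have "mat_adjoint Sinv * Sinv = mat_adjoint Ri * S * (S * Ri)"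
      unfolding Sinv_def mat_adjoint_mult[OF Sc Ri(1)] Sh ..
    also have "\<dots> = mat_adjoint Ri * (S * (S * Ri))"
      using Sc Ri by (intro assoc_mult_mat[of _ n n _ n _ n]) auto
    also have "S * (S * Ri) = 1\<^sub>m n" using SSi by (simp add: Sinv_def)
    finally have "mat_adjoint Sinv * Sinv = mat_adjoint Ri" using Ri by simp
    then have "cnj (Ri $$ (0, 0)) = (mat_adjoint Sinv * Sinv) $$ (0, 0)" using Ri n0 by simp
    also have "\<dots> = (\<Sum>l<n. cnj (Sinv $$ (l, 0)) * Sinv $$ (l, 0))"
      using Sic n0 by (subst mat_mult_index) auto
    finally show ?thesis by (simp add: ip_def v_def)
  qed
  then have Re_vv: "Re (ip {..<n} v v) = \<rho>" by (simp add: \<rho>_def Ri_def)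
  have v_nz: "ip {..<n} v v \<noteq> 0"
  proof
    assume "ip {..<n} v v = 0"
    then have "\<forall>l<n. v l = 0" by (simp add: ip_self_eq_0_iff)
    then have "ip {..<n} (sb 0) v = 0" by (simp add: ip_def)
    then show False using sb_v[OF n0] by simp
  qed
  have \<rho>0: "\<rho> > 0"
  proof -
    have "\<rho> \<ge> 0" using Re_ip_self_nonneg[of "{..<n}" v] Re_vv by simp
    moreover have "ip {..<n} v v = of_real \<rho>" using Re_vv by (metis ip_self Re_complex_of_real)
    then have "\<rho> \<noteq> 0" using v_nz by auto
    ultimately show ?thesis by simp
  qed

  have R': "hermitian_pos_def (Suc (Suc k)) R" using R by (simp add: n_def)
  note P22 = cov_R22_pos_def[OF R']
  define C where "C = cov_R22 R"
  have Cc: "C \<in> carrier_mat (Suc k) (Suc k)" using P22 by (auto simp: C_def hermitian_pos_def_def hermitian_mat_def)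
  have Ci: "C $$ (i, j) = R $$ (Suc i, Suc j)" if "i < Suc k" "j < Suc k" for i j
    using that Rc by (simp add: C_def cov_R22_def mat_delete_def n_def)
  define Cinv where "Cinv = mat_inv C"
  have Cinv: "Cinv \<in> carrier_mat (Suc k) (Suc k)" "Cinv * C = 1\<^sub>m (Suc k)"
    using mat_inv_props[OF Cc] det_pos_def[OF P22] by (auto simp: C_def Cinv_def)
  \<comment> \<open>The coefficients make \<open>y\<close> the vector in the span of the
    \<open>sb (Suc j)\<close> that represents the mean of the other columns. Its squared norm is
    \<open>par_x2 R b\<close>, and the part of \<open>cnj (b $ 0)\<close> that it does not account
    for is \<open>mu1 R b\<close>.\<close>
  define \<kappa> where "\<kappa> j = (\<Sum>i<Suc k. cnj (b $ Suc i) * Cinv $$ (i, j))" for j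
  define y where "y l = (\<Sum>j<Suc k. \<kappa> j * sb (Suc j) l)" for l
  have ip_y: "ip {..<n} y z = (\<Sum>j<Suc k. \<kappa> j * ip {..<n} (sb (Suc j)) z)" for z
  proof -
    have "ip {..<n} y z = (\<Sum>l<n. \<Sum>j<Suc k. \<kappa> j * (sb (Suc j) l * cnj (z l)))"
      by (simp only: ip_def y_def sum_distrib_right mult.assoc)
    also have "\<dots> = (\<Sum>j<Suc k. \<kappa> j * ip {..<n} (sb (Suc j)) z)"
      by (subst sum.swap) (simp only: ip_def sum_distrib_left)
    finally show ?thesis .
  qed
  have yv: "ip {..<n} y v = 0"
  proof -
    have "ip {..<n} (sb (Suc j)) v = 0" if "j < Suc k" for j
      using sb_v[of "Suc j"] that by (simp add: n_def)
    then show ?thesis unfolding ip_y by (intro sum.neutral) auto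
  qed
  have y_sb: "ip {..<n} y (sb (Suc i)) = cnj (b $ Suc i)" if i: "i < Suc k" for i
  proof -
    have "ip {..<n} y (sb (Suc i)) = (\<Sum>j<Suc k. \<kappa> j * C $$ (j, i))"
      unfolding ip_y using i by (intro sum.cong) (auto simp: ip_sb Ci nk)
    also have "\<dots> = (\<Sum>j<Suc k. \<Sum>l<Suc k. cnj (b $ Suc l) * (Cinv $$ (l, j) * C $$ (j, i)))"
      by (simp only: \<kappa>_def sum_distrib_right mult.assoc)
    also have "\<dots> = (\<Sum>l<Suc k. cnj (b $ Suc l) * (\<Sum>j<Suc k. Cinv $$ (l, j) * C $$ (j, i)))"
      by (subst sum.swap) (simp only: sum_distrib_left)
    also have "\<dots> = (\<Sum>l<Suc k. cnj (b $ Suc l) * (1\<^sub>m (Suc k) :: complex mat) $$ (l, i))"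
    proof (intro sum.cong refl arg_cong2[where f="(*)"])
      fix l assume "l \<in> {..<Suc k}"
      then have "(Cinv * C) $$ (l, i) = (\<Sum>j<Suc k. Cinv $$ (l, j) * C $$ (j, i))"
        using i Cc Cinv by (subst mat_mult_index) auto
      then show "(\<Sum>j<Suc k. Cinv $$ (l, j) * C $$ (j, i)) = (1\<^sub>m (Suc k) :: complex mat) $$ (l, i)"
        by (simp only: Cinv(2))
    qed
    also have "\<dots> = (\<Sum>l<Suc k. if l = i then cnj (b $ Suc l) else 0)"
      using i by (intro sum.cong) auto
    also have "\<dots> = cnj (b $ Suc i)" using i by (subst sum.delta) auto
    finally show ?thesis .
  qed
  have y_sb0: "cnj (b $ 0) - ip {..<n} y (sb 0) = mu1 R b"
  proof -
    have "ip {..<n} y (sb 0) = (\<Sum>j<Suc k. \<kappa> j * R $$ (Suc j, 0))"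
      unfolding ip_y by (intro sum.cong) (auto simp: ip_sb nk n0)
    also have "\<dots> = (\<Sum>j<Suc k. \<Sum>l<Suc k. Cinv $$ (l, j) * R $$ (Suc j, 0) * cnj (b $ Suc l))"
      unfolding \<kappa>_def sum_distrib_right by (simp only: mult_ac)
    also have "\<dots> = (\<Sum>l<Suc k. (\<Sum>j<Suc k. Cinv $$ (l, j) * R $$ (Suc j, 0)) * cnj (b $ Suc l))"
      by (subst sum.swap) (simp only: sum_distrib_right)
    also have "\<dots> = cov_r21 R \<bullet>c tail_vec b"
      using Rc Cinv(1) b
      by (simp add: cov_r21_def C_def[symmetric] Cinv_def[symmetric] cov_rho_def tail_vec_def scalar_prod_def
          atLeast0LessThan n_def conjugate_complex_def del: sum.lessThan_Suc)
    finally show ?thesis by (simp add: mu1_def)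
  qed
  have yy: "Re (ip {..<n} y y) = par_x2 R b"
  proof -
    have "ip {..<n} y y = cnj (\<Sum>j<Suc k. \<kappa> j * b $ Suc j)"
    proof -
      have "ip {..<n} y y = (\<Sum>j<Suc k. \<kappa> j * b $ Suc j)"
      proof -
        have "ip {..<n} (sb (Suc j)) y = b $ Suc j" if "j < Suc k" for j
          using y_sb[OF that] ip_commute[of "{..<n}" "sb (Suc j)" y] by simp
        then show ?thesis unfolding ip_y by (intro sum.cong) auto
      qed
      moreover have "cnj (ip {..<n} y y) = ip {..<n} y y" by (metis ip_commute)
      ultimately show ?thesis by simp
    qed
    then have "Re (ip {..<n} y y) = Re (\<Sum>j<Suc k. \<kappa> j * b $ Suc j)" by (simp del: sum.lessThan_Suc)
    also have "(\<Sum>j<Suc k. \<kappa> j * b $ Suc j) = (\<Sum>j<Suc k. \<Sum>i<Suc k. Cinv $$ (i, j) * b $ Suc j * cnj (b $ Suc i))"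
      unfolding \<kappa>_def sum_distrib_right by (simp only: mult_ac)
    also have "\<dots> = (\<Sum>i<Suc k. \<Sum>j<Suc k. Cinv $$ (i, j) * b $ Suc j * cnj (b $ Suc i))"
      by (rule sum.swap)
    also have "\<dots> = (mat_inv (cov_R22 R) *\<^sub>v tail_vec b) \<bullet>c tail_vec b"
      using Cinv(1) b 
      by (subst quad_form_sum[of _ "Suc k"]) 
        (simp_all add: C_def[symmetric] Cinv_def[symmetric] tail_vec_def n_def del: sum.lessThan_Suc)
    finally show ?thesis by (simp add: par_x2_def)
  qed

  obtain T where T: "rot {..<n} T" "\<forall>i<Suc k. T v i = 0" "\<forall>i<n. i \<noteq> k \<longrightarrow> T y i = 0"
    using rot_two_vectors[of k y v] yv v_nz unfolding n_def by blast
  define \<tau> where "\<tau> = T v (Suc k)"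
  define \<eta> where "\<eta> = T y k"
  have nS: "{..<n} = insert (Suc k) {..<Suc k}" "{..<n} = insert k ({..<n} - {k})" by (auto simp: n_def)
  have ip_Tv: "ip {..<n} x (T v) = x (Suc k) * cnj \<tau>" for x
  proof -
    have "ip {..<n} x (T v) = x (Suc k) * cnj (T v (Suc k)) + (\<Sum>i<Suc k. x i * cnj (T v i))"
      unfolding ip_def nS(1) by (subst sum.insert) auto
    also have "(\<Sum>i<Suc k. x i * cnj (T v i)) = 0" using T(2) by (intro sum.neutral) auto
    finally show ?thesis by (simp add: \<tau>_def)
  qed
  have ip_Ty: "ip {..<n} (T y) x = \<eta> * cnj (x k)" for x
  proof -
    have "ip {..<n} (T y) x = T y k * cnj (x k) + (\<Sum>i\<in>{..<n} - {k}. T y i * cnj (x i))"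
      unfolding ip_def by (subst nS(2), subst sum.insert) auto
    also have "(\<Sum>i\<in>{..<n} - {k}. T y i * cnj (x i)) = 0" using T(3) by (intro sum.neutral) auto
    finally show ?thesis by (simp add: \<eta>_def)
  qed
  have rip: "ip {..<n} (T x) (T z) = ip {..<n} x z" for x z by (rule rot_ip[OF T(1)]) simp
  have tau2: "(cmod \<tau>)\<^sup>2 = \<rho>"
  proof -
    have "ip {..<n} v v = \<tau> * cnj \<tau>" using ip_Tv[of "T v"] rip[of v v] by (simp add: \<tau>_def)
    then have "ip {..<n} v v = of_real ((cmod \<tau>)\<^sup>2)" by (simp only: complex_norm_square)
    then show ?thesis using Re_vv by simp
  qed
  then have tau0: "\<tau> \<noteq> 0" using \<rho>0 by auto
  have eta2: "(cmod \<eta>)\<^sup>2 = par_x2 R b"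
  proof -
    have "ip {..<n} y y = \<eta> * cnj \<eta>" using ip_Ty[of "T y"] rip[of y y] by (simp add: \<eta>_def)
    then have "ip {..<n} y y = of_real ((cmod \<eta>)\<^sup>2)" by (simp only: complex_norm_square)
    then show ?thesis using yy by simp
  qed

  \<comment> \<open>A rotated square root of \<open>R\<close>: \<open>H\<close> is the matrix of the
    columns \<open>g l\<close> below, multiplied by \<open>L\<close>. The last row of
    \<open>L\<close> is zero outside column 0, so \<open>g (Suc k)\<close> enters the first column
    of \<open>H\<close> only.\<close>
  define L where "L = mat n n (\<lambda>(l, j). cnj (T (sb j) l))"
  have Lc: "L \<in> carrier_mat n n" by (simp add: L_def)
  have LL: "mat_adjoint L * L = R"
  proof (rule eq_matI)
    fix i j assume "i < dim_row R" "j < dim_col R"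
    then have ij: "i < n" "j < n" using Rc by auto
    have "(mat_adjoint L * L) $$ (i, j) = ip {..<n} (T (sb i)) (T (sb j))"
      using ij by (subst mat_mult_index) (auto simp: L_def ip_def)
    then show "(mat_adjoint L * L) $$ (i, j) = R $$ (i, j)" using ij by (simp add: rip ip_sb)
  qed (use Rc in \<open>auto simp: L_def\<close>)
  define Li where "Li = Ri * mat_adjoint L"
  have Lic: "Li \<in> carrier_mat n n" using Ri Lc by (simp add: Li_def)
  have LiL: "Li * L = 1\<^sub>m n"
    unfolding Li_def using assoc_mult_mat[OF Ri(1) mat_adjoint_carrier[OF Lc] Lc] LL Ri by simp
  have LLi: "L * Li = 1\<^sub>m n" by (rule mat_mult_left_right_inverse[OF Lic Lc LiL])
  have Lrow: "L $$ (Suc k, j) = (if j = 0 then 1 / \<tau> else 0)" if "j < n" for j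
  proof -
    have "T (sb j) (Suc k) * cnj \<tau> = (if j = 0 then 1 else 0)"
      using sb_v[OF that] rip[of "sb j" v] ip_Tv[of "T (sb j)"] by simp
    then have "T (sb j) (Suc k) = (if j = 0 then 1 / cnj \<tau> else 0)"
      using tau0 by (auto simp: field_simps split: if_splits)
    then show ?thesis using that by (simp add: L_def n_def)
  qed
  have Lk: "\<eta> * L $$ (k, j) = ip {..<n} y (sb j)" if "j < n" for j
    using ip_Ty[of "T (sb j)"] rip[of y "sb j"] that by (simp add: L_def n_def)

  have "Re (mat_inv (mat_adjoint H * H) $$ (0,0)) = \<rho> / residual nr gs first"
    if W: "W \<in> carrier_mat nr n" and ws: "ws = rotated_cols nr n T W"
      and first: "first = (\<lambda>i. ws (Suc k) i + (\<tau> * mu1 R b) * a $ i)"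
      and gs: "gs = (\<lambda>i. ws k i + \<eta> * a $ i) # col_list k ws"
      and H: "H = outer_prod a b + W * S"
      and nd: "nondeg nr (gs @ [first])" for W ws first gs H
  proof -
    have Hc: "H \<in> carrier_mat nr n" using W Sc a b by (simp add: H outer_prod_def)
    \<comment> \<open>Rotated Gaussian columns with their means. Through rows \<open>Suc k\<close>
      and \<open>k\<close> of \<open>L\<close> the two means reproduce
      \<open>outer_prod a b\<close>.\<close>
    define g where "g l = (\<lambda>i. ws l i + (if l = Suc k then \<tau> * mu1 R b else if l = k then \<eta> else 0) * a $ i)" for l
    have gsi: "gs ! i = g (k - i)" if "i < Suc k" for i
    proof (cases i)
      case 0
      then show ?thesis by (simp add: gs g_def)
    next
      case (Suc i')
      then have "gs ! i = ws (k - i)" using that by (simp add: gs nth_col_list)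
      then show ?thesis using Suc that by (auto simp: g_def fun_eq_iff)
    qed
    have len: "length gs = Suc k" by (simp add: gs)
    have first': "first = g (Suc k)" by (simp add: first g_def)
    have wsT: "ws l r = T (\<lambda>j. W $$ (r, j)) l" if "r < nr" "l < n" for r l
      using that by (simp add: ws rotated_cols_def)
    have Hg: "H $$ (r, j) = (\<Sum>l<n. g l r * L $$ (l, j))" if r: "r < nr" and j: "j < n" for r j
    proof -
      have "H $$ (r, j) = a $ r * cnj (b $ j) + (\<Sum>l<n. W $$ (r, l) * S $$ (l, j))"
        using r j W Sc a b by (simp add: H outer_prod_def scalar_prod_def atLeast0LessThan)
      also have "(\<Sum>l<n. W $$ (r, l) * S $$ (l, j)) = ip {..<n} (\<lambda>l. W $$ (r, l)) (sb j)"
        by (simp add: ip_def sb_def)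
      also have "\<dots> = ip {..<n} (T (\<lambda>l. W $$ (r, l))) (T (sb j))" by (rule rip[symmetric])
      also have "\<dots> = (\<Sum>l<n. ws l r * L $$ (l, j))"
        unfolding ip_def using r j by (intro sum.cong) (auto simp: wsT L_def)
      finally have 1: "H $$ (r, j) = a $ r * cnj (b $ j) + (\<Sum>l<n. ws l r * L $$ (l, j))" .
      have "(\<Sum>l<n. g l r * L $$ (l, j)) = (\<Sum>l<n. ws l r * L $$ (l, j)) + 
          (\<Sum>l<n. (if l = Suc k then \<tau> * mu1 R b else if l = k then \<eta> else 0) * a $ r * L $$ (l, j))"
        by (simp only: g_def distrib_right sum.distrib)
      also have "(\<Sum>l<n. (if l = Suc k then \<tau> * mu1 R b else if l = k then \<eta> else 0) * a $ r * L $$ (l, j))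
         = a $ r * (\<tau> * mu1 R b * L $$ (Suc k, j) + \<eta> * L $$ (k, j))"
        by (simp add: n_def algebra_simps)
      also have "\<tau> * mu1 R b * L $$ (Suc k, j) + \<eta> * L $$ (k, j) = cnj (b $ j)"
      proof (cases j)
        case 0
        then show ?thesis using Lrow[OF j] Lk[OF j] tau0 by (simp flip: y_sb0)
      next
        case (Suc i)
        then show ?thesis using Lrow[OF j] Lk[OF j] y_sb[of i] j by (simp add: n_def)
      qed
      finally show ?thesis using 1 by simp
    qed
    have indep: "c l = 0" if z: "\<And>r. r < nr \<Longrightarrow> (\<Sum>l<n. c l * g l r) = 0" and l: "l < n" for c l
    proof -
      \<comment> \<open>\<open>gs\<close> runs from column \<open>k\<close> down to column 0, so its
        entry \<open>i\<close> belongs to column \<open>k - i\<close>; \<open>first\<close>,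
        appended at the end, is column \<open>Suc k\<close>.\<close>
      define d where "d i = (if i = Suc k then c (Suc k) else c (k - i))" for i
      have s: "(\<Sum>i<length (gs @ [first]). d i * ((gs @ [first]) ! i) r) = (\<Sum>l<n. c l * g l r)" for r
      proof -
        have len2: "length (gs @ [first]) = Suc (Suc k)" by (simp add: len)
        have e1: "d i * ((gs @ [first]) ! i) r = c (k - i) * g (k - i) r" if "i \<in> {..<Suc k}" for i
          using that gsi[of i] by (simp add: nth_append len d_def)
        have "(gs @ [first]) ! Suc k = g (Suc k)"
          using nth_append_length[of gs first "[]"] by (simp only: len first')
        then have e2: "d (Suc k) * ((gs @ [first]) ! Suc k) r = c (Suc k) * g (Suc k) r"
          by (simp add: d_def)
        have "(\<Sum>i<length (gs @ [first]). d i * ((gs @ [first]) ! i) r) = (\<Sum>i<Suc k. c (k - i) * g (k - i) r) + c (Suc k) * g (Suc k) r"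
          unfolding len2 sum.lessThan_Suc[of _ "Suc k"] e2
          by (intro arg_cong2[where f="(+)"] sum.cong refl e1)
        also have "(\<Sum>i<Suc k. c (k - i) * g (k - i) r) = (\<Sum>l<Suc k. c l * g l r)"
          using sum.nat_diff_reindex[of "\<lambda>l. c l * g l r" "Suc k"] by (simp del: sum.lessThan_Suc)
        finally show ?thesis by (simp add: n_def)
      qed
      have d0: "d i = 0" if "i < Suc (Suc k)" for i
        by (rule nondeg_independent[OF nd]) (use s z len that in auto)
      show ?thesis
      proof (cases "l = Suc k")
        case True
        then show ?thesis using d0[of "Suc k"] by (simp add: d_def)
      next
        case False
        then have "l \<le> k" using l by (simp add: n_def)
        moreover have "k - l < Suc (Suc k)" "k - l \<noteq> Suc k" by simp_all
        ultimately show ?thesis using d0[of "k - l"] by (simp only: d_def if_False diff_diff_cancel)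
      qed
    qed
    define B where "B = mat_adjoint H * H"
    have Bc: "B \<in> carrier_mat n n" unfolding B_def by (rule mult_carrier_mat[OF mat_adjoint_carrier[OF Hc] Hc])
    have Hx: "(H *\<^sub>v x) $ r = (\<Sum>l<n. (L *\<^sub>v x) $ l * g l r)" if x: "x \<in> carrier_vec n" and r: "r < nr" for x r
    proof -
      have "(H *\<^sub>v x) $ r = (\<Sum>j<n. \<Sum>l<n. g l r * L $$ (l, j) * x $ j)"
        using Hc x r by (simp add: scalar_prod_def atLeast0LessThan Hg sum_distrib_right)
      also have "\<dots> = (\<Sum>l<n. \<Sum>j<n. g l r * L $$ (l, j) * x $ j)" by (rule sum.swap)
      also have "\<dots> = (\<Sum>l<n. (L *\<^sub>v x) $ l * g l r)"
        using Lc x by (simp add: scalar_prod_def atLeast0LessThan sum_distrib_left mult_ac)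
      finally show ?thesis .
    qed
    \<comment> \<open>A kernel vector of \<open>B\<close> is one of \<open>H\<close>. But
      \<open>H\<close> is injective, since the columns \<open>g l\<close> are independent and
      \<open>L\<close> is invertible.\<close>
    have "det B \<noteq> 0"
    proof
      assume "det B = 0"
      then obtain x where x: "x \<in> carrier_vec n" "x \<noteq> 0\<^sub>v n" "B *\<^sub>v x = 0\<^sub>v n"
        using det_0_iff_vec_prod_zero_field[OF Bc] by auto
      have Hxc: "H *\<^sub>v x \<in> carrier_vec nr" using Hc x by simp
      have "mat_adjoint H *\<^sub>v (H *\<^sub>v x) = 0\<^sub>v n"
        using assoc_mult_mat_vec[OF mat_adjoint_carrier[OF Hc] Hc x(1)] x(3) by (simp add: B_def)
      then have "(H *\<^sub>v x) \<bullet>c (H *\<^sub>v x) = x \<bullet>c (0\<^sub>v n)"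
        using adjoint_cscalar[OF Hc x(1) Hxc] by simp
      also have "\<dots> = 0" using x(1) by (simp add: scalar_prod_def)
      finally have H0: "H *\<^sub>v x = 0\<^sub>v nr" using cscalar_self_eq_0[OF Hxc] by simp
      have L0: "(L *\<^sub>v x) $ l = 0" if "l < n" for l
        by (rule indep[OF _ that]) (use Hx[OF x(1)] H0 in auto)
      have "L *\<^sub>v x = 0\<^sub>v n" by (rule eq_vecI) (use L0 Lc in auto)
      then have "Li *\<^sub>v (L *\<^sub>v x) = 0\<^sub>v n" using Lic by (intro eq_vecI) auto
      then have "x = 0\<^sub>v n" using assoc_mult_mat_vec[OF Lic Lc x(1)] LiL x(1) by simp
      then show False using x(2) by simp
    qed
    note Bi = mat_inv_props[OF Bc this]
    \<comment> \<open>For this \<open>x\<close> the vector \<open>w = H x\<close> satisfies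
      \<open>H^H w = e_0\<close>, hence is orthogonal to every \<open>g l\<close> with
      \<open>l \<le> k\<close>. Divided by \<open>u (Suc k)\<close>, its coefficient at
      \<open>first\<close>, it meets the conditions of \<open>residual_eqI\<close>.\<close>
    define x where "x = col (mat_inv B) 0"
    have x: "x \<in> carrier_vec n" using Bi(1) n0 by (auto simp: x_def)
    define u where "u l = (L *\<^sub>v x) $ l" for l
    define w where "w r = (\<Sum>l<n. u l * g l r)" for r
    have wH: "w r = (H *\<^sub>v x) $ r" if "r < nr" for r using Hx[OF x that] by (simp add: w_def u_def)
    have Bx: "(\<Sum>r<nr. cnj (H $$ (r, j)) * w r) = (if j = 0 then 1 else 0)" if j: "j < n" for j
    proof -
      have "B *\<^sub>v x = col (1\<^sub>m n) 0"
        unfolding x_def using col_mult2[OF Bc Bi(1) n0] Bi(2) by simp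
      then have "(B *\<^sub>v x) $ j = (if j = 0 then 1 else 0)" using j n0 by simp
      moreover have "B *\<^sub>v x = mat_adjoint H *\<^sub>v (H *\<^sub>v x)"
        unfolding B_def by (rule assoc_mult_mat_vec[OF mat_adjoint_carrier[OF Hc] Hc x])
      moreover have "(mat_adjoint H *\<^sub>v (H *\<^sub>v x)) $ j = (\<Sum>r<nr. cnj (H $$ (r, j)) * (H *\<^sub>v x) $ r)"
        using Hc j by (simp add: scalar_prod_def atLeast0LessThan)
      ultimately show ?thesis using wH by simp
    qed
    define G where "G l = ip {..<nr} w (g l)" for l
    have LG: "(\<Sum>l<n. cnj (L $$ (l, j)) * G l) = (if j = 0 then 1 else 0)" if j: "j < n" for j
    proof -
      have "(\<Sum>r<nr. cnj (H $$ (r, j)) * w r) = (\<Sum>r<nr. \<Sum>l<n. cnj (L $$ (l, j)) * (w r * cnj (g l r)))"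
        using j by (intro sum.cong) (auto simp: Hg sum_distrib_left sum_distrib_right mult_ac)
      also have "\<dots> = (\<Sum>l<n. cnj (L $$ (l, j)) * G l)"
        by (subst sum.swap) (simp add: G_def ip_def sum_distrib_left)
      finally show ?thesis using Bx[OF j] by simp
    qed
    have Gl: "G l = (if l = Suc k then cnj \<tau> else 0)" if l: "l < n" for l
    proof -
      define d where "d = vec n (\<lambda>l. G l - (if l = Suc k then cnj \<tau> else 0))"
      have dc: "d \<in> carrier_vec n" by (simp add: d_def)
      have "mat_adjoint L *\<^sub>v d = 0\<^sub>v n"
      proof (rule eq_vecI)
        fix j assume "j < dim_vec (0\<^sub>v n :: complex vec)"
        then have j: "j < n" by simp
        have "(mat_adjoint L *\<^sub>v d) $ j = (\<Sum>l<n. cnj (L $$ (l, j)) * (G l - (if l = Suc k then cnj \<tau> else 0)))"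
          using Lc j by (simp add: d_def scalar_prod_def atLeast0LessThan)
        also have "\<dots> = (\<Sum>l<n. cnj (L $$ (l, j)) * G l) - (\<Sum>l<n. if l = Suc k then cnj (L $$ (l, j)) * cnj \<tau> else 0)"
          unfolding sum_subtractf[symmetric] by (intro sum.cong) (auto simp: algebra_simps)
        also have "(\<Sum>l<n. if l = Suc k then cnj (L $$ (l, j)) * cnj \<tau> else 0) = cnj (L $$ (Suc k, j) * \<tau>)"
          by (simp add: n_def)
        also have "\<dots> = (if j = 0 then 1 else 0)" using Lrow[OF j] tau0 by simp
        finally show "(mat_adjoint L *\<^sub>v d) $ j = 0\<^sub>v n $ j" using LG[OF j] j by simp
      qed (use Lc in simp)
      then have "mat_adjoint Li *\<^sub>v (mat_adjoint L *\<^sub>v d) = 0\<^sub>v n" using Lic by (intro eq_vecI) auto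
      moreover have "mat_adjoint Li * mat_adjoint L = 1\<^sub>m n"
      proof -
        have "mat_adjoint Li * mat_adjoint L = mat_adjoint (L * Li)" by (rule mat_adjoint_mult[OF Lc Lic, symmetric])
        also have "\<dots> = 1\<^sub>m n" unfolding LLi by (rule eq_matI) auto
        finally show ?thesis .
      qed
      ultimately have "d = 0\<^sub>v n"
        using assoc_mult_mat_vec[OF mat_adjoint_carrier[OF Lic] mat_adjoint_carrier[OF Lc] dc] dc by simp
      then have "d $ l = 0" using l by simp
      then show ?thesis using l by (simp add: d_def)
    qed
    have u0: "u (Suc k) = x $ 0 / \<tau>"
    proof -
      have "u (Suc k) = (\<Sum>j<n. L $$ (Suc k, j) * x $ j)"
        using Lc x by (simp add: u_def scalar_prod_def atLeast0LessThan n_def)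
      also have "\<dots> = (\<Sum>j<n. if j = 0 then x $ j / \<tau> else 0)" by (intro sum.cong) (auto simp: Lrow)
      also have "\<dots> = x $ 0 / \<tau>" using n0 by (subst sum.delta) auto
      finally show ?thesis .
    qed
    have ww: "ip {..<nr} w w = cnj (x $ 0)"
    proof -
      have "ip {..<nr} w w = (\<Sum>r<nr. \<Sum>l<n. cnj (u l) * (w r * cnj (g l r)))"
        unfolding ip_def by (intro sum.cong refl) (simp add: w_def[of r for r] sum_distrib_left mult_ac)
      also have "\<dots> = (\<Sum>l<n. cnj (u l) * G l)"
        by (subst sum.swap) (simp add: G_def ip_def sum_distrib_left)
      also have "\<dots> = (\<Sum>l<n. if l = Suc k then cnj (u l) * cnj \<tau> else 0)" by (intro sum.cong) (auto simp: Gl)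
      also have "\<dots> = cnj (u (Suc k) * \<tau>)" by (simp add: n_def)
      finally show ?thesis using u0 tau0 by simp
    qed
    define q where "q = Re (ip {..<nr} w w)"
    have x0: "x $ 0 = of_real q"
    proof -
      have "x $ 0 = cnj (ip {..<nr} w w)" by (simp add: ww)
      also have "\<dots> = of_real q" unfolding q_def by (simp add: ip_self)
      finally show ?thesis .
    qed
    have q0: "q \<noteq> 0"
    proof
      assume "q = 0"
      then have "ip {..<nr} w w = 0" using ww x0 by simp
      then have "\<forall>r<nr. w r = 0" by (simp add: ip_self_eq_0_iff)
      then have "G (Suc k) = 0" by (simp add: G_def ip_def)
      then show False using Gl[of "Suc k"] tau0 by (simp add: n_def)
    qed
    have u1: "u (Suc k) \<noteq> 0" using u0 x0 q0 tau0 by simp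
    have "residual nr gs first = Re (ip {..<nr} (\<lambda>i. (1 / u (Suc k)) * w i) (\<lambda>i. (1 / u (Suc k)) * w i))"
    proof (rule residual_eqI[where c="\<lambda>i. u (k - i) / u (Suc k)"])
      fix r assume "r < nr"
      have "w r = (\<Sum>l<Suc k. u l * g l r) + u (Suc k) * g (Suc k) r" by (simp add: w_def n_def)
      also have "(\<Sum>l<Suc k. u l * g l r) = (\<Sum>i<Suc k. u (k - i) * (gs ! i) r)"
        using sum.nat_diff_reindex[of "\<lambda>l. u l * g l r" "Suc k"] by (simp add: gsi del: sum.lessThan_Suc)
      finally show "(1 / u (Suc k)) * w r = first r + (\<Sum>j<length gs. u (k - j) / u (Suc k) * (gs ! j) r)"
      proof -
        assume w: "w r = (\<Sum>i<Suc k. u (k - i) * (gs ! i) r) + u (Suc k) * g (Suc k) r"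
        have "(\<Sum>j<length gs. u (k - j) / u (Suc k) * (gs ! j) r) = (\<Sum>i<Suc k. u (k - i) * (gs ! i) r) / u (Suc k)"
          by (simp add: len sum_divide_distrib del: sum.lessThan_Suc)
        then show ?thesis using u1 unfolding w by (simp add: first' add_divide_distrib del: sum.lessThan_Suc)
      qed
    next
      fix j assume "j < length gs"
      then have "ip {..<nr} w (gs ! j) = 0" using Gl[of "k - j"] by (simp add: len gsi G_def n_def)
      then show "ip {..<nr} (\<lambda>i. (1 / u (Suc k)) * w i) (gs ! j) = 0"
        using ip_add_left[of "{..<nr}" "1 / u (Suc k)" w "\<lambda>_. 0" "gs ! j"] by (simp add: ip_def)
    qed
    also have "\<dots> = (cmod (1 / u (Suc k)))\<^sup>2 * q"
      unfolding q_def Re_ip_self by (simp only: norm_mult power_mult_distrib sum_distrib_left)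
    \<comment> \<open>\<open>q\<close> is both the squared norm of \<open>w\<close> and the sought
      entry \<open>x $ 0\<close>; with \<open>u (Suc k) = q / \<tau>\<close> the residual is
      \<open>|\<tau>|^2 / q\<close>.\<close>
    also have "\<dots> = \<rho> / q"
    proof -
      have "1 / u (Suc k) = \<tau> / of_real q" by (simp add: u0 x0)
      then have "(cmod (1 / u (Suc k)))\<^sup>2 = \<rho> / q\<^sup>2" by (simp add: norm_divide power_divide tau2)
      then show ?thesis using q0 by (simp add: power2_eq_square)
    qed
    finally have "residual nr gs first = \<rho> / q" .
    moreover have "Re (mat_inv B $$ (0, 0)) = q"
      using x0 Bi(1) n0 by (simp add: x_def)
    ultimately show ?thesis using q0 \<rho>0 by (simp add: B_def)
  qed
  then show ?thesis
    using T(1) \<rho>0 tau2 eta2 unfolding Let_def by (intro exI[of _ T] exI[of _ \<tau>] exI[of _ \<eta>]) auto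
qed

subsection \<open>The law of the signal-to-noise ratio\<close>

lemma measurable_det:
  assumes "\<And>i j. i < n \<Longrightarrow> j < n \<Longrightarrow> (\<lambda>\<omega>. f \<omega> i j) \<in> borel_measurable M"
  shows "(\<lambda>\<omega>. Determinant.det (mat n n (\<lambda>(i, j). f \<omega> i j :: complex))) \<in> borel_measurable M"
proof -
  have "Determinant.det (mat n n (\<lambda>(i, j). f \<omega> i j)) = (\<Sum>p | p permutes {0..<n}. signof p * (\<Prod>i = 0..<n. f \<omega> i (p i)))" for \<omega>
    by (subst det_def') (auto intro!: sum.cong prod.cong simp: permutes_in_image)
  moreover have "(\<lambda>\<omega>. \<Sum>p | p permutes {0..<n}. signof p * (\<Prod>i = 0..<n. f \<omega> i (p i))) \<in> borel_measurable M"
  proof (intro borel_measurable_sum borel_measurable_times borel_measurable_prod borel_measurable_const)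
    fix p i assume "p \<in> {p. p permutes {0..<n}}" "i \<in> {0..<n}"
    then show "(\<lambda>\<omega>. f \<omega> i (p i)) \<in> borel_measurable M"
      using assms permutes_in_image[of p "{0..<n}" i] by auto
  qed
  ultimately show ?thesis by simp
qed

text \<open>Cramer's rule together with the singular case, where \<open>mat_inv\<close> takes a
  fixed though unspecified value. This makes \<open>zf_snr\<close> measurable on the whole space,
  including the null set of singular Gram matrices.\<close>

lemma mat_inv_00:
  assumes B: "(B :: complex mat) \<in> carrier_mat (Suc n) (Suc n)"
  shows "mat_inv B $$ (0, 0) = (if det B = 0 then the None $$ (0, 0) else det (mat_delete B 0 0) / det B)"
proof (cases "det B = 0")
  case True
  have "mat_inverse B = None"
  proof (rule ccontr)
    assume "mat_inverse B \<noteq> None"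
    then obtain C where "mat_inverse B = Some C" by auto
    then have C: "B * C = 1\<^sub>m (Suc n)" "C \<in> carrier_mat (Suc n) (Suc n)" using mat_inverse(2)[OF B] by auto
    have "det B * det C = 1" using det_mult[OF B C(2)] C(1) by simp
    then show False using True by simp
  qed
  then show ?thesis using True by (simp add: mat_inv_def)
next
  case False
  note Bi = mat_inv_props[OF B False]
  have "mat_inv B * (B * adj_mat B) = adj_mat B"
    using assoc_mult_mat[OF Bi(1) B adj_mat(1)[OF B]] Bi adj_mat(1)[OF B] by simp
  then have "mat_inv B * (det B \<cdot>\<^sub>m 1\<^sub>m (Suc n)) = adj_mat B" by (simp only: adj_mat(2)[OF B])
  moreover have "mat_inv B * (det B \<cdot>\<^sub>m 1\<^sub>m (Suc n)) = det B \<cdot>\<^sub>m mat_inv B"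
    using mult_smult_distrib[OF Bi(1), of "1\<^sub>m (Suc n)" "Suc n" "det B"] Bi(1) by simp
  ultimately have "det B * mat_inv B $$ (0, 0) = adj_mat B $$ (0, 0)"
    using Bi(1) by (metis carrier_matD(1) carrier_matD(2) index_smult_mat(1) zero_less_Suc)
  also have "\<dots> = det (mat_delete B 0 0)" using B by (simp add: adj_mat_def cofactor_def)
  finally show ?thesis using False by (simp add: field_simps)
qed

lemma measurable_zf_snr:
  assumes H: "\<And>\<omega>. \<omega> \<in> space M \<Longrightarrow> H \<omega> \<in> carrier_mat nr (Suc n)"
    and m: "\<And>i j. i < nr \<Longrightarrow> j < Suc n \<Longrightarrow> (\<lambda>\<omega>. H \<omega> $$ (i, j)) \<in> borel_measurable M"
  shows "(\<lambda>\<omega>. zf_snr \<Gamma>s (H \<omega>)) \<in> borel_measurable M"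
proof -
  define f where "f \<omega> i j = (\<Sum>r<nr. cnj (H \<omega> $$ (r, i)) * H \<omega> $$ (r, j))" for \<omega> i j
  have fm: "(\<lambda>\<omega>. f \<omega> i j) \<in> borel_measurable M" if "i < Suc n" "j < Suc n" for i j
  proof -
    have "cnj \<in> borel_measurable borel" by (intro borel_measurable_continuous_onI continuous_intros)
    then have "(\<lambda>\<omega>. cnj (H \<omega> $$ (r, i))) \<in> borel_measurable M" if "r < nr" for r
      using measurable_compose[OF m[OF that \<open>i < Suc n\<close>]] by auto
    then show ?thesis unfolding f_def using m that by (intro borel_measurable_sum borel_measurable_times) auto
  qed
  define d where "d \<omega> = det (mat (Suc n) (Suc n) (\<lambda>(i, j). f \<omega> i j))" for \<omega>
  define e where "e \<omega> = det (mat n n (\<lambda>(i, j). f \<omega> (Suc i) (Suc j)))" for \<omega>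
  have [measurable]: "d \<in> borel_measurable M" "e \<in> borel_measurable M"
    unfolding d_def e_def by (rule measurable_det, use fm in auto)+
  have "zf_snr \<Gamma>s (H \<omega>) = \<Gamma>s / Re (if d \<omega> = 0 then the None $$ (0, 0) else e \<omega> / d \<omega>)" if "\<omega> \<in> space M" for \<omega>
  proof -
    have Hc: "H \<omega> \<in> carrier_mat nr (Suc n)" using H that .
    have 1: "mat_adjoint (H \<omega>) * H \<omega> = mat (Suc n) (Suc n) (\<lambda>(i, j). f \<omega> i j)"
      by (rule eq_matI) (use Hc in \<open>auto simp: f_def scalar_prod_def atLeast0LessThan\<close>)
    have 2: "mat_delete (mat (Suc n) (Suc n) (\<lambda>(i, j). f \<omega> i j)) 0 0 = mat n n (\<lambda>(i, j). f \<omega> (Suc i) (Suc j))"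
      by (rule eq_matI) (auto simp: mat_delete_def)
    have 3: "mat (Suc n) (Suc n) (\<lambda>(i, j). f \<omega> i j) \<in> carrier_mat (Suc n) (Suc n)" by simp
    show ?thesis
      unfolding zf_snr_def 1 mat_inv_00[OF 3] 2 d_def e_def ..
  qed
  moreover have "(\<lambda>\<omega>. \<Gamma>s / Re (if d \<omega> = 0 then the None $$ (0, 0) else e \<omega> / d \<omega>)) \<in> borel_measurable M"
    by measurable
  ultimately show ?thesis by (subst measurable_cong) auto
qed

lemma hermitian_pos_def_smult:
  assumes "hermitian_pos_def n A" "c > 0"
  shows "hermitian_pos_def n (complex_of_real c \<cdot>\<^sub>m A)"
proof -
  have A: "A \<in> carrier_mat n n" "mat_adjoint A = A" using assms by (auto simp: hermitian_pos_def_def hermitian_mat_def)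
  have cA: "complex_of_real c \<cdot>\<^sub>m A \<in> carrier_mat n n" using A by simp
  have "mat_adjoint (complex_of_real c \<cdot>\<^sub>m A) = complex_of_real c \<cdot>\<^sub>m A"
    by (rule eq_matI) (use A hermitian_entry[OF A] in auto)
  moreover have "0 < Re ((complex_of_real c \<cdot>\<^sub>m A *\<^sub>v v) \<bullet>c v)" if v: "v \<in> carrier_vec n" "v \<noteq> 0\<^sub>v n" for v
  proof -
    have "(complex_of_real c \<cdot>\<^sub>m A *\<^sub>v v) \<bullet>c v = complex_of_real c * ((A *\<^sub>v v) \<bullet>c v)"
      unfolding quad_form_sum[OF cA v(1)] quad_form_sum[OF A(1) v(1)] using A(1)
      by (simp add: sum_distrib_left mult_ac)
    then show ?thesis using assms v by (simp add: hermitian_pos_def_def)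
  qed
  ultimately show ?thesis using A by (simp add: hermitian_pos_def_def hermitian_mat_def)
qed

theorem mainTheorem2:
  fixes M :: "'w measure" and Hw :: "'w \<Rightarrow> complex mat"
    and NT NR N :: nat and K \<Gamma>s G x1 x2 :: real
    and RT R :: "complex mat" and a b :: "complex vec"
    and \<gamma>1 :: "'w \<Rightarrow> real"
  assumes "NT \<ge> 2" and "NR \<ge> NT" and N: "N = NR - NT + 1"
    and "K > 0" and "\<Gamma>s > 0"
    and "hermitian_pos_def NT RT" and "(\<Sum>i<NT. RT $$ (i,i)) = of_nat NT"
    and R: "R = complex_of_real (1 / (K + 1)) \<cdot>\<^sub>m RT"
    and "a \<in> carrier_vec NR" and "euclid_norm a = 1"
    and "b \<in> carrier_vec NT" and "\<forall>j<NT. b $ j \<noteq> 0"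
    and "(euclid_norm b)\<^sup>2 = K / (K + 1) * real NR * real NT"
    and "prob_space M" and "iid_std_complex_normal_mat M NR NT Hw"
    and \<gamma>1: "\<gamma>1 = (\<lambda>\<omega>. zf_snr \<Gamma>s (rician_channel a b R Hw \<omega>))"
    and G: "G = Gamma1 \<Gamma>s R" and x1: "x1 = par_x1 R b" and x2: "x2 = par_x2 R b"
  shows "(\<forall>s::complex. Re s < 1 / G \<longrightarrow>
            integrable M (\<lambda>\<omega>. exp (s * complex_of_real (\<gamma>1 \<omega>))) \<and>
            S_convergent N NR x1 x2 (alt_binom_sum (M_nm N G s)) \<and>
            (\<integral>\<omega>. exp (s * complex_of_real (\<gamma>1 \<omega>)) \<partial>M)
              = S_sum N NR x1 x2 (alt_binom_sum (M_nm N G s)))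
       \<and> (\<exists>p :: real \<Rightarrow> real.
            (\<forall>t. 0 \<le> p t) \<and>
            distributed M lborel \<gamma>1 (\<lambda>t. ennreal (p t)) \<and>
            (\<forall>t>0. S_convergent N NR x1 x2 (alt_binom_sum (p_nm N G t)) \<and>
                   p t = S_sum N NR x1 x2 (alt_binom_sum (p_nm N G t))) \<and>
            (\<forall>\<tau>>0. S_convergent N NR x1 x2 (alt_binom_sum (Po_nm N G \<tau>)) \<and>
                   (LBINT t:{0..\<tau>}. p t)
                     = S_sum N NR x1 x2 (alt_binom_sum (Po_nm N G \<tau>))) \<and>
            set_integrable lborel {0..} (\<lambda>t. ln (1 + t) * p t) \<and>
            S_convergent N NR x1 x2 (alt_binom_sum (C_nm N G)) \<and>
            1 / ln 2 * (LBINT t:{0..}. ln (1 + t) * p t)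
              = S_sum N NR x1 x2 (alt_binom_sum (C_nm N G)))"
proof -
  interpret prob_space M by fact
  \<comment> \<open>The number of central interfering columns after the reduction; the other two
    columns are the interfering one with a mean and the desired one.\<close>
  define k where "k = NT - 2"
  define m where "m = NR - NT"
  have NT: "NT = Suc (Suc k)" and NR: "NR = Suc k + Suc m" and Nm: "N = Suc m"
    using assms(1,2) N by (auto simp: k_def m_def)
  have "hermitian_pos_def NT R"
    unfolding R using assms(4,6) by (intro hermitian_pos_def_smult) auto
  then have Rp: "hermitian_pos_def (Suc (Suc k)) R" by (simp add: NT)
  define \<rho> where "\<rho> = Re (mat_inv R $$ (0,0))"
  have bc: "b \<in> carrier_vec (Suc (Suc k))" using assms NT by simp
  obtain T \<tau> \<eta> where red0: "rot {..<Suc (Suc k)} T \<and> \<rho> > 0 \<and> (cmod \<tau>)\<^sup>2 = \<rho> \<and> (cmod \<eta>)\<^sup>2 = par_x2 R b \<and>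
    (\<forall>W\<in>carrier_mat NR (Suc (Suc k)). let ws = rotated_cols NR (Suc (Suc k)) T W; 
        first = (\<lambda>i. ws (Suc k) i + (\<tau> * mu1 R b) * a $ i);
        gs = (\<lambda>i. ws k i + \<eta> * a $ i) # col_list k ws;
        H = outer_prod a b + W * hermitian_sqrt R
      in nondeg NR (gs @ [first]) \<longrightarrow> Re (mat_inv (mat_adjoint H * H) $$ (0,0)) = \<rho> / residual NR gs first)"
    using channel_reduction[OF Rp assms(9) bc] unfolding \<rho>_def[symmetric] by (elim exE)
  then have T: "rot {..<Suc (Suc k)} T" and \<rho>: "\<rho> > 0" and \<tau>: "(cmod \<tau>)\<^sup>2 = \<rho>" and \<eta>: "(cmod \<eta>)\<^sup>2 = x2"
    unfolding x2 by (auto simp only:)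
  define \<kappa> where "\<kappa> = \<tau> * mu1 R b"
  have a1: "ip {..<NR} (($) a) (($) a) = 1"
  proof -
    have "(\<Sum>i<NR. (cmod (a $ i))\<^sup>2) = 1"
      using assms(9,10) by (simp add: euclid_norm_def)
    then show ?thesis by (simp add: ip_self del: of_real_sum of_real_power)
  qed
  interpret C: column_law NR k m "($) a" \<eta> \<kappa>
    by unfold_locales (use NR a1 in auto)
  have G\<rho>: "G = \<Gamma>s / \<rho>" unfolding G Gamma1_def \<rho>_def ..
  have G0: "G > 0" using \<rho> assms(5) by (simp add: G\<rho>)
  have x1\<kappa>: "(cmod \<kappa>)\<^sup>2 = x1"
    unfolding \<kappa>_def x1 par_x1_def \<rho>_def[symmetric] by (simp add: norm_mult power_mult_distrib \<tau>)
  \<comment> \<open>The mixing variable lives on the space of the \<open>Suc k\<close> interfering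
    columns; \<open>M\<close> is tied to it through the law of \<open>ws\<close> only.\<close>
  interpret P: noncentral_mixture "CM NR (Suc k)" C.\<beta> N NR x1 x2 G
  proof (intro noncentral_mixture.intro prob_space_CM noncentral_mixture_axioms.intro)
    show "C.\<beta> \<in> borel_measurable (CM NR (Suc k))" by (rule C.measurable_\<beta>) simp
    show "0 \<le> C.\<beta> ws" "C.\<beta> ws \<le> 1" for ws by (rule C.\<beta>_bounds)+
    show "0 \<le> x1" unfolding x1\<kappa>[symmetric] by (rule zero_le_power2)
    show "0 \<le> x2" unfolding \<eta>[symmetric] by (rule zero_le_power2)
    show "(\<integral>\<^sup>+ws. ennreal (C.\<beta> ws ^ j) \<partial>CM NR (Suc k))
      = (\<Sum>i. ennreal (pois x2 i * (pochhammer (real N) j / pochhammer (real (NR + i)) j)))" for j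
      using C.\<beta>_moment[of j] unfolding \<eta> Nm .
  qed (use G0 NR Nm in auto)
  have Wc: "Hw \<omega> \<in> carrier_mat NR (Suc (Suc k))" if "\<omega> \<in> space M" for \<omega>
    using assms(15) that by (simp add: iid_std_complex_normal_mat_def NT)
  define ws where "ws \<omega> = rotated_cols NR (Suc (Suc k)) T (Hw \<omega>)" for \<omega>
  have iid: "iid_std_complex_normal_mat M NR (Suc (Suc k)) Hw" using assms(15) by (simp add: NT)
  have NR0: "NR > 0" using NR by simp
  have wsm: "ws \<in> measurable M (CM NR (Suc (Suc k)))" and wsd: "distr M (CM NR (Suc (Suc k))) ws = CM NR (Suc (Suc k))"
    unfolding ws_def[abs_def] using distr_rotated_cols[OF assms(14) iid _ NR0 T] by auto
  have \<gamma>m: "\<gamma>1 \<in> borel_measurable M"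
    unfolding \<gamma>1
  proof (rule measurable_zf_snr[where nr=NR and n="Suc k"])
    have Sc: "hermitian_sqrt R \<in> carrier_mat (Suc (Suc k)) (Suc (Suc k))" by (rule hermitian_sqrt_props(1)[OF Rp])
    show "rician_channel a b R Hw \<omega> \<in> carrier_mat NR (Suc (Suc k))" if "\<omega> \<in> space M" for \<omega>
      using Wc[OF that] Sc assms(9) bc by (simp add: rician_channel_def outer_prod_def)
    fix i j assume ij: "i < NR" "j < Suc (Suc k)"
    have "rician_channel a b R Hw \<omega> $$ (i, j) = a $ i * cnj (b $ j) + (\<Sum>l<Suc (Suc k). Hw \<omega> $$ (i, l) * hermitian_sqrt R $$ (l, j))"
      if "\<omega> \<in> space M" for \<omega>
      using Wc[OF that] Sc assms(9) bc ij
      by (simp add: rician_channel_def outer_prod_def scalar_prod_def atLeast0LessThan del: sum.lessThan_Suc)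
    moreover have "(\<lambda>\<omega>. a $ i * cnj (b $ j) + (\<Sum>l<Suc (Suc k). Hw \<omega> $$ (i, l) * hermitian_sqrt R $$ (l, j))) \<in> borel_measurable M"
    proof (intro borel_measurable_add borel_measurable_sum borel_measurable_times borel_measurable_const)
      fix l assume "l \<in> {..<Suc (Suc k)}"
      then show "(\<lambda>\<omega>. Hw \<omega> $$ (i, l)) \<in> borel_measurable M"
        using iid ij by (auto simp: iid_std_complex_normal_mat_def std_complex_normal_def distributed_def)
    qed
    ultimately show "(\<lambda>\<omega>. rician_channel a b R Hw \<omega> $$ (i, j)) \<in> borel_measurable M"
      by (subst measurable_cong) auto
  qed
  \<comment> \<open>Only almost everywhere, since \<open>channel_reduction\<close> speaks of
    nondegenerate columns.\<close>
  have rep: "AE \<omega> in M. \<gamma>1 \<omega> = G * residual NR (C.noise_cols (ws \<omega>)) (C.first_col (ws \<omega>))"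
  proof -
    have "AE \<omega> in M. nondeg NR (C.noise_cols (ws \<omega>) @ [C.first_col (ws \<omega>)])"
      by (rule AE_distrD[OF wsm]) (unfold wsd, rule C.AE_nondeg_first)
    then show ?thesis
    proof (rule AE_mp, intro AE_I2 impI)
      fix \<omega> assume \<omega>: "\<omega> \<in> space M" and nd: "nondeg NR (C.noise_cols (ws \<omega>) @ [C.first_col (ws \<omega>)])"
      have "Re (mat_inv (mat_adjoint (rician_channel a b R Hw \<omega>) * rician_channel a b R Hw \<omega>) $$ (0,0)) 
         = \<rho> / residual NR (C.noise_cols (ws \<omega>)) (C.first_col (ws \<omega>))"
        using red0 nd Wc[OF \<omega>]
        unfolding Let_def C.first_col_def C.noise_cols_def
        unfolding \<kappa>_def rician_channel_def ws_def by blast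
      then show "\<gamma>1 \<omega> = G * residual NR (C.noise_cols (ws \<omega>)) (C.first_col (ws \<omega>))"
        by (simp add: \<gamma>1 zf_snr_def G\<rho>)
    qed
  qed
  have dist: "distributed M lborel \<gamma>1 (\<lambda>t. ennreal (P.dens t))"
  proof (rule P.distributed_dens[OF \<gamma>m])
    fix F :: "real \<Rightarrow> ennreal" assume F[measurable]: "F \<in> borel_measurable borel"
    note [measurable] = C.measurable_first
    have "(\<integral>\<^sup>+\<omega>. F (\<gamma>1 \<omega>) \<partial>M) = (\<integral>\<^sup>+\<omega>. F (G * residual NR (C.noise_cols (ws \<omega>)) (C.first_col (ws \<omega>))) \<partial>M)"
      by (rule nn_integral_cong_AE) (use rep in eventually_elim, simp)
    also have "\<dots> = (\<integral>\<^sup>+w. F (G * residual NR (C.noise_cols w) (C.first_col w)) \<partial>distr M (CM NR (Suc (Suc k))) ws)"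
      by (subst nn_integral_distr[OF wsm]) simp_all
    also have "\<dots> = (\<Sum>i. (\<integral>\<^sup>+w. ennreal (pois (x1 * C.\<beta> w) i) \<partial>CM NR (Suc k)) * (\<integral>\<^sup>+t. F (G * t) * ennreal (erlang_density (m + i) 1 t) \<partial>lborel))"
      unfolding wsd using C.first_law[of "\<lambda>t. F (G * t)"] by (simp add: x1\<kappa>)
    finally show "(\<integral>\<^sup>+\<omega>. F (\<gamma>1 \<omega>) \<partial>M) = (\<Sum>i. (\<integral>\<^sup>+w. ennreal (pois (x1 * C.\<beta> w) i) \<partial>CM NR (Suc k)) * (\<integral>\<^sup>+t. F (G * t) * ennreal (erlang_density (N - 1 + i) 1 t) \<partial>lborel))"
      by (simp add: Nm)
  qed
  show ?thesis
  proof (intro conjI exI[of _ P.dens] allI impI)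
    fix s :: complex assume s: "Re s < 1 / G"
    show "integrable M (\<lambda>\<omega>. exp (s * complex_of_real (\<gamma>1 \<omega>)))" by (rule P.distributed_mgf(1)[OF dist s])
    show "S_convergent N NR x1 x2 (alt_binom_sum (M_nm N G s))" by (rule P.dens_mgf(1)[OF s])
    show "(\<integral>\<omega>. exp (s * complex_of_real (\<gamma>1 \<omega>)) \<partial>M) = S_sum N NR x1 x2 (alt_binom_sum (M_nm N G s))"
      by (rule P.distributed_mgf(2)[OF dist s])
  next
    fix t :: real assume t: "t > 0"
    show "S_convergent N NR x1 x2 (alt_binom_sum (p_nm N G t))" by (rule P.dens_pointwise(1)[OF t])
    show "P.dens t = S_sum N NR x1 x2 (alt_binom_sum (p_nm N G t))" by (rule P.dens_pointwise(2)[OF t])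
  qed (rule P.dens_nonneg dist P.dens_outage P.dens_capacity)+
qed

end
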